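(* Let $\Omega \subset \mathbb{R}^n$ be a smooth bounded domain, let $D \in C^1(\Omega)$ be uniformly positive, and let $\sigma \in C(\Omega)$ be nonnegative. Suppose $f_1, f_2 \in C(\partial \Omega)$ with $f_2$ positive and $f_1/f_2$ not constant. Let $u_1$ and $u_2$ be the solutions to $$D \Delta u + \nabla D \cdot \nabla u - \sigma u = 0 \quad \text{in } \Omega$$ with $u_1 = f_1$ and $u_2 = f_2$ on $\partial \Omega$, and let $X$ be the vector field defined by $$X := u_2 \nabla u_1 - u_1 \nabla u_2 .$$ Then the union of the integral curves of $X$ that intersect the boundary of $\Omega$ is dense in $\Omega$.
   Context: The equation is the expanded form of $\nabla \cdot D \nabla u - \sigma u = 0$. An integral curve of $X$ is a curve $\gamma : [0,b] \to \overline{\Omega}$ defined by $\dot{\gamma}(t) = X(\gamma(t))$. The union of the integral curves of $X$ that intersect the boundary is the set of all $y \in \overline{\Omega}$ for which there is an integral curve $\gamma:[0,b]\to\overline{\Omega}$ of $X$ whose image contains both $y$ and some point of $\partial\Omega$.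
   Formalization: D is additionally assumed bounded on Ω (automatic if D is C¹ up to the boundary); for unbounded D the claim fails, e.g. Ω=(0,1), D=1/(x(1−x)), σ=0, u₂=1, u₁=x²/2−x³/3, where X=x(1−x) never reaches the boundary in finite time. *)

theory Defs
  imports "HOL-Analysis.Analysis"
begin

definition grad :: "('a::euclidean_space \<Rightarrow> real) \<Rightarrow> 'a \<Rightarrow> 'a" where
  "grad f x = (THE g. GDERIV f x :> g)"

(* C^k on an open set U; behaviour towards the frontier of U is not restricted. *)
primrec C_k_on :: "nat \<Rightarrow> ('a::euclidean_space \<Rightarrow> real) \<Rightarrow> 'a set \<Rightarrow> bool" where
  "C_k_on 0 f U \<longleftrightarrow> continuous_on U f"
| "C_k_on (Suc k) f U \<longleftrightarrow>
     (\<exists>g. (\<forall>x\<in>U. GDERIV f x :> g x) \<and> (\<forall>i\<in>Basis. C_k_on k (\<lambda>x. g x \<bullet> i) U))"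

definition smooth_on :: "('a::euclidean_space \<Rightarrow> real) \<Rightarrow> 'a set \<Rightarrow> bool" where
  "smooth_on f U \<longleftrightarrow> (\<forall>k. C_k_on k f U)"

(* Smoothness of the frontier is expressed by local defining functions. *)
definition smooth_bounded_domain :: "'a::euclidean_space set \<Rightarrow> bool" where
  "smooth_bounded_domain \<Omega> \<longleftrightarrow>
     open \<Omega> \<and> connected \<Omega> \<and> \<Omega> \<noteq> {} \<and> bounded \<Omega> \<and>
     (\<forall>p\<in>frontier \<Omega>. \<exists>U \<rho>. open U \<and> p \<in> U \<and> smooth_on \<rho> U \<and>
        (\<forall>x\<in>U. grad \<rho> x \<noteq> 0) \<and> \<Omega> \<inter> U = {x\<in>U. \<rho> x < 0})"

definition C1_test_function :: "'a::euclidean_space set \<Rightarrow> ('a \<Rightarrow> real) \<Rightarrow> bool" where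
  "C1_test_function \<Omega> \<phi> \<longleftrightarrow> C_k_on 1 \<phi> UNIV \<and>
     compact (closure {x. \<phi> x \<noteq> 0}) \<and> closure {x. \<phi> x \<noteq> 0} \<subseteq> \<Omega>"

(* L is the Laplacian of u on \<Omega> in the weak sense. For u of class C^2 this is the
   pointwise Laplacian (integration by parts), up to a null set. *)
definition weak_laplacian :: "'a::euclidean_space set \<Rightarrow> ('a \<Rightarrow> real) \<Rightarrow> ('a \<Rightarrow> real) \<Rightarrow> bool" where
  "weak_laplacian \<Omega> u L \<longleftrightarrow>
     (\<forall>K. compact K \<and> K \<subseteq> \<Omega> \<longrightarrow> L absolutely_integrable_on K) \<and>
     (\<forall>\<phi>. C1_test_function \<Omega> \<phi> \<longrightarrow>
        integral \<Omega> (\<lambda>x. L x * \<phi> x) = - integral \<Omega> (\<lambda>x. grad u x \<bullet> grad \<phi> x))"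

(* Solution of the Dirichlet problem for D \<Delta>u + \<nabla>D \<bullet> \<nabla>u - \<sigma> u = 0. For D only C^1 and
   \<sigma> only continuous, solutions need not be C^2, but they are C^1 in \<Omega> by elliptic
   regularity (L^p theory), so \<nabla>D and \<nabla>u are classical and only \<Delta>u is taken weakly.
   Classical C^2 solutions are included. The value of L on a null set is immaterial to
   weak_laplacian, hence the equation can be required at every point. *)
definition dirichlet_solution ::
  "'a::euclidean_space set \<Rightarrow> ('a \<Rightarrow> real) \<Rightarrow> ('a \<Rightarrow> real) \<Rightarrow> ('a \<Rightarrow> real) \<Rightarrow> ('a \<Rightarrow> real) \<Rightarrow> bool" where
  "dirichlet_solution \<Omega> D \<sigma> f u \<longleftrightarrow>
     continuous_on (closure \<Omega>) u \<and> C_k_on 1 u \<Omega> \<and>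
     (\<exists>L. weak_laplacian \<Omega> u L \<and>
        (\<forall>x\<in>\<Omega>. D x * L x + grad D x \<bullet> grad u x - \<sigma> x * u x = 0)) \<and>
     (\<forall>x\<in>frontier \<Omega>. u x = f x)"

(* Integral curve [0,b] \<rightarrow> closure \<Omega> of a field X on \<Omega>. At points of the frontier the
   equation refers to the continuous extension of X, wherever that extension exists
   (it need not exist everywhere, as the boundary data are merely continuous). *)
definition integral_curve :: "'a::euclidean_space set \<Rightarrow> ('a \<Rightarrow> 'a) \<Rightarrow> real \<Rightarrow> (real \<Rightarrow> 'a) \<Rightarrow> bool" where
  "integral_curve \<Omega> X b \<gamma> \<longleftrightarrow>
     0 \<le> b \<and> continuous_on {0..b} \<gamma> \<and> \<gamma> ` {0..b} \<subseteq> closure \<Omega> \<and>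
     (\<forall>t\<in>{0..b}. \<gamma> t \<in> \<Omega> \<longrightarrow>
        (\<gamma> has_vector_derivative X (\<gamma> t)) (at t within {0..b})) \<and>
     (\<forall>t\<in>{0..b}. \<forall>v. \<gamma> t \<in> frontier \<Omega> \<and> (X \<longlongrightarrow> v) (at (\<gamma> t) within \<Omega>) \<longrightarrow>
        (\<gamma> has_vector_derivative v) (at t within {0..b}))"

definition boundary_curves_union :: "'a::euclidean_space set \<Rightarrow> ('a \<Rightarrow> 'a) \<Rightarrow> 'a set" where
  "boundary_curves_union \<Omega> X =
     {y\<in>closure \<Omega>. \<exists>b \<gamma>. integral_curve \<Omega> X b \<gamma> \<and> y \<in> \<gamma> ` {0..b} \<and>
        \<gamma> ` {0..b} \<inter> frontier \<Omega> \<noteq> {}}"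

end

theory Submission
  imports Defs "HOL-Complex_Analysis.Great_Picard"
begin

text \<open>
The field $V = D X$ is divergence free in the weak sense, and $w = u_1 / u_2$ strictly increases along $X$
wherever $X$ does not vanish, since $\nabla w = X / u_2^2$; here $u_2 > 0$ by the minimum principle. If $X$
vanished on a ball, then $u_1 - k u_2$ would vanish there for a constant $k$, hence everywhere by unique
continuation, and $f_1 / f_2$ would be constant.

So let $X(y) \neq 0$. As solutions of the differential equation need not be unique for a merely continuous
field, Poincare recurrence is applied to a discretisation: the step $x \mapsto x + h W(x)$, with a smooth
divergence free $W$ close to $V$ on a compact $K$, preserves volume up to $O(h^2)$. Thus some
polygon that ends near $y$ either starts near the complement of $K$ or starts near $y$ at least a time $\tau$
earlier. Bounding $\int |V|^2$ along polygons by the oscillation of $w$ makes them equicontinuous. A limit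
curve that stayed in $\Omega$ would return to the neighbourhood of $y$, which the gain of $w$ during the time
$\tau$ forbids. Hence the curve comes from the frontier. Dividing by $D$ in the time parameter turns
integral curves of $V$ into those of $X$.
\<close>

section \<open>Integrals of compactly supported functions\<close>

text \<open>The field \<open>D X\<close> is divergence free because both solutions satisfy div (D
  \<nabla>u) = \<sigma> u, so that the two products of \<sigma>, u1 and u2 cancel; along it w has
  the derivative D |X|^2 / u2^2. The obstacle is low regularity. With D of class C^1 and \<sigma>
  continuous, solutions are only C^1; X is merely continuous, has no flow, and may be unbounded near
  the frontier, where the data are only continuous. Hence identities are used in integrated form
  against C^1 test functions, the equation itself supplies a continuous representative of the
  Laplacian, second derivatives are available only after mollification, and equicontinuity has to
  come from an energy bound instead of a speed bound. For z = u1 - k u2 one has only |\<Delta>z|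
  \<le> B (|z| + |\<nabla>z|) on compact sets, without analytic coefficients, and this is why unique
  continuation rests on a Carleman estimate. Its weight is quadratic: the Hessian is a constant map
  \<open>Q\<close>, and the estimate comes down to the Rellich identity, two simpler integral
  identities and polynomial algebra.\<close>

lemma extend_by_zero_continuous:
  fixes f :: "'a::topological_space \<Rightarrow> 'b::real_normed_vector"
  assumes "open U" "closed K" "K \<subseteq> U" "continuous_on U f" "\<And>x. x \<in> U - K \<Longrightarrow> f x = 0"
  shows "continuous_on UNIV (\<lambda>x. if x \<in> U then f x else 0)"
proof -
  let ?F = "\<lambda>x. if x \<in> U then f x else 0"
  have "continuous_on U ?F"
    using assms(4) by (simp cong: continuous_on_cong)
  moreover have "continuous_on (- K) ?F"
    by (rule continuous_on_cong[THEN iffD2, OF refl _ continuous_on_const[of _ 0]])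
       (use assms(5) in auto)
  ultimately have "continuous_on (U \<union> - K) ?F"
    using assms(1,2) by (intro continuous_on_open_Un) auto
  moreover have "U \<union> - K = UNIV" using assms(3) by auto
  ultimately show ?thesis by simp
qed

lemma integral_eq_cbox:
  fixes f :: "'a::euclidean_space \<Rightarrow> 'b::euclidean_space"
  assumes "K \<subseteq> U" "K \<subseteq> cbox a b" "\<And>x. x \<in> U - K \<Longrightarrow> f x = 0"
  shows "integral U f = integral (cbox a b) (\<lambda>x. if x \<in> U then f x else 0)"
proof -
  have "integral U f = integral UNIV (\<lambda>x. if x \<in> U then f x else 0)"
    by (simp add: integral_restrict_UNIV)
  also have "(\<lambda>x. if x \<in> U then f x else 0) =
      (\<lambda>x. if x \<in> cbox a b then (if x \<in> U then f x else 0) else 0)"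
    using assms by force
  also have "integral UNIV \<dots> = integral (cbox a b) (\<lambda>x. if x \<in> U then f x else 0)"
    by (simp add: integral_restrict_UNIV)
  finally show ?thesis .
qed

lemma compact_support_integrable:
  fixes f :: "'a::euclidean_space \<Rightarrow> 'b::euclidean_space"
  assumes "open U" "compact K" "K \<subseteq> U" "continuous_on U f" "\<And>x. x \<in> U - K \<Longrightarrow> f x = 0"
  shows "f integrable_on U"
proof -
  let ?F = "\<lambda>x. if x \<in> U then f x else 0"
  obtain a where a: "K \<subseteq> cbox (-a) a"
    using bounded_subset_cbox_symmetric compact_imp_bounded assms(2) by metis
  have "continuous_on UNIV ?F"
    by (rule extend_by_zero_continuous[OF assms(1) compact_imp_closed[OF assms(2)] assms(3-5)])
  then have "?F integrable_on cbox (-a) a"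
    using integrable_continuous continuous_on_subset by blast
  then have "?F integrable_on UNIV"
    by (rule integrable_on_superset) (use a assms(3,5) in auto)
  then show ?thesis by (simp add: integrable_restrict_UNIV)
qed

lemma compact_support_integral_nonpos_imp_zero:
  fixes f :: "'a::euclidean_space \<Rightarrow> real"
  assumes "open U" "compact K" "K \<subseteq> U" "continuous_on U f" "\<And>x. x \<in> U - K \<Longrightarrow> f x = 0"
    and nn: "\<And>x. x \<in> U \<Longrightarrow> 0 \<le> f x" and le: "integral U f \<le> 0" and x: "x \<in> U"
  shows "f x = 0"
proof -
  let ?F = "\<lambda>x. if x \<in> U then f x else 0"
  obtain c where c: "insert x K \<subseteq> cbox (-c) c"
    using bounded_subset_cbox_symmetric[of "insert x K"] compact_imp_bounded assms(2) by auto
  \<comment> \<open>Adding \<open>One\<close> makes the box nondegenerate, as needed to infer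
    vanishing of a nonnegative continuous function from a vanishing integral.\<close>
  define a where "a = c + One"
  have ne: "box (-a) a \<noteq> {}" and sub: "cbox (-c) c \<subseteq> cbox (-a) a"
    using c unfolding a_def by (auto simp: mem_box box_ne_empty algebra_simps)
       (smt (verit) inner_minus_left)+
  have cont: "continuous_on UNIV ?F"
    by (rule extend_by_zero_continuous[OF assms(1) compact_imp_closed[OF assms(2)] assms(3-5)])
  have "integral U f = integral (cbox (-a) a) ?F"
    using c sub by (intro integral_eq_cbox[OF assms(3)]) (use assms(5) in auto)
  moreover have "integral (cbox (-a) a) ?F \<ge> 0"
    by (rule integral_nonneg) (use nn cont in \<open>auto intro!: integrable_continuous continuous_on_subset[OF cont]\<close>)
  ultimately have "integral (cbox (-a) a) ?F = 0" using le by linarith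
  moreover have "x \<in> cbox (-a) a" using c sub by auto
  moreover have "continuous_on (cbox (-a) a) ?F" using cont continuous_on_subset by blast
  moreover have "?F y \<ge> 0" for y using nn by auto
  ultimately have "?F x = 0"
    using integral_cbox_eq_0_iff[of "-a" a ?F] ne by blast
  then show ?thesis using x by simp
qed

text \<open>By translation invariance the integral of \<open>f (x + t *\<^sub>R e)\<close> does not
  depend on t; differentiating under the integral sign at t = 0 gives the claim.\<close>

lemma integral_directional_derivative_zero:
  fixes f :: "'a::euclidean_space \<Rightarrow> real"
  assumes der: "\<And>x. (f has_derivative f' x) (at x)"
    and cont: "continuous_on UNIV (\<lambda>x. f' x e)"
    and K: "bounded K" "\<And>x. x \<notin> K \<Longrightarrow> f x = 0"
  shows "integral UNIV (\<lambda>x. f' x e) = 0"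
proof -
  \<comment> \<open>One box that contains the supports of all translates with |t| \<le> 1, so that
    the domain of integration stays fixed during the differentiation.\<close>
  have "bounded ((\<lambda>(x,t). x - t *\<^sub>R e) ` (closure K \<times> {-1..1::real}))"
    by (intro compact_imp_bounded compact_continuous_image compact_Times)
       (use K in \<open>auto intro!: continuous_intros simp: split_beta compact_closure\<close>)
  then obtain c where c: "(\<lambda>(x,t). x - t *\<^sub>R e) ` (closure K \<times> {-1..1::real}) \<subseteq> cbox (-c) c"
    using bounded_subset_cbox_symmetric by blast
  have in_c: "x \<in> cbox (-c) c" if "x + t *\<^sub>R e \<in> K" "\<bar>t\<bar> \<le> 1" for x t
  proof -
    have "(x + t *\<^sub>R e, t) \<in> closure K \<times> {-1..1}" using that closure_subset[of K] by auto
    then have "(\<lambda>(x,t). x - t *\<^sub>R e) (x + t *\<^sub>R e, t) \<in> cbox (-c) c" using c by blast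
    then show ?thesis by simp
  qed
  have contf: "continuous_on UNIV f"
    using der has_derivative_continuous by (metis continuous_at_imp_continuous_on)
  define F where "F = (\<lambda>t::real. integral (cbox (-c) c) (\<lambda>x. f (x + t *\<^sub>R e)))"
  have F_const: "F t = integral UNIV f" if "\<bar>t\<bar> \<le> 1" for t
  proof -
    have "F t = integral (cbox (-c + t *\<^sub>R e) (c + t *\<^sub>R e)) f"
      unfolding F_def using integral_shift_cbox_plus[of "-c" c f "t *\<^sub>R e"]
      by (simp add: o_def add.commute)
    also have "\<dots> = integral (UNIV) f"
    proof -
      have "x \<in> cbox (-c + t *\<^sub>R e) (c + t *\<^sub>R e)" if "x \<in> K" for x
        using in_c[of "x - t *\<^sub>R e" t] \<open>\<bar>t\<bar> \<le> 1\<close> that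
        by (auto simp: mem_box inner_diff_left inner_add_left)
      then have "K \<subseteq> cbox (-c + t *\<^sub>R e) (c + t *\<^sub>R e)" by blast
      from integral_eq_cbox[OF subset_UNIV this, of f] K show ?thesis by simp
    qed
    finally show ?thesis .
  qed
  have "(F has_field_derivative integral (cbox (-c) c) (\<lambda>x. f' (x + 0 *\<^sub>R e) e)) (at 0 within UNIV)"
    unfolding F_def
  proof (rule leibniz_rule_field_derivative)
    fix t :: real and x :: 'a
    have "((\<lambda>t. f (x + t *\<^sub>R e)) has_derivative (\<lambda>h. f' (x + t *\<^sub>R e) (h *\<^sub>R e))) (at t)"
      by (rule has_derivative_compose[of "\<lambda>t. x + t *\<^sub>R e" _ _ _ f, OF _ der])
         (auto intro!: derivative_eq_intros)
    moreover have "f' (x + t *\<^sub>R e) (h *\<^sub>R e) = f' (x + t *\<^sub>R e) e * h" for h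
      using linear_scale[OF has_derivative_linear[OF der[of "x + t *\<^sub>R e"]]] by simp
    then have "(\<lambda>h. f' (x + t *\<^sub>R e) (h *\<^sub>R e)) = (*) (f' (x + t *\<^sub>R e) e)"
      by (intro ext)
    ultimately show "((\<lambda>t. f (x + t *\<^sub>R e)) has_field_derivative f' (x + t *\<^sub>R e) e) (at t within UNIV)"
      by (simp add: has_field_derivative_def)
  next
    fix t :: real
    show "(\<lambda>x. f (x + t *\<^sub>R e)) integrable_on cbox (-c) c"
      by (intro integrable_continuous continuous_on_compose2[OF contf] continuous_intros) auto
  next
    show "continuous_on (UNIV \<times> cbox (-c) c) (\<lambda>(t, x). f' (x + t *\<^sub>R e) e)"
      unfolding split_beta by (intro continuous_on_compose2[OF cont] continuous_intros) auto
  qed auto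
  moreover have "(F has_field_derivative 0) (at 0 within UNIV)"
    by (rule has_field_derivative_transform_within_open[of "\<lambda>_. integral UNIV f" _ _ "ball 0 1"])
       (use F_const in auto)
  ultimately have z: "integral (cbox (-c) c) (\<lambda>x. f' x e) = 0"
    using DERIV_unique by fastforce
  have "f' x e = 0" if "x \<notin> closure K" for x
  proof -
    have "(f has_derivative (\<lambda>h. 0)) (at x)"
      by (rule has_derivative_transform_within_open[of "\<lambda>_. 0" _ _ _ "- closure K"])
         (use that K closure_subset[of K] in auto)
    then show ?thesis using has_derivative_unique[OF der] by metis
  qed
  moreover have "closure K \<subseteq> cbox (-c) c"
  proof
    fix x assume "x \<in> closure K"
    then have "(x, 0) \<in> closure K \<times> {-1..1::real}" by simp
    then have "(\<lambda>(x,t). x - t *\<^sub>R e) (x, 0) \<in> cbox (-c) c" using c by blast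
    then show "x \<in> cbox (-c) c" by simp
  qed
  ultimately show ?thesis
    using z integral_eq_cbox[of "closure K" UNIV "-c" c "\<lambda>x. f' x e"] by simp
qed

text \<open>The divergence theorem without boundary term; the divergence is the trace of
  \<open>DY x\<close>. Each diagonal entry, extended by zero, is a directional derivative of a
  compactly supported function.\<close>

lemma integral_divergence_zero:
  fixes Y :: "'a::euclidean_space \<Rightarrow> 'a"
  assumes U: "open U" "compact K" "K \<subseteq> U"
    and der: "\<And>x. x \<in> U \<Longrightarrow> (Y has_derivative DY x) (at x)"
    and cont: "\<And>b. b \<in> Basis \<Longrightarrow> continuous_on U (\<lambda>x. DY x b)"
    and zero: "\<And>x. x \<in> U - K \<Longrightarrow> Y x = 0"
  shows "integral U (\<lambda>x. \<Sum>b\<in>Basis. DY x b \<bullet> b) = 0"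
proof -
  have opn: "open (U - K)" using U by (simp add: compact_imp_closed open_Diff)
  have DY0: "DY x b = 0" if "x \<in> U - K" for x b
  proof -
    have "(Y has_derivative (\<lambda>h. 0)) (at x)"
      by (rule has_derivative_transform_within_open[of "\<lambda>_. 0" _ _ _ "U - K"])
         (use that opn zero in auto)
    then show ?thesis using has_derivative_unique[OF der] that by (metis DiffD1)
  qed
  have contb: "continuous_on U (\<lambda>x. DY x b \<bullet> b)" if "b \<in> Basis" for b
    using cont[OF that] by (intro continuous_intros)
  have "integral U (\<lambda>x. DY x b \<bullet> b) = 0" if b: "b \<in> Basis" for b
  proof -
    define f where "f = (\<lambda>x. if x \<in> U then Y x \<bullet> b else 0)"
    define f' where "f' = (\<lambda>x h. if x \<in> U then DY x h \<bullet> b else 0)"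
    have "(f has_derivative f' x) (at x)" for x
    proof (cases "x \<in> U")
      case True
      have "((\<lambda>x. Y x \<bullet> b) has_derivative (\<lambda>h. DY x h \<bullet> b)) (at x)"
        by (auto intro!: derivative_eq_intros der[OF True])
      then have "(f has_derivative (\<lambda>h. DY x h \<bullet> b)) (at x)"
        by (rule has_derivative_transform_within_open[of _ _ _ _ U]) (use U True in \<open>auto simp: f_def\<close>)
      then show ?thesis using True by (simp add: f'_def)
    next
      case False
      have "(f has_derivative (\<lambda>h. 0)) (at x)"
        by (rule has_derivative_transform_within_open[of "\<lambda>_. 0" _ _ _ "- K"])
           (use U False zero in \<open>auto simp: f_def compact_imp_closed\<close>)
      then show ?thesis using False by (simp add: f'_def)
    qed
    moreover have "continuous_on UNIV (\<lambda>x. f' x b)"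
      unfolding f'_def
      by (rule extend_by_zero_continuous[OF U(1) compact_imp_closed[OF U(2)] U(3) contb[OF b]])
         (use DY0 in auto)
    ultimately have "integral UNIV (\<lambda>x. f' x b) = 0"
      by (rule integral_directional_derivative_zero[of f f' b K])
         (use U zero compact_imp_bounded in \<open>auto simp: f_def\<close>)
    then show ?thesis by (simp add: f'_def integral_restrict_UNIV)
  qed
  moreover have "(\<lambda>x. DY x b \<bullet> b) integrable_on U" if "b \<in> Basis" for b
    by (rule compact_support_integrable[OF U contb[OF that]]) (use DY0 in auto)
  ultimately show ?thesis by (simp add: integral_sum)
qed

section \<open>The weak form of the equation\<close>

lemma grad_eqI: "GDERIV f x :> g \<Longrightarrow> grad f x = g"
  unfolding grad_def
proof (rule the_equality)
  fix g' assume "GDERIV f x :> g" "GDERIV f x :> g'"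
  then have "(\<lambda>h. h \<bullet> g) = (\<lambda>h. h \<bullet> g')"
    unfolding gderiv_def by (rule has_derivative_unique)
  then show "g' = g" by (metis inner_commute vector_eq_rdot)
qed

lemma GDERIV_continuous_on:
  assumes "\<And>x. x \<in> U \<Longrightarrow> GDERIV f x :> g x"
  shows "continuous_on U f"
proof (rule continuous_at_imp_continuous_on, rule ballI)
  fix x assume "x \<in> U"
  then show "isCont f x"
    using assms[unfolded gderiv_def] has_derivative_continuous by blast
qed

lemma GDERIV_transform_open:
  assumes "GDERIV f x :> g" "open S" "x \<in> S" "\<And>y. y \<in> S \<Longrightarrow> f y = f' y"
  shows "GDERIV f' x :> g"
  unfolding gderiv_def
  by (rule has_derivative_transform_within_open[OF assms(1)[unfolded gderiv_def] assms(2-4)])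

lemma C1_gradD:
  assumes "C_k_on 1 f U"
  shows "x \<in> U \<Longrightarrow> GDERIV f x :> grad f x" "continuous_on U (grad f)"
proof -
  obtain g where g: "\<forall>x\<in>U. GDERIV f x :> g x" "\<forall>i\<in>Basis. continuous_on U (\<lambda>x. g x \<bullet> i)"
    using assms by (auto simp: One_nat_def)
  then have eq: "grad f x = g x" if "x \<in> U" for x
    using that grad_eqI by metis
  show "GDERIV f x :> grad f x" if "x \<in> U" using g eq that by metis
  have "continuous_on U g"
    using g(2) continuous_on_componentwise by blast
  then show "continuous_on U (grad f)" using eq by (simp cong: continuous_on_cong)
qed

text \<open>Neither \<open>\<psi>\<close> nor \<open>g\<close> is restricted outside \<open>U\<close>, so functions given only on \<open>U\<close> may be used as factors.\<close>
definition test_on :: "'a::euclidean_space set \<Rightarrow> ('a \<Rightarrow> real) \<Rightarrow> ('a \<Rightarrow> 'a) \<Rightarrow> bool" where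
  "test_on U \<psi> g \<longleftrightarrow> (\<exists>K. compact K \<and> K \<subseteq> U \<and> (\<forall>x\<in>U - K. \<psi> x = 0)) \<and>
     (\<forall>x\<in>U. GDERIV \<psi> x :> g x) \<and> continuous_on U g"

text \<open>The weak form of div \<open>p\<close> = \<open>L\<close>. Only the field
  \<open>p\<close> enters, not a function whose gradient it is.\<close>

definition weak_lap :: "'a::euclidean_space set \<Rightarrow> ('a \<Rightarrow> 'a) \<Rightarrow> ('a \<Rightarrow> real) \<Rightarrow> bool" where
  "weak_lap U p L \<longleftrightarrow>
     (\<forall>\<psi> g. test_on U \<psi> g \<longrightarrow> integral U (\<lambda>x. L x * \<psi> x + p x \<bullet> g x) = 0)"

lemma test_onE:
  assumes "test_on U \<psi> g" "open U"
  obtains K where "compact K" "K \<subseteq> U" "\<And>x. x \<in> U - K \<Longrightarrow> \<psi> x = 0" "\<And>x. x \<in> U - K \<Longrightarrow> g x = 0"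
    "\<And>x. x \<in> U \<Longrightarrow> GDERIV \<psi> x :> g x" "continuous_on U g" "continuous_on U \<psi>"
proof -
  obtain K where K: "compact K" "K \<subseteq> U" "\<forall>x\<in>U - K. \<psi> x = 0"
    and g: "\<forall>x\<in>U. GDERIV \<psi> x :> g x" "continuous_on U g"
    using assms unfolding test_on_def by blast
  have "g x = 0" if x: "x \<in> U - K" for x
  proof -
    have "open (U - K)" using assms(2) K(1) by (simp add: compact_imp_closed open_Diff)
    then have "GDERIV \<psi> x :> 0"
      by (rule GDERIV_transform_open[OF GDERIV_const[of 0]]) (use x K in auto)
    then show ?thesis using g x grad_eqI by (metis DiffD1)
  qed
  then show thesis using that K g GDERIV_continuous_on[of U \<psi> g] by blast
qed

lemma test_on_mult:
  assumes "open U" "test_on U \<psi> g"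
    and "\<And>x. x \<in> U \<Longrightarrow> GDERIV a x :> a' x" "continuous_on U a'"
  shows "test_on U (\<lambda>x. a x * \<psi> x) (\<lambda>x. a x *\<^sub>R g x + \<psi> x *\<^sub>R a' x)"
proof -
  have "continuous_on U a" using assms(3) by (rule GDERIV_continuous_on)
  moreover have "continuous_on U \<psi>"
    using assms(2) unfolding test_on_def by (intro GDERIV_continuous_on) auto
  ultimately show ?thesis
    using assms unfolding test_on_def
    by (auto intro!: continuous_intros GDERIV_mult[THEN GDERIV_subst] simp: add.commute)
qed

lemma test_on_extend:
  assumes "open U" "test_on U \<psi> g"
  shows "test_on UNIV (\<lambda>x. if x \<in> U then \<psi> x else 0) (\<lambda>x. if x \<in> U then g x else 0)"
proof -
  obtain K where K: "compact K" "K \<subseteq> U" "\<And>x. x \<in> U - K \<Longrightarrow> \<psi> x = 0" "\<And>x. x \<in> U - K \<Longrightarrow> g x = 0"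
    "\<And>x. x \<in> U \<Longrightarrow> GDERIV \<psi> x :> g x" "continuous_on U g"
    using test_onE[OF assms(2,1)] by metis
  have "GDERIV (\<lambda>x. if x \<in> U then \<psi> x else 0) x :> (if x \<in> U then g x else 0)" for x
  proof (cases "x \<in> U")
    case True
    then show ?thesis
      using GDERIV_transform_open[OF K(5)[OF True] assms(1) True] by auto
  next
    case False
    have "GDERIV (\<lambda>x. if x \<in> U then \<psi> x else 0) x :> 0"
      by (rule GDERIV_transform_open[OF GDERIV_const[of 0], of "- K"])
         (use K False in \<open>auto simp: compact_imp_closed\<close>)
    then show ?thesis using False by simp
  qed
  moreover have "continuous_on UNIV (\<lambda>x. if x \<in> U then g x else 0)"
    by (rule extend_by_zero_continuous[OF assms(1) compact_imp_closed[OF K(1)] K(2,6)]) (use K in auto)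
  ultimately show ?thesis
    unfolding test_on_def using K(1,3) by (auto intro!: exI[of _ K])
qed

text \<open>Test functions on \<Omega> become global ones by extension by zero. Passing to the
  continuous representative \<open>L0\<close> makes both integrands integrable, so that they may be
  merged into one integral.\<close>

lemma weak_laplacian_imp_weak_lap:
  assumes "open \<Omega>" "weak_laplacian \<Omega> u L" "C_k_on 1 u \<Omega>"
    and L0: "continuous_on \<Omega> L0" "\<And>x. x \<in> \<Omega> \<Longrightarrow> L x = L0 x"
  shows "weak_lap \<Omega> (grad u) L0"
  unfolding weak_lap_def
proof (intro allI impI)
  fix \<psi> g assume t: "test_on \<Omega> \<psi> g"
  obtain K where K: "compact K" "K \<subseteq> \<Omega>" "\<And>x. x \<in> \<Omega> - K \<Longrightarrow> \<psi> x = 0" "\<And>x. x \<in> \<Omega> - K \<Longrightarrow> g x = 0"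
    "\<And>x. x \<in> \<Omega> \<Longrightarrow> GDERIV \<psi> x :> g x" "continuous_on \<Omega> g" "continuous_on \<Omega> \<psi>"
    using test_onE[OF t assms(1)] by metis
  define \<phi> where "\<phi> = (\<lambda>x. if x \<in> \<Omega> then \<psi> x else 0)"
  have t0: "test_on UNIV \<phi> (\<lambda>x. if x \<in> \<Omega> then g x else 0)"
    unfolding \<phi>_def using test_on_extend[OF assms(1) t] .
  have cl: "closure {x. \<phi> x \<noteq> 0} \<subseteq> K"
    by (rule closure_minimal) (use K in \<open>auto simp: \<phi>_def compact_imp_closed\<close>)
  have "C_k_on 1 \<phi> UNIV"
    using t0 unfolding test_on_def One_nat_def
    by (auto intro!: exI[of _ "\<lambda>x. if x \<in> \<Omega> then g x else 0"] continuous_on_inner)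
  moreover have "compact (closure {x. \<phi> x \<noteq> 0})"
    using cl K(1) by (metis closed_closure compact_Int_closed inf.absorb_iff2)
  ultimately have "C1_test_function \<Omega> \<phi>"
    unfolding C1_test_function_def using cl K(2) by simp
  then have "integral \<Omega> (\<lambda>x. L x * \<phi> x) = - integral \<Omega> (\<lambda>x. grad u x \<bullet> grad \<phi> x)"
    using assms(2) unfolding weak_laplacian_def by blast
  moreover have "integral \<Omega> (\<lambda>x. L x * \<phi> x) = integral \<Omega> (\<lambda>x. L0 x * \<psi> x)"
    by (rule integral_cong) (simp add: \<phi>_def L0)
  moreover have "integral \<Omega> (\<lambda>x. grad u x \<bullet> grad \<phi> x) = integral \<Omega> (\<lambda>x. grad u x \<bullet> g x)"
  proof (rule integral_cong)
    fix x assume "x \<in> \<Omega>"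
    moreover have "GDERIV \<phi> x :> (if x \<in> \<Omega> then g x else 0)"
      using t0 unfolding test_on_def by blast
    ultimately have "grad \<phi> x = g x" using grad_eqI[of \<phi> x] by simp
    then show "grad u x \<bullet> grad \<phi> x = grad u x \<bullet> g x" by simp
  qed
  moreover have "(\<lambda>x. L0 x * \<psi> x) integrable_on \<Omega>"
    by (rule compact_support_integrable[OF assms(1) K(1,2)]) (use K L0 in \<open>auto intro!: continuous_intros\<close>)
  moreover have "(\<lambda>x. grad u x \<bullet> g x) integrable_on \<Omega>"
    by (rule compact_support_integrable[OF assms(1) K(1,2)])
       (use K C1_gradD[OF assms(3)] in \<open>auto intro!: continuous_intros\<close>)
  ultimately show "integral \<Omega> (\<lambda>x. L0 x * \<psi> x + grad u x \<bullet> g x) = 0"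
    by (simp add: integral_add)
qed

text \<open>The weak form of div (D p) = \<sigma> u. Testing with D \<psi> produces the term \<psi>
  D' \<bullet> p by the product rule, which is the first-order term of the equation.\<close>

lemma weak_lap_divergence_form:
  assumes U: "open U" and wl: "weak_lap U p L"
    and D: "\<And>x. x \<in> U \<Longrightarrow> GDERIV D x :> D' x" "continuous_on U D'"
    and eq: "\<And>x. x \<in> U \<Longrightarrow> D x * L x + D' x \<bullet> p x - \<sigma> x * u x = 0"
    and t: "test_on U \<psi> g"
  shows "integral U (\<lambda>x. D x * (p x \<bullet> g x) + \<sigma> x * u x * \<psi> x) = 0"
proof -
  have "integral U (\<lambda>x. L x * (D x * \<psi> x) + p x \<bullet> (D x *\<^sub>R g x + \<psi> x *\<^sub>R D' x)) = 0"
    using wl test_on_mult[OF U t D] unfolding weak_lap_def by blast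
  moreover have "L x * (D x * \<psi> x) + p x \<bullet> (D x *\<^sub>R g x + \<psi> x *\<^sub>R D' x) =
      D x * (p x \<bullet> g x) + \<sigma> x * u x * \<psi> x" if "x \<in> U" for x
  proof -
    have "D x * L x + D' x \<bullet> p x = \<sigma> x * u x" using eq[OF that] by simp
    then have "(D x * L x + D' x \<bullet> p x) * \<psi> x = \<sigma> x * u x * \<psi> x" by simp
    then show ?thesis by (simp add: inner_add_right inner_commute algebra_simps)
  qed
  then have "integral U (\<lambda>x. L x * (D x * \<psi> x) + p x \<bullet> (D x *\<^sub>R g x + \<psi> x *\<^sub>R D' x)) =
      integral U (\<lambda>x. D x * (p x \<bullet> g x) + \<sigma> x * u x * \<psi> x)"
    by (rule integral_cong)
  ultimately show ?thesis by simp
qed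

section \<open>Minimum principles\<close>

text \<open>From the second power on, the kink of the positive part at 0 disappears, as the
  difference quotient there is at most |h| to the power n + 1. Squares serve the truncation in the
  minimum principle, cubes the bump functions.\<close>

lemma DERIV_max_0_power:
  "((\<lambda>y::real. max 0 y ^ Suc (Suc n)) has_field_derivative real (Suc (Suc n)) * max 0 y ^ Suc n) (at y)"
proof -
  consider "y > 0" | "y < 0" | "y = 0" by linarith
  then show ?thesis
  proof cases
    case 1
    have "((\<lambda>y::real. y ^ Suc (Suc n)) has_field_derivative real (Suc (Suc n)) * max 0 y ^ Suc n) (at y)"
      using DERIV_pow[of "Suc (Suc n)" y] 1 by (simp add: max_def)
    then show ?thesis
      by (rule has_field_derivative_transform_within_open[of _ _ _ "{0<..}"]) (use 1 in auto)
  next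
    case 2
    have "((\<lambda>y::real. 0) has_field_derivative real (Suc (Suc n)) * max 0 y ^ Suc n) (at y)"
      using 2 by (auto intro!: derivative_eq_intros)
    then show ?thesis
      by (rule has_field_derivative_transform_within_open[of _ _ _ "{..<0}"]) (use 2 in auto)
  next
    case 3
    have "((\<lambda>h. (max 0 (y + h) ^ Suc (Suc n) - max 0 y ^ Suc (Suc n)) / h) \<longlongrightarrow> 0) (at 0)"
    proof (rule tendsto_0_le[where K = 1])
      show "((\<lambda>h::real. h ^ Suc n) \<longlongrightarrow> 0) (at 0)"
        by (auto intro!: tendsto_eq_intros)
      have "\<bar>max 0 h ^ Suc (Suc n) / h\<bar> \<le> \<bar>h ^ Suc n\<bar>" if "h \<noteq> 0" for h :: real
        using that by (cases "h > 0") (auto simp: max_def)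
      then show "\<forall>\<^sub>F h in at 0. norm ((max 0 (y + h) ^ Suc (Suc n) - max 0 y ^ Suc (Suc n)) / h)
          \<le> norm (h ^ Suc n) * 1"
        using 3 by (auto simp: eventually_at_filter)
    qed
    then show ?thesis using 3 by (simp add: DERIV_def)
  qed
qed

lemma compactly_supported_gradient_zero:
  assumes "test_on UNIV \<psi> (\<lambda>_. 0)"
  shows "\<psi> x = 0"
proof -
  obtain K where K: "compact K" "\<And>x. x \<notin> K \<Longrightarrow> \<psi> x = 0" "\<And>x. GDERIV \<psi> x :> 0"
    using test_onE[OF assms open_UNIV] by (metis UNIV_I Diff_iff)
  have "(\<psi> has_derivative (\<lambda>h. 0)) (at x within UNIV)" for x
    using K(3) unfolding gderiv_def by simp
  then obtain c where c: "\<And>x. \<psi> x = c"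
    using has_derivative_zero_constant[of UNIV \<psi>] by auto
  obtain y where "y \<notin> K"
    using compact_imp_bounded[OF K(1)] not_bounded_UNIV by (metis UNIV_eq_I)
  then show ?thesis using c K(2) by metis
qed

text \<open>The test function is the square of the positive part of \<open>- z - \<delta>\<close>, which is \<open>C\<^sup>1\<close>, unlike the positive part itself.\<close>
lemma weak_minimum_principle:
  fixes z :: "'a::euclidean_space \<Rightarrow> real"
  assumes G: "open G" "bounded G" and z: "continuous_on (closure G) z"
    and p: "\<And>x. x \<in> G \<Longrightarrow> GDERIV z x :> p x" "continuous_on G p"
    and D: "continuous_on G D" "\<And>x. x \<in> G \<Longrightarrow> 0 < D x"
    and \<sigma>: "continuous_on G \<sigma>" "\<And>x. x \<in> G \<Longrightarrow> 0 \<le> \<sigma> x"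
    and super: "\<And>\<psi> g. test_on G \<psi> g \<Longrightarrow> (\<And>x. x \<in> G \<Longrightarrow> 0 \<le> \<psi> x) \<Longrightarrow>
        0 \<le> integral G (\<lambda>x. D x * (p x \<bullet> g x) + \<sigma> x * z x * \<psi> x)"
    and bd: "\<And>x. x \<in> frontier G \<Longrightarrow> 0 \<le> z x" and x: "x \<in> G"
  shows "0 \<le> z x"
proof (rule ccontr)
  assume "\<not> 0 \<le> z x"
  \<comment> \<open>Half of the negative value keeps the truncation positive at \<open>x\<close>,
    while its support lies in \<open>K\<close>, which avoids the frontier because \<open>z\<close>
    is nonnegative there.\<close>
  define \<delta> where "\<delta> = - z x / 2"
  have \<delta>: "\<delta> > 0" "z x < - \<delta>" using \<open>\<not> 0 \<le> z x\<close> by (auto simp: \<delta>_def)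
  define m where "m = (\<lambda>y. max 0 (- z y - \<delta>))"
  define \<psi> where "\<psi> = (\<lambda>y. m y ^ 2)"
  define g where "g = (\<lambda>y. - (2 * m y) *\<^sub>R p y)"
  define K where "K = {y \<in> closure G. z y \<le> - \<delta>}"
  have zG: "continuous_on G z" using z closure_subset continuous_on_subset by blast
  then have mc: "continuous_on G m" unfolding m_def by (intro continuous_intros)
  have K: "compact K"
  proof -
    have "closed K" unfolding K_def by (intro continuous_closed_preimage_constant continuous_on_closed_Collect_le z continuous_intros) auto
    moreover have "bounded K" unfolding K_def using G(2) by (metis (no_types, lifting) bounded_closure bounded_subset mem_Collect_eq subsetI)
    ultimately show ?thesis by (simp add: compact_eq_bounded_closed)
  qed
  have KG: "K \<subseteq> G"
  proof
    fix y assume "y \<in> K"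
    then have "y \<in> closure G" "\<not> 0 \<le> z y" using \<delta> by (auto simp: K_def)
    then show "y \<in> G" using bd[of y] G(1) by (auto simp: frontier_def interior_open)
  qed
  have der: "GDERIV \<psi> y :> g y" if "y \<in> G" for y
  proof -
    have "GDERIV (\<lambda>y. - z y - \<delta>) y :> - p y - 0"
      by (intro GDERIV_diff GDERIV_minus GDERIV_const p that)
    from GDERIV_DERIV_compose[OF this DERIV_max_0_power[of 0]]
    show ?thesis unfolding \<psi>_def g_def m_def by (simp add: numeral_2_eq_2)
  qed
  have m0: "m y = 0" if "y \<in> G - K" for y
    using that closure_subset[of G] by (auto simp: m_def K_def)
  have gc: "continuous_on G g" unfolding g_def by (intro continuous_intros mc p)
  have t: "test_on G \<psi> g"
    unfolding test_on_def using K KG m0 der gc by (auto simp: \<psi>_def intro!: exI[of _ K])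
  \<comment> \<open>For this test function both summands of the integrand are nonpositive.
    \<open>F\<close> is the negative of the integrand, hence a nonnegative function with nonpositive
    integral, and it vanishes. Then the gradient of \<psi> vanishes too, and \<psi> itself by
    compact support, although it is positive at \<open>x\<close>.\<close>
  define F where "F = (\<lambda>y. - (D y * (p y \<bullet> g y) + \<sigma> y * z y * \<psi> y))"
  have mz: "m y * z y \<le> 0" for y
    using \<delta> by (auto simp: m_def max_def mult_le_0_iff)
  have F_eq: "F y = 2 * D y * m y * (p y \<bullet> p y) + \<sigma> y * (- (m y * z y)) * m y" for y
    unfolding F_def g_def \<psi>_def by (simp add: power2_eq_square algebra_simps)
  have m_nn: "m y \<ge> 0" for y by (simp add: m_def)
  have terms: "0 \<le> 2 * D y * m y * (p y \<bullet> p y)" "0 \<le> \<sigma> y * (- (m y * z y)) * m y" if "y \<in> G" for y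
    using D(2)[OF that] \<sigma>(2)[OF that] mz[of y] m_nn[of y]
    by (intro mult_nonneg_nonneg; simp)+
  have "integral G F = - integral G (\<lambda>y. D y * (p y \<bullet> g y) + \<sigma> y * z y * \<psi> y)"
    unfolding F_def by (rule integral_neg)
  then have Fle: "integral G F \<le> 0" using super[OF t] by (auto simp: \<psi>_def)
  have Fc: "continuous_on G F"
    unfolding F_def \<psi>_def by (intro continuous_intros D \<sigma> p gc zG mc)
  have F0: "F y = 0" if "y \<in> G" for y
  proof (rule compact_support_integral_nonpos_imp_zero[OF G(1) K KG Fc _ _ Fle that])
    show "F y = 0" if "y \<in> G - K" for y using m0[OF that] by (simp add: F_eq)
    show "0 \<le> F y" if "y \<in> G" for y using terms[OF that] unfolding F_eq by (rule add_nonneg_nonneg)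
  qed
  have "g y = 0" if "y \<in> G" for y
  proof -
    have "2 * D y * m y * (p y \<bullet> p y) = 0" using F0[OF that] terms[OF that] F_eq[of y] by linarith
    then show ?thesis using D(2)[OF that] by (auto simp: g_def)
  qed
  then have "(\<lambda>y. if y \<in> G then g y else 0) = (\<lambda>_. 0)" by auto
  then have "(if x \<in> G then \<psi> x else 0) = 0"
    using compactly_supported_gradient_zero[of "\<lambda>y. if y \<in> G then \<psi> y else 0" x] test_on_extend[OF G(1) t] by simp
  then show False using x \<delta> by (auto simp: \<psi>_def m_def max_def split: if_splits)
qed

text \<open>Only the product has to vanish off \<open>K\<close>, since in the applications the
  compact support may come from the scalar or from the field.\<close>

lemma integral_div_scaleR_zero_product:
  fixes Z :: "'a::euclidean_space \<Rightarrow> 'a"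
  assumes U: "open U" "compact K" "K \<subseteq> U"
    and s: "\<And>x. x \<in> U \<Longrightarrow> GDERIV s x :> s' x" "continuous_on U s'" "\<And>x. x \<in> U - K \<Longrightarrow> s x *\<^sub>R Z x = 0"
    and Z: "\<And>x. x \<in> U \<Longrightarrow> (Z has_derivative DZ x) (at x)"
      "\<And>b. b \<in> Basis \<Longrightarrow> continuous_on U (\<lambda>x. DZ x b)"
  shows "integral U (\<lambda>x. s' x \<bullet> Z x + s x * (\<Sum>b\<in>Basis. DZ x b \<bullet> b)) = 0"
proof -
  have contZ: "continuous_on U Z"
    using Z(1) has_derivative_continuous by (meson continuous_at_imp_continuous_on)
  have conts: "continuous_on U s" using s(1) by (rule GDERIV_continuous_on)
  have "integral U (\<lambda>x. \<Sum>b\<in>Basis. (s x *\<^sub>R DZ x b + (b \<bullet> s' x) *\<^sub>R Z x) \<bullet> b) = 0"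
  proof (rule integral_divergence_zero[OF U, of "\<lambda>x. s x *\<^sub>R Z x"])
    fix x assume "x \<in> U"
    then show "((\<lambda>x. s x *\<^sub>R Z x) has_derivative (\<lambda>h. s x *\<^sub>R DZ x h + (h \<bullet> s' x) *\<^sub>R Z x)) (at x)"
      using has_derivative_scaleR[OF s(1)[unfolded gderiv_def] Z(1)] by blast
  qed (use s Z conts contZ in \<open>auto intro!: continuous_intros\<close>)
  moreover have "(\<Sum>b\<in>Basis. (s x *\<^sub>R DZ x b + (b \<bullet> s' x) *\<^sub>R Z x) \<bullet> b) =
      s' x \<bullet> Z x + s x * (\<Sum>b\<in>Basis. DZ x b \<bullet> b)" for x
    using euclidean_inner[of "s' x" "Z x"]
    by (simp add: inner_add_left sum.distrib sum_distrib_left inner_commute[of _ "s' x"])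
  ultimately show ?thesis by simp
qed

lemma integral_div_scaleR_zero:
  fixes Z :: "'a::euclidean_space \<Rightarrow> 'a"
  assumes "open U" "compact K" "K \<subseteq> U"
    and "\<And>x. x \<in> U \<Longrightarrow> GDERIV s x :> s' x" "continuous_on U s'" "\<And>x. x \<in> U - K \<Longrightarrow> s x = 0"
    and "\<And>x. x \<in> U \<Longrightarrow> (Z has_derivative DZ x) (at x)"
      "\<And>b. b \<in> Basis \<Longrightarrow> continuous_on U (\<lambda>x. DZ x b)"
  shows "integral U (\<lambda>x. s' x \<bullet> Z x + s x * (\<Sum>b\<in>Basis. DZ x b \<bullet> b)) = 0"
  by (rule integral_div_scaleR_zero_product[OF assms(1-5) _ assms(7,8)]) (use assms(6) in auto)

text \<open>Integrability need not be checked: a function that is not integrable has integral 0 by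
  convention.\<close>

lemma integral_nonpos:
  fixes f :: "'a::euclidean_space \<Rightarrow> real"
  assumes "\<And>x. x \<in> S \<Longrightarrow> f x \<le> 0"
  shows "integral S f \<le> 0"
proof (cases "f integrable_on S")
  case True
  then have "integral S f \<le> integral S (\<lambda>_. 0)" by (intro integral_le integrable_0 assms)
  then show ?thesis by simp
qed (simp add: not_integrable_integral)

text \<open>By connectedness some point q of \<Omega> outside \<open>P\<close> lies in the closure
  of \<open>P\<close>. A centre in \<open>P\<close> that is close to q, relative to the room around
  q in \<Omega>, has a nearest point outside \<open>P\<close>, and this is the point of contact. The
  same geometry serves the Hopf argument and unique continuation.\<close>

lemma touching_ball:
  fixes \<Omega> P :: "'a::euclidean_space set"
  assumes "open \<Omega>" "connected \<Omega>" "open P" "P \<subseteq> \<Omega>" "P \<noteq> {}" "P \<noteq> \<Omega>"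
  obtains a R p where "0 < R" "ball a R \<subseteq> P" "cball a R \<subseteq> \<Omega>" "p \<in> \<Omega> - P" "dist a p = R"
proof -
  obtain q where q: "q \<in> \<Omega>" "q \<notin> P" "q \<in> closure P"
  proof (rule ccontr)
    assume "\<not> thesis"
    with that have "P = \<Omega> \<inter> closure P" using assms(4) closure_subset by blast
    then have "closedin (top_of_set \<Omega>) P" by (metis closed_closure closedin_closed_Int)
    moreover have "openin (top_of_set \<Omega>) P" using assms by (simp add: open_openin_trans)
    ultimately show False using assms connected_clopen by blast
  qed
  obtain e where e: "e > 0" "cball q e \<subseteq> \<Omega>"
    using assms(1) q(1) open_contains_cball by blast
  define s where "s = e / 2"
  have s: "s > 0" "cball q (2 * s) \<subseteq> \<Omega>" using e by (auto simp: s_def)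
  obtain a where a: "a \<in> P" "dist a q < s"
    using q(3) s(1) closure_approachable by blast
  define Z where "Z = cball q (2 * s) - P"
  have "closed Z" "q \<in> Z" unfolding Z_def using assms(3) q s by (auto intro: closed_Diff)
  then obtain p where p: "p \<in> Z" "infdist a Z = dist a p"
    using infdist_attains_inf[of Z a] by blast
  have min: "dist a p \<le> dist a y" if "y \<in> Z" for y
    using infdist_le[OF that] p(2) by metis
  have R: "0 < dist a p" using a(1) p(1) by (auto simp: Z_def)
  have lt: "dist a p < s" using min[OF \<open>q \<in> Z\<close>] a(2) by simp
  have near: "y \<in> cball q (2 * s)" if "dist a y \<le> dist a p" for y
    using that lt a(2) dist_triangle[of q y a] by (auto simp: dist_commute)
  show thesis
  proof (rule that[OF R])
    show "ball a (dist a p) \<subseteq> P"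
      using min near unfolding Z_def by (force simp: less_eq_real_def)
    show "cball a (dist a p) \<subseteq> \<Omega>" using near s(2) by auto
    show "p \<in> \<Omega> - P" using p(1) s(2) by (auto simp: Z_def)
  qed simp
qed

lemma test_on_extend_superset:
  assumes "open A" "A \<subseteq> U" "test_on A \<psi> g"
  shows "test_on U (\<lambda>x. if x \<in> A then \<psi> x else 0) (\<lambda>x. if x \<in> A then g x else 0)"
proof -
  have t: "test_on UNIV (\<lambda>x. if x \<in> A then \<psi> x else 0) (\<lambda>x. if x \<in> A then g x else 0)"
    by (rule test_on_extend[OF assms(1,3)])
  obtain K where "compact K" "K \<subseteq> A" "\<And>x. x \<in> A - K \<Longrightarrow> \<psi> x = 0"
    using test_onE[OF assms(3,1)] by metis
  then show ?thesis using t assms(2) unfolding test_on_def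
    by (auto intro!: exI[of _ K] intro: continuous_on_subset)
qed

lemma continuous_on_compact_bound:
  fixes f :: "'a::topological_space \<Rightarrow> 'b::real_normed_vector"
  assumes "compact C" "continuous_on C f"
  obtains B where "B \<ge> 0" "\<And>x. x \<in> C \<Longrightarrow> norm (f x) \<le> B"
proof -
  have "bounded (f ` C)" using assms compact_continuous_image compact_imp_bounded by blast
  then obtain B where "\<And>x. x \<in> C \<Longrightarrow> norm (f x) \<le> B" unfolding bounded_iff by auto
  then show thesis using that[of "max 0 B"] by fastforce
qed

lemma continuous_on_compact_pos_lower_bound:
  fixes f :: "'a::topological_space \<Rightarrow> real"
  assumes "compact C" "continuous_on C f" "\<And>x. x \<in> C \<Longrightarrow> 0 < f x"
  obtains d where "d > 0" "\<And>x. x \<in> C \<Longrightarrow> d \<le> f x"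
proof (cases "C = {}")
  case True then show thesis using that[of 1] by simp
next
  case False
  then obtain x where "x \<in> C" "\<forall>y\<in>C. f x \<le> f y"
    using continuous_attains_inf[OF assms(1) _ assms(2)] by blast
  then show thesis using that[of "f x"] assms(3) by blast
qed

text \<open>Hopf's argument: \<open>u\<close> is compared on an annulus with a multiple of the barrier
  \<open>exp (- \<alpha> \<bar>x - a\<bar>\<^sup>2) - exp (- \<alpha> R\<^sup>2)\<close>, a strict subsolution for large \<open>\<alpha>\<close>.\<close>
lemma strong_minimum_principle:
  fixes u :: "'a::euclidean_space \<Rightarrow> real"
  assumes \<Omega>: "open \<Omega>" "connected \<Omega>"
    and p: "\<And>x. x \<in> \<Omega> \<Longrightarrow> GDERIV u x :> p x" "continuous_on \<Omega> p"
    and D: "\<And>x. x \<in> \<Omega> \<Longrightarrow> GDERIV D x :> D' x" "continuous_on \<Omega> D'" "\<And>x. x \<in> \<Omega> \<Longrightarrow> 0 < D x"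
    and \<sigma>: "continuous_on \<Omega> \<sigma>" "\<And>x. x \<in> \<Omega> \<Longrightarrow> 0 \<le> \<sigma> x"
    and weak: "\<And>\<psi> g. test_on \<Omega> \<psi> g \<Longrightarrow>
        integral \<Omega> (\<lambda>x. D x * (p x \<bullet> g x) + \<sigma> x * u x * \<psi> x) = 0"
    and nn: "\<And>x. x \<in> \<Omega> \<Longrightarrow> 0 \<le> u x" and ne: "x\<^sub>0 \<in> \<Omega>" "u x\<^sub>0 \<noteq> 0" and x: "x \<in> \<Omega>"
  shows "0 < u x"
proof (rule ccontr)
  assume "\<not> 0 < u x"
  define P where "P = {x \<in> \<Omega>. 0 < u x}"
  have uc: "continuous_on \<Omega> u" using p(1) by (rule GDERIV_continuous_on)
  have Dc: "continuous_on \<Omega> D" using D(1) by (rule GDERIV_continuous_on)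
  have oP: "open P" unfolding P_def
    using continuous_open_preimage[OF uc \<Omega>(1), of "{0<..}"] by (simp add: vimage_def Int_def)
  have P1: "P \<noteq> {}" using ne nn[of x\<^sub>0] by (auto simp: P_def less_eq_real_def)
  have P2: "P \<noteq> \<Omega>" using \<open>\<not> 0 < u x\<close> x by (auto simp: P_def)
  have P3: "P \<subseteq> \<Omega>" by (auto simp: P_def)
  obtain a R q where q: "0 < R" "ball a R \<subseteq> P" "cball a R \<subseteq> \<Omega>" "q \<in> \<Omega> - P" "dist a q = R"
    by (rule touching_ball[OF \<Omega> oP P3 P1 P2])
  have uq: "u q = 0" using q(4) nn[of q] by (auto simp: P_def)
  let ?C = "cball a R"
  obtain d0 where d0: "d0 > 0" "\<And>x. x \<in> ?C \<Longrightarrow> d0 \<le> D x"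
    using continuous_on_compact_pos_lower_bound[OF compact_cball continuous_on_subset[OF Dc q(3)]] D(3) q(3) by blast
  obtain d1 where d1: "d1 \<ge> 0" "\<And>x. x \<in> ?C \<Longrightarrow> norm (D' x) \<le> d1"
    using continuous_on_compact_bound[OF compact_cball continuous_on_subset[OF D(2) q(3)]] by blast
  obtain d2 where d2: "d2 \<ge> 0" "\<And>x. x \<in> ?C \<Longrightarrow> norm (D x) \<le> d2"
    using continuous_on_compact_bound[OF compact_cball continuous_on_subset[OF Dc q(3)]] by blast
  obtain s1 where s1: "s1 \<ge> 0" "\<And>x. x \<in> ?C \<Longrightarrow> norm (\<sigma> x) \<le> s1"
    using continuous_on_compact_bound[OF compact_cball continuous_on_subset[OF \<sigma>(1) q(3)]] by blast
  let ?n = "real DIM('a)"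
  \<comment> \<open>\<open>B\<close> collects the bounds for the drift, trace and zero-order terms.
    On the annulus |x - a| \<ge> R/2, so the leading term is at least \<alpha>^2 d0 R^2; the choice
    of \<alpha> gives \<alpha> d0 R^2 \<ge> B, and \<alpha> \<ge> 1 covers the zero-order
    term.\<close>
  define B where "B = 2 * R * d1 + 2 * ?n * d2 + s1"
  have B: "B \<ge> 0" using q(1) d1(1) d2(1) s1(1) by (simp add: B_def)
  define \<alpha> where "\<alpha> = 1 + B / (d0 * R\<^sup>2)"
  have \<alpha>1: "\<alpha> \<ge> 1" using B q(1) d0(1) by (simp add: \<alpha>_def)
  have "\<alpha> * (d0 * R\<^sup>2) \<ge> B" using B q(1) d0(1) by (simp add: \<alpha>_def field_simps)
  then have \<alpha>B: "\<alpha> * (\<alpha> * (d0 * R\<^sup>2)) \<ge> \<alpha> * (2 * R * d1 + 2 * ?n * d2) + s1"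
  proof -
    have "\<alpha> * (\<alpha> * (d0 * R\<^sup>2)) \<ge> \<alpha> * B"
      using \<open>B \<le> \<alpha> * (d0 * R\<^sup>2)\<close> \<alpha>1 by (intro mult_left_mono) auto
    moreover have "\<alpha> * B \<ge> \<alpha> * (2 * R * d1 + 2 * ?n * d2) + s1"
      using mult_right_mono[OF \<alpha>1 s1(1)] by (simp add: B_def distrib_left)
    ultimately show ?thesis by linarith
  qed
  define E where "E = (\<lambda>x. exp (- \<alpha> * ((x - a) \<bullet> (x - a))))"
  have E: "GDERIV E x :> (- 2 * \<alpha> * E x) *\<^sub>R (x - a)" for x
    unfolding gderiv_def E_def
    by (auto intro!: derivative_eq_intros simp: inner_commute)
  have Epos: "E x > 0" for x by (simp add: E_def)
  define v where "v = (\<lambda>x. E x - exp (- \<alpha> * R\<^sup>2))"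
  define v' where "v' = (\<lambda>x. (- 2 * \<alpha> * E x) *\<^sub>R (x - a))"
  have v: "GDERIV v x :> v' x" for x
    unfolding v_def v'_def using GDERIV_diff[OF E GDERIV_const] by simp
  have Ec: "continuous_on S E" for S unfolding E_def by (intro continuous_intros)
  have v'c: "continuous_on S v'" for S unfolding v'_def by (intro continuous_intros Ec)
  have vc: "continuous_on S v" for S unfolding v_def by (intro continuous_intros Ec)
  \<comment> \<open>Removing the inner ball keeps |x - a| away from 0, where the leading term of the
    barrier degenerates, and creates an inner sphere on which \<open>u\<close> has a positive
    minimum.\<close>
  define A where "A = ball a R - cball a (R / 2)"
  have A: "open A" "bounded A" "A \<subseteq> ?C" by (auto simp: A_def intro: bounded_subset[OF bounded_cball])
  have A\<Omega>: "A \<subseteq> \<Omega>" using A q by blast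
  have v_sub: "integral A (\<lambda>x. D x * (v' x \<bullet> g x) + \<sigma> x * v x * \<psi> x) \<le> 0"
    if t: "test_on A \<psi> g" and \<psi>0: "\<And>x. x \<in> A \<Longrightarrow> 0 \<le> \<psi> x" for \<psi> g
  proof -
    obtain K where K: "compact K" "K \<subseteq> A" "\<And>x. x \<in> A - K \<Longrightarrow> \<psi> x = 0" "\<And>x. x \<in> A - K \<Longrightarrow> g x = 0"
      "\<And>x. x \<in> A \<Longrightarrow> GDERIV \<psi> x :> g x" "continuous_on A g" "continuous_on A \<psi>"
      using test_onE[OF t A(1)] by metis
    note cs = continuous_on_subset[OF Dc A\<Omega>] continuous_on_subset[OF D(2) A\<Omega>] Ec K(6,7)
      continuous_on_subset[OF \<sigma>(1) A\<Omega>] v'c vc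
    \<comment> \<open>Chosen so that s (x - a) = \<psi> D v'. The divergence of this field
      integrates to zero; subtracting it eliminates the gradient of \<psi> and leaves \<psi> times
      \<sigma> v - div (D v').\<close>
    define s where "s = (\<lambda>x. \<psi> x * (D x * (- 2 * \<alpha> * E x)))"
    define s' where "s' = (\<lambda>x. \<psi> x *\<^sub>R (D x *\<^sub>R ((4 * \<alpha>\<^sup>2 * E x) *\<^sub>R (x - a)) + (- 2 * \<alpha> * E x) *\<^sub>R D' x)
        + (D x * (- 2 * \<alpha> * E x)) *\<^sub>R g x)"
    have s: "GDERIV s x :> s' x" if "x \<in> A" for x
    proof -
      have "GDERIV (\<lambda>x. - 2 * \<alpha> * E x) x :> (4 * \<alpha>\<^sup>2 * E x) *\<^sub>R (x - a)"
        using GDERIV_mult[OF GDERIV_const[of "- 2 * \<alpha>" x] E[of x]] by (simp add: power2_eq_square mult.assoc)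
      from GDERIV_mult[OF K(5)[OF that] GDERIV_mult[OF D(1) this]] that A\<Omega>
      show ?thesis unfolding s_def s'_def by auto
    qed
    have "integral A (\<lambda>x. s' x \<bullet> (x - a) + s x * (\<Sum>b\<in>(Basis::'a set). b \<bullet> b)) = 0"
    proof (rule integral_div_scaleR_zero[OF A(1) K(1,2) s, where Z = "\<lambda>x. x - a" and DZ = "\<lambda>x h. h"])
      show "continuous_on A s'" unfolding s'_def by (intro continuous_intros cs)
      show "((\<lambda>x. x - a) has_derivative (\<lambda>h. h)) (at x)" for x
        by (auto intro!: derivative_eq_intros)
    qed (use K in \<open>auto simp: s_def\<close>)
    moreover have "(\<Sum>b\<in>(Basis::'a set). b \<bullet> b) = ?n" by (simp add: inner_Basis)
    ultimately have I1: "integral A (\<lambda>x. s' x \<bullet> (x - a) + s x * ?n) = 0" by simp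
    define F where "F = (\<lambda>x. D x * (v' x \<bullet> g x) + \<sigma> x * v x * \<psi> x)"
    have "integral A F = integral A F - integral A (\<lambda>x. s' x \<bullet> (x - a) + s x * ?n)" using I1 by simp
    also have "\<dots> = integral A (\<lambda>x. F x - (s' x \<bullet> (x - a) + s x * ?n))"
    proof (rule integral_diff[symmetric])
      show "F integrable_on A"
        by (rule compact_support_integrable[OF A(1) K(1,2)])
           (use K in \<open>auto simp: F_def intro!: continuous_intros cs\<close>)
      show "(\<lambda>x. s' x \<bullet> (x - a) + s x * ?n) integrable_on A"
        by (rule compact_support_integrable[OF A(1) K(1,2)])
           (use K in \<open>auto simp: s_def s'_def intro!: continuous_intros cs\<close>)
    qed
    also have "\<dots> \<le> 0"
    proof -
      have "F x - (s' x \<bullet> (x - a) + s x * ?n) \<le> 0" if xA: "x \<in> A" for x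
      proof -
        have xC: "x \<in> ?C" using A xA by blast
        let ?r = "(x - a) \<bullet> (x - a)"
        have nr: "norm (x - a) \<le> R" "R / 2 \<le> norm (x - a)"
          using xA by (auto simp: A_def dist_norm norm_minus_commute)
        have r: "?r \<ge> (R/2)\<^sup>2"
          using nr(2) q(1) by (metis half_gt_zero less_eq_real_def power2_norm_eq_inner power_mono)
        have "F x - (s' x \<bullet> (x - a) + s x * ?n) =
            \<psi> x * (\<sigma> x * v x - E x * (4 * \<alpha>\<^sup>2 * D x * ?r - 2 * \<alpha> * (D' x \<bullet> (x - a)) - 2 * \<alpha> * ?n * D x))"
          unfolding F_def s_def s'_def v'_def
          by (simp add: inner_add_left inner_commute algebra_simps)
        moreover have "\<sigma> x * v x \<le> s1 * E x"
          using s1(2)[OF xC] \<sigma>(2)[of x] xA A\<Omega> Epos[of x]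
          by (intro order_trans[OF mult_left_mono[of "v x" "E x"] mult_right_mono]) (auto simp: v_def)
        moreover have "s1 \<le> 4 * \<alpha>\<^sup>2 * D x * ?r - 2 * \<alpha> * (D' x \<bullet> (x - a)) - 2 * \<alpha> * ?n * D x"
        proof -
          have "\<alpha>\<^sup>2 * (d0 * R\<^sup>2) \<le> 4 * \<alpha>\<^sup>2 * D x * ?r"
          proof -
            have "d0 * (R/2)\<^sup>2 \<le> D x * ?r"
              using d0(1) d0(2)[OF xC] r by (intro mult_mono) auto
            then have "4 * \<alpha>\<^sup>2 * (d0 * (R/2)\<^sup>2) \<le> 4 * \<alpha>\<^sup>2 * (D x * ?r)"
              by (intro mult_left_mono) auto
            then show ?thesis by (simp add: power_divide mult.assoc)
          qed
          moreover have "D' x \<bullet> (x - a) \<le> d1 * R"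
            using norm_cauchy_schwarz[of "D' x" "x - a"] d1(2)[OF xC] nr(1) d1(1)
            by (meson mult_mono norm_ge_zero order_trans)
          then have "2 * \<alpha> * (D' x \<bullet> (x - a)) \<le> 2 * \<alpha> * (d1 * R)"
            using \<alpha>1 by (intro mult_left_mono) auto
          moreover have "2 * \<alpha> * ?n * D x \<le> 2 * \<alpha> * ?n * d2"
            using d2(2)[OF xC] \<alpha>1 by (intro mult_left_mono) auto
          ultimately show ?thesis using \<alpha>B by (simp add: power2_eq_square algebra_simps)
        qed
        then have "s1 * E x \<le> E x * (4 * \<alpha>\<^sup>2 * D x * ?r - 2 * \<alpha> * (D' x \<bullet> (x - a)) - 2 * \<alpha> * ?n * D x)"
          using Epos[of x] by (simp add: mult.commute)
        ultimately show ?thesis using \<psi>0[OF xA] by (simp add: mult_le_0_iff)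
      qed
      then show ?thesis
        by (intro integral_nonpos) 
    qed
    finally show ?thesis unfolding F_def .
  qed
  have "cball a (R/2) \<subseteq> P" using q(1,2) by (force simp: subset_eq)
  then obtain \<mu> where \<mu>: "\<mu> > 0" "\<And>x. x \<in> cball a (R/2) \<Longrightarrow> \<mu> \<le> u x"
    using continuous_on_compact_pos_lower_bound[OF compact_cball continuous_on_subset[OF uc], of a "R/2"]
    by (auto simp: P_def subset_eq)
  \<comment> \<open>The barrier is 0 on the outer sphere and at most 1 on the inner one, where u
    \<ge> \<mu>; so \<open>z\<close> is nonnegative on both, and then on the annulus by the weak
    minimum principle.\<close>
  define z where "z = (\<lambda>x. u x - \<mu> * v x)"
  define z' where "z' = (\<lambda>x. p x - \<mu> *\<^sub>R v' x)"
  have z: "GDERIV z x :> z' x" if "x \<in> \<Omega>" for x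
    unfolding z_def z'_def
    using GDERIV_diff[OF p(1)[OF that] GDERIV_mult[OF GDERIV_const[of \<mu> x] v[of x]]] by simp
  have zpos: "0 \<le> z x" if "x \<in> A" for x
  proof (rule weak_minimum_principle[OF A(1,2) _ _ _ _ _ _ _ _ _ that])
    have cl: "closure A \<subseteq> {x. R/2 \<le> dist a x \<and> dist a x \<le> R}"
      by (rule closure_minimal)
         (auto simp: A_def intro!: closed_Collect_conj closed_Collect_le continuous_intros)
    have "closure A \<subseteq> \<Omega>"
    proof
      fix x assume "x \<in> closure A"
      then have "x \<in> ?C" using cl by auto
      then show "x \<in> \<Omega>" using q(3) by blast
    qed
    then show "continuous_on (closure A) z"
      unfolding z_def by (intro continuous_intros vc continuous_on_subset[OF uc])
    show "GDERIV z x :> z' x" if "x \<in> A" for x using z that A\<Omega> by blast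
    show "continuous_on A z'" unfolding z'_def by (intro continuous_intros v'c continuous_on_subset[OF p(2) A\<Omega>])
    show "continuous_on A D" "continuous_on A \<sigma>" using Dc \<sigma>(1) A\<Omega> continuous_on_subset by blast+
    show "0 < D x" "0 \<le> \<sigma> x" if "x \<in> A" for x using D(3) \<sigma>(2) that A\<Omega> by blast+
    show "0 \<le> z x" if "x \<in> frontier A" for x
    proof -
      have "x \<in> closure A" "x \<notin> A" using that A(1) by (auto simp: frontier_def interior_open)
      then have "dist a x = R \<or> dist a x = R / 2" "dist a x \<le> R" using cl by (auto simp: A_def)
      then consider "dist a x = R" | "dist a x = R/2" by blast
      then show ?thesis
      proof cases
        case 1
        then have "(x - a) \<bullet> (x - a) = R\<^sup>2"
          by (metis dist_commute dist_norm power2_norm_eq_inner)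
        then have "v x = 0" by (simp add: v_def E_def)
        moreover have "x \<in> \<Omega>" using 1 q(3) by auto
        ultimately show ?thesis using nn by (simp add: z_def)
      next
        case 2
        have "E x \<le> 1" using \<alpha>1 by (simp add: E_def)
        then have "v x \<le> 1" unfolding v_def using exp_ge_zero[of "- \<alpha> * R\<^sup>2"] by linarith
        then have "\<mu> * v x \<le> \<mu>" using \<mu>(1) by (metis less_eq_real_def mult_left_mono mult.right_neutral)
        then show ?thesis using \<mu>(2)[of x] 2 by (simp add: z_def)
      qed
    qed
    fix \<psi> g assume t: "test_on A \<psi> g" and \<psi>0: "\<And>x. x \<in> A \<Longrightarrow> 0 \<le> \<psi> x"
    obtain K where K: "compact K" "K \<subseteq> A" "\<And>x. x \<in> A - K \<Longrightarrow> \<psi> x = 0" "\<And>x. x \<in> A - K \<Longrightarrow> g x = 0"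
      "\<And>x. x \<in> A \<Longrightarrow> GDERIV \<psi> x :> g x" "continuous_on A g" "continuous_on A \<psi>"
      using test_onE[OF t A(1)] by metis
    note cs = continuous_on_subset[OF Dc A\<Omega>] continuous_on_subset[OF p(2) A\<Omega>] K(6,7)
      continuous_on_subset[OF \<sigma>(1) A\<Omega>] v'c vc continuous_on_subset[OF uc A\<Omega>]
    have "0 = integral \<Omega> (\<lambda>x. D x * (p x \<bullet> (if x \<in> A then g x else 0)) + \<sigma> x * u x * (if x \<in> A then \<psi> x else 0))"
      using weak[OF test_on_extend_superset[OF A(1) A\<Omega> t]] by simp
    also have "\<dots> = integral \<Omega> (\<lambda>x. if x \<in> A then D x * (p x \<bullet> g x) + \<sigma> x * u x * \<psi> x else 0)"
      by (rule integral_cong) auto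
    also have "\<dots> = integral A (\<lambda>x. D x * (p x \<bullet> g x) + \<sigma> x * u x * \<psi> x)"
      using A\<Omega> by (simp add: integral_restrict_Int Int_absorb1 Int_absorb2)
    finally have u0: "integral A (\<lambda>x. D x * (p x \<bullet> g x) + \<sigma> x * u x * \<psi> x) = 0" by simp
    have "integral A (\<lambda>x. D x * (z' x \<bullet> g x) + \<sigma> x * z x * \<psi> x) =
        integral A (\<lambda>x. (D x * (p x \<bullet> g x) + \<sigma> x * u x * \<psi> x) - \<mu> * (D x * (v' x \<bullet> g x) + \<sigma> x * v x * \<psi> x))"
      by (rule integral_cong) (simp add: z_def z'_def inner_diff_left algebra_simps)
    also have "\<dots> = integral A (\<lambda>x. D x * (p x \<bullet> g x) + \<sigma> x * u x * \<psi> x) -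
        integral A (\<lambda>x. \<mu> * (D x * (v' x \<bullet> g x) + \<sigma> x * v x * \<psi> x))"
      by (rule integral_diff; rule compact_support_integrable[OF A(1) K(1,2)])
         (use K in \<open>auto intro!: continuous_intros cs\<close>)
    also have "\<dots> = - \<mu> * integral A (\<lambda>x. D x * (v' x \<bullet> g x) + \<sigma> x * v x * \<psi> x)"
      using u0 by simp
    also have "\<dots> \<ge> 0" using v_sub[OF t \<psi>0] \<mu>(1) by (simp add: mult_le_0_iff)
    finally show "0 \<le> integral A (\<lambda>x. D x * (z' x \<bullet> g x) + \<sigma> x * z x * \<psi> x)" .
  qed
  have q\<Omega>: "q \<in> \<Omega>" using q(4) by blast
  \<comment> \<open>The contact point lies inside \<Omega> and is a minimum of \<open>u\<close>, so
    the gradient of \<open>u\<close> vanishes there.\<close>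
  have "(\<lambda>h. h \<bullet> p q) = (\<lambda>h. 0)"
    by (rule differential_zero_maxmin[OF q\<Omega> \<Omega>(1) p(1)[OF q\<Omega>, unfolded gderiv_def]])
       (use nn uq in auto)
  then have pq: "p q = 0" by (metis inner_eq_zero_iff)
  have nqa: "norm (q - a) = R" using q(5) by (simp add: dist_norm norm_minus_commute)
  have qR: "(q - a) \<bullet> (q - a) = R\<^sup>2"
    using nqa by (metis power2_norm_eq_inner)
  have zq: "z q = 0" using uq qR by (simp add: z_def v_def E_def)
  \<comment> \<open>On the way from \<open>q\<close> towards the centre \<open>u\<close> is
    stationary to first order while the barrier grows at a positive rate. Thus \<open>z\<close>,
    which is 0 at \<open>q\<close>, becomes negative inside the annulus.\<close>
  define \<phi> where "\<phi> = (\<lambda>t::real. z (q + t *\<^sub>R (a - q)))"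
  have "(\<phi> has_derivative (\<lambda>t. (t *\<^sub>R (a - q)) \<bullet> z' q)) (at 0)"
    unfolding \<phi>_def
    by (rule has_derivative_compose[of "\<lambda>t. q + t *\<^sub>R (a - q)" "\<lambda>t. t *\<^sub>R (a - q)" 0 UNIV z "\<lambda>h. h \<bullet> z' q"])
       (use z[OF q\<Omega>] in \<open>auto intro!: derivative_eq_intros simp: gderiv_def\<close>)
  moreover have "(a - q) \<bullet> z' q = - (2 * \<mu> * \<alpha> * E q * R\<^sup>2)"
  proof -
    have "(a - q) \<bullet> (q - a) = - R\<^sup>2" using qR by (metis inner_minus_left minus_diff_eq)
    then show ?thesis by (simp add: z'_def pq v'_def)
  qed
  then have "(\<lambda>t. (t *\<^sub>R (a - q)) \<bullet> z' q) = (*) (- (2 * \<mu> * \<alpha> * E q * R\<^sup>2))"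
    by (simp add: fun_eq_iff)
  ultimately have "DERIV \<phi> 0 :> - (2 * \<mu> * \<alpha> * E q * R\<^sup>2)"
    by (simp add: has_field_derivative_def)
  then obtain d where d: "d > 0" "\<And>h. 0 < h \<Longrightarrow> h < d \<Longrightarrow> \<phi> (0 + h) < \<phi> 0"
    using DERIV_neg_dec_right[of \<phi> "- (2 * \<mu> * \<alpha> * E q * R\<^sup>2)" 0] \<mu>(1) \<alpha>1 Epos[of q] q(1) by auto
  define h where "h = min (d/2) (1/4)"
  have h: "0 < h" "h < d" "h < 1/2" using d(1) by (auto simp: h_def)
  have "q + h *\<^sub>R (a - q) - a = (1 - h) *\<^sub>R (q - a)" by (simp add: algebra_simps)
  then have "dist a (q + h *\<^sub>R (a - q)) = (1 - h) * R"
    using nqa h by (simp add: dist_norm norm_minus_commute[of a])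
  moreover have "0 < h * R" "h * R < R / 2" using h q(1) by auto
  ultimately have "q + h *\<^sub>R (a - q) \<in> A"
    using h(3) unfolding A_def Diff_iff mem_ball mem_cball by (simp add: left_diff_distrib)
  then show False using zpos d(2)[OF h(1,2)] zq by (force simp: \<phi>_def)
qed

section \<open>Mollification\<close>

lemma compact_support_integrable_UNIV:
  fixes f :: "'a::euclidean_space \<Rightarrow> 'b::euclidean_space"
  assumes "compact K" "continuous_on UNIV f" "\<And>x. x \<notin> K \<Longrightarrow> f x = 0"
  shows "f integrable_on UNIV"
  by (rule compact_support_integrable[OF open_UNIV assms(1) _ assms(2)]) (use assms(3) in auto)

lemma continuous_on_convolution:
  fixes f :: "'a::euclidean_space \<Rightarrow> real" and k :: "'a \<Rightarrow> 'b::euclidean_space"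
  assumes K: "compact K" "continuous_on UNIV f" "\<And>x. x \<notin> K \<Longrightarrow> f x = 0"
    and k: "continuous_on UNIV k"
  shows "continuous_on UNIV (\<lambda>x. integral UNIV (\<lambda>y. f y *\<^sub>R k (x - y)))"
proof -
  obtain c where c: "K \<subseteq> cbox (-c) c"
    using bounded_subset_cbox_symmetric compact_imp_bounded K(1) by metis
  have "integral UNIV (\<lambda>y. f y *\<^sub>R k (x - y)) = integral (cbox (-c) c) (\<lambda>y. f y *\<^sub>R k (x - y))" for x
    using integral_eq_cbox[OF subset_UNIV c, of "\<lambda>y. f y *\<^sub>R k (x - y)"] K(3) by simp
  moreover have "continuous_on UNIV (\<lambda>x. integral (cbox (-c) c) (\<lambda>y. f y *\<^sub>R k (x - y)))"
    by (rule integral_continuous_on_param)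
       (auto simp: split_beta intro!: continuous_intros continuous_on_compose2[OF K(2)] continuous_on_compose2[OF k])
  ultimately show ?thesis by simp
qed

text \<open>The kernel carries the derivative, so the density \<open>f\<close> need only be
  continuous.\<close>

lemma has_derivative_convolution:
  fixes f :: "'a::euclidean_space \<Rightarrow> real" and k :: "'a \<Rightarrow> 'b::euclidean_space"
  assumes K: "compact K" "continuous_on UNIV f" "\<And>x. x \<notin> K \<Longrightarrow> f x = 0"
    and k: "\<And>z. (k has_derivative k' z) (at z)" "\<And>b. b \<in> Basis \<Longrightarrow> continuous_on UNIV (\<lambda>z. k' z b)"
  shows "((\<lambda>x. integral UNIV (\<lambda>y. f y *\<^sub>R k (x - y))) has_derivative
      (\<lambda>h. integral UNIV (\<lambda>y. f y *\<^sub>R k' (x - y) h))) (at x)"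
proof -
  obtain c where c: "K \<subseteq> cbox (-c) c"
    using bounded_subset_cbox_symmetric compact_imp_bounded K(1) by metis
  have eq: "integral UNIV (\<lambda>y. f y *\<^sub>R g y) = integral (cbox (-c) c) (\<lambda>y. f y *\<^sub>R g y)" for g :: "'a \<Rightarrow> 'b"
    using integral_eq_cbox[OF subset_UNIV c, of "\<lambda>y. f y *\<^sub>R g y"] K(3) by simp
  have contk: "continuous_on UNIV k"
    using k(1) has_derivative_continuous by (metis continuous_at_imp_continuous_on)
  define B where "B = (\<lambda>z. Blinfun (k' z))"
  have B: "blinfun_apply (B z) = k' z" for z
    unfolding B_def using has_derivative_bounded_linear[OF k(1)[of z]] bounded_linear_Blinfun_apply by blast
  have contB: "continuous_on UNIV B"
    by (rule continuous_on_blinfun_componentwise) (simp add: B k(2))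
  define F where "F = (\<lambda>x y. f y *\<^sub>R B (x - y))"
  have Fint: "F x integrable_on cbox (-c) c" for x
    unfolding F_def by (intro integrable_continuous continuous_intros continuous_on_compose2[OF contB]
        continuous_on_compose2[OF K(2)]) auto
  have "((\<lambda>x. integral (cbox (-c) c) (\<lambda>y. f y *\<^sub>R k (x - y))) has_derivative
      blinfun_apply (integral (cbox (-c) c) (F x))) (at x within UNIV)"
  proof (rule leibniz_rule)
    fix x y :: 'a
    have "((\<lambda>x. k (x - y)) has_derivative k' (x - y)) (at x)"
      by (rule has_derivative_compose[of "\<lambda>x. x - y" "\<lambda>h. h" x UNIV k, OF _ k(1)])
         (auto intro!: derivative_eq_intros)
    then have "((\<lambda>x. f y *\<^sub>R k (x - y)) has_derivative (\<lambda>h. f y *\<^sub>R k' (x - y) h)) (at x)"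
      by (rule has_derivative_scaleR_right)
    moreover have "blinfun_apply (F x y) = (\<lambda>h. f y *\<^sub>R k' (x - y) h)"
      by (simp add: fun_eq_iff F_def B blinfun.scaleR_left)
    ultimately show "((\<lambda>x. f y *\<^sub>R k (x - y)) has_derivative blinfun_apply (F x y)) (at x within UNIV)"
      by simp
  next
    show "(\<lambda>y. f y *\<^sub>R k (x - y)) integrable_on cbox (-c) c" for x
      by (intro integrable_continuous continuous_intros continuous_on_compose2[OF contk]
        continuous_on_compose2[OF K(2)]) auto
    show "continuous_on (UNIV \<times> cbox (-c) c) (\<lambda>(x, y). F x y)"
      unfolding F_def split_beta
      by (intro continuous_intros continuous_on_compose2[OF contB] continuous_on_compose2[OF K(2)]) auto
  qed auto
  moreover have "blinfun_apply (integral (cbox (-c) c) (F x)) =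
      (\<lambda>h. integral (cbox (-c) c) (\<lambda>y. f y *\<^sub>R k' (x - y) h))"
    unfolding fun_eq_iff blinfun_apply_integral[OF Fint] by (simp add: F_def B blinfun.scaleR_left)
  ultimately show ?thesis by (simp only: eq)
qed

text \<open>The third power makes this polynomial bump C^2, as required for mollified Hessians and
  for the Laplacians of cutoffs. It is not normalised; the mass is divided out where an average is
  meant.\<close>

definition bump :: "real \<Rightarrow> 'a::euclidean_space \<Rightarrow> real" where
  "bump d z = max 0 (d\<^sup>2 - z \<bullet> z) ^ 3"

definition bump_grad :: "real \<Rightarrow> 'a::euclidean_space \<Rightarrow> 'a" where
  "bump_grad d z = (- 6 * max 0 (d\<^sup>2 - z \<bullet> z) ^ 2) *\<^sub>R z"

definition bump_hess :: "real \<Rightarrow> 'a::euclidean_space \<Rightarrow> 'a \<Rightarrow> 'a" where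
  "bump_hess d z h = (24 * max 0 (d\<^sup>2 - z \<bullet> z) * (z \<bullet> h)) *\<^sub>R z - (6 * max 0 (d\<^sup>2 - z \<bullet> z) ^ 2) *\<^sub>R h"

lemma GDERIV_bump_arg: "GDERIV (\<lambda>z. d\<^sup>2 - z \<bullet> z) z :> - 2 *\<^sub>R z"
  unfolding gderiv_def by (auto intro!: derivative_eq_intros simp: inner_commute)

lemma GDERIV_bump: "GDERIV (bump d) z :> bump_grad d z"
  using GDERIV_DERIV_compose[OF GDERIV_bump_arg DERIV_max_0_power[of 1], of d z]
  unfolding bump_def[abs_def] bump_grad_def by (simp add: numeral_3_eq_3 numeral_2_eq_2)

lemma has_derivative_bump_grad: "(bump_grad d has_derivative bump_hess d z) (at z)"
proof -
  have "GDERIV (\<lambda>z. max 0 (d\<^sup>2 - z \<bullet> z) ^ 2) z :> (2 * max 0 (d\<^sup>2 - z \<bullet> z)) *\<^sub>R (- 2 *\<^sub>R z)"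
    using GDERIV_DERIV_compose[OF GDERIV_bump_arg DERIV_max_0_power[of 0], of d z]
    by (simp add: numeral_2_eq_2)
  from GDERIV_mult[OF GDERIV_const[of "-6"] this]
  have "GDERIV (\<lambda>z. - 6 * max 0 (d\<^sup>2 - z \<bullet> z) ^ 2) z :> (24 * max 0 (d\<^sup>2 - z \<bullet> z)) *\<^sub>R z"
    by simp
  from has_derivative_scaleR[OF this[unfolded gderiv_def] has_derivative_ident]
  show ?thesis
    unfolding bump_grad_def[abs_def] bump_hess_def[abs_def]
    by (rule has_derivative_eq_rhs) (auto simp: fun_eq_iff inner_commute algebra_simps)
qed

lemma bump_hess_symmetric: "bump_hess d z h \<bullet> k = h \<bullet> bump_hess d z k"
  by (simp add: bump_hess_def inner_diff_left inner_diff_right inner_commute)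

lemma continuous_on_bump [continuous_intros]:
  "continuous_on S g \<Longrightarrow> continuous_on S (\<lambda>x. bump d (g x))"
  "continuous_on S g \<Longrightarrow> continuous_on S (\<lambda>x. bump_grad d (g x))"
  "continuous_on S g \<Longrightarrow> continuous_on S (\<lambda>x. bump_hess d (g x) h)"
  unfolding bump_def bump_grad_def bump_hess_def by (auto intro!: continuous_intros)

lemma bump_nonneg: "0 \<le> bump d z" by (simp add: bump_def)

lemma bump_minus: "bump d (- z) = bump d z" by (simp add: bump_def)

lemma bump_pos: "norm z < d \<Longrightarrow> 0 < bump d z"
  unfolding bump_def power2_norm_eq_inner[symmetric]
  by (auto simp: less_max_iff_disj power_strict_mono)

lemma bump_eq_0: "0 \<le> d \<Longrightarrow> d \<le> norm z \<Longrightarrow> bump d z = 0"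
  unfolding bump_def power2_norm_eq_inner[symmetric] by (simp add: max_def power_mono)

lemma test_on_bump: "test_on UNIV (\<lambda>y. bump d (x - y)) (\<lambda>y. - bump_grad d (x - y))"
proof -
  have "GDERIV (\<lambda>y. bump d (x - y)) y :> - bump_grad d (x - y)" for y
    unfolding gderiv_def
    by (rule has_derivative_eq_rhs[OF has_derivative_compose[of "\<lambda>y. x - y" "\<lambda>h. - h" y UNIV "bump d",
          OF _ GDERIV_bump[unfolded gderiv_def]]]) (auto intro!: derivative_eq_intros)
  moreover have "bump d (x - y) = 0" if "y \<notin> cball x \<bar>d\<bar>" for y
    using bump_eq_0[of "\<bar>d\<bar>" "x - y"] that by (simp add: dist_norm bump_def)
  ultimately show ?thesis
    unfolding test_on_def by (auto intro!: exI[of _ "cball x \<bar>d\<bar>"] continuous_intros)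
qed

text \<open>The mass depends on the dimension, hence the type argument.\<close>

definition bump_mass :: "real \<Rightarrow> 'a::euclidean_space itself \<Rightarrow> real" where
  "bump_mass d _ = integral UNIV (bump d :: 'a \<Rightarrow> real)"

lemma bump_mass_pos:
  assumes "0 < d" shows "0 < bump_mass d TYPE('a::euclidean_space)"
proof (rule ccontr)
  assume "\<not> 0 < bump_mass d TYPE('a)"
  then have le: "integral UNIV (bump d :: 'a \<Rightarrow> real) \<le> 0" by (simp add: bump_mass_def)
  have "bump d (0::'a) = 0"
  proof (rule compact_support_integral_nonpos_imp_zero[OF open_UNIV compact_cball[of 0 d] subset_UNIV _ _ _ le UNIV_I])
    show "continuous_on UNIV (bump d :: 'a \<Rightarrow> real)" by (rule continuous_on_bump(1)[OF continuous_on_id])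
    show "bump d x = 0" if "x \<in> UNIV - cball 0 d" for x :: 'a
      using bump_eq_0[of d x] assms that by simp
    show "0 \<le> bump d x" for x :: 'a by (rule bump_nonneg)
  qed
  then show False using bump_pos[of "0::'a" d] assms by simp
qed

lemma integral_bump_shift:
  fixes x :: "'a::euclidean_space"
  assumes "0 < d" shows "integral UNIV (\<lambda>y. bump d (x - y)) = bump_mass d TYPE('a)"
proof -
  obtain c where c: "cball 0 d \<subseteq> cbox (-c) (c::'a)"
    using bounded_subset_cbox_symmetric bounded_cball by metis
  have "bump_mass d TYPE('a) = integral (cbox (-c) c) (bump d)"
  proof -
    have "bump d y = 0" if "y \<notin> cball 0 d" for y :: 'a using bump_eq_0[of d y] assms that by simp
    then show ?thesis unfolding bump_mass_def using integral_eq_cbox[OF subset_UNIV c, of "bump d"] by simp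
  qed
  also have "\<dots> = integral (cbox (-c - (-x)) (c - (-x))) (\<lambda>y. bump d (y + (-x)))"
    by (rule integral_shift_cbox[symmetric])
  also have "\<dots> = integral UNIV (\<lambda>y. bump d (y + (-x)))"
  proof -
    have "cball x d \<subseteq> cbox (-c - (-x)) (c - (-x))"
    proof
      fix y assume "y \<in> cball x d"
      then have "y - x \<in> cbox (-c) c" using c by (auto simp: dist_norm norm_minus_commute)
      then show "y \<in> cbox (-c - (-x)) (c - (-x))" by (auto simp: mem_box algebra_simps)
    qed
    moreover have "bump d (y + (-x)) = 0" if "y \<notin> cball x d" for y
      using bump_eq_0[of d "y - x"] assms that by (simp add: dist_norm norm_minus_commute)
    ultimately show ?thesis
      using integral_eq_cbox[OF subset_UNIV, of "cball x d" "-c - (-x)" "c - (-x)" "\<lambda>y. bump d (y + (-x))"]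
      by simp
  qed
  also have "\<dots> = integral UNIV (\<lambda>y. bump d (x - y))"
  proof -
    have "bump d (y + (-x)) = bump d (x - y)" for y using bump_minus[of d "x - y"] by simp
    then show ?thesis by simp
  qed
  finally show ?thesis by simp
qed

lemma uniformly_continuous_compact_support:
  fixes f :: "'a::euclidean_space \<Rightarrow> 'b::real_normed_vector"
  assumes K: "compact K" "continuous_on UNIV f" "\<And>x. x \<notin> K \<Longrightarrow> f x = 0" and "0 < e"
  obtains d where "0 < d" "\<And>x y. dist x y < d \<Longrightarrow> dist (f x) (f y) < e"
proof -
  define S where "S = {x + y |x y. x \<in> K \<and> y \<in> cball 0 1}"
  have "compact S" unfolding S_def by (rule compact_sums[OF K(1) compact_cball])
  then have "uniformly_continuous_on S f"
    using compact_uniformly_continuous continuous_on_subset[OF K(2)] by blast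
  then obtain d where d: "d > 0" "\<And>x y. x \<in> S \<Longrightarrow> y \<in> S \<Longrightarrow> dist y x < d \<Longrightarrow> dist (f y) (f x) < e"
    by (rule uniformly_continuous_onE[OF _ \<open>0 < e\<close>]) blast
  have inS: "y \<in> S" if "x \<in> K" "dist x y < 1" for x y
  proof -
    have "y = x + (y - x)" "y - x \<in> cball 0 1" using that by (auto simp: dist_norm norm_minus_commute)
    then show ?thesis unfolding S_def using that by blast
  qed
  have "dist (f x) (f y) < e" if "dist x y < min d 1" for x y
  proof (cases "x \<in> K \<or> y \<in> K")
    case True
    then have "x \<in> S" "y \<in> S" using inS[of x x] inS[of x y] inS[of y x] inS[of y y] that
      by (auto simp: dist_commute)
    then show ?thesis using d(2) that by simp
  qed (use K(3) \<open>0 < e\<close> in auto)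
  then show thesis using that[of "min d 1"] d(1) by auto
qed

lemma mollifier_approximates:
  fixes f :: "'a::euclidean_space \<Rightarrow> 'b::euclidean_space"
  assumes K: "compact K" "continuous_on UNIV f" "\<And>x. x \<notin> K \<Longrightarrow> f x = 0" and e: "0 < e"
  obtains d\<^sub>0 where "0 < d\<^sub>0" "\<And>d x. 0 < d \<Longrightarrow> d < d\<^sub>0 \<Longrightarrow>
     norm (integral UNIV (\<lambda>y. bump d (x - y) *\<^sub>R f y) /\<^sub>R bump_mass d TYPE('a) - f x) \<le> e"
proof -
  obtain d\<^sub>0 where d0: "0 < d\<^sub>0" "\<And>x y. dist x y < d\<^sub>0 \<Longrightarrow> dist (f x) (f y) < e"
    using uniformly_continuous_compact_support[OF K e] by blast
  have "norm (integral UNIV (\<lambda>y. bump d (x - y) *\<^sub>R f y) /\<^sub>R bump_mass d TYPE('a) - f x) \<le> e"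
    if d: "0 < d" "d < d\<^sub>0" for d x
  proof -
    let ?c = "bump_mass d TYPE('a)"
    have c: "?c > 0" by (rule bump_mass_pos[OF d(1)])
    have supp: "bump d (x - y) = 0" if "y \<notin> cball x d" for y
      using bump_eq_0[of d "x - y"] that d(1) by (simp add: dist_norm)
    have i1: "(\<lambda>y. bump d (x - y) *\<^sub>R g y) integrable_on UNIV" if "continuous_on UNIV g" for g :: "'a \<Rightarrow> 'b"
      by (rule compact_support_integrable_UNIV[of "cball x d"]) (use supp that in \<open>auto intro!: continuous_intros\<close>)
    have i2: "(\<lambda>y. bump d (x - y)) integrable_on UNIV"
      by (rule compact_support_integrable_UNIV[of "cball x d"]) (use supp in \<open>auto intro!: continuous_intros\<close>)
    have ib: "integral UNIV (\<lambda>y. bump d (x - y)) = ?c" by (rule integral_bump_shift[OF d(1)])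
    have "integral UNIV (\<lambda>y. bump d (x - y) *\<^sub>R f y) - ?c *\<^sub>R f x =
        integral UNIV (\<lambda>y. bump d (x - y) *\<^sub>R f y) - integral UNIV (\<lambda>y. bump d (x - y) *\<^sub>R f x)"
      using ib integral_linear[OF i2 bounded_linear_scaleR_left[of "f x"]] by (simp add: o_def)
    also have "\<dots> = integral UNIV (\<lambda>y. bump d (x - y) *\<^sub>R (f y - f x))"
      using i1[of f] i1[of "\<lambda>_. f x"] K(2) by (simp add: integral_diff scaleR_diff_right)
    also have "norm \<dots> \<le> integral UNIV (\<lambda>y. e * bump d (x - y))"
    proof (rule integral_norm_bound_integral)
      show "(\<lambda>y. bump d (x - y) *\<^sub>R (f y - f x)) integrable_on UNIV"
        by (rule i1) (intro continuous_intros K)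
      show "(\<lambda>y. e * bump d (x - y)) integrable_on UNIV"
        using integrable_on_cmult_left[OF i2, of e] by simp
      show "norm (bump d (x - y) *\<^sub>R (f y - f x)) \<le> e * bump d (x - y)" for y
      proof (cases "dist x y < d")
        case True
        then have "norm (f y - f x) \<le> e"
          using d0(2)[of x y] d(2) by (simp add: dist_norm norm_minus_commute less_imp_le)
        from mult_right_mono[OF this bump_nonneg[of d "x - y"]]
        show ?thesis by (simp add: bump_nonneg mult.commute)
      qed (use bump_eq_0[of d "x - y"] d(1) in \<open>simp add: dist_norm\<close>)
    qed
    also have "\<dots> = e * ?c" using ib by simp
    finally have le: "norm (integral UNIV (\<lambda>y. bump d (x - y) *\<^sub>R f y) - ?c *\<^sub>R f x) \<le> e * ?c" .
    have "integral UNIV (\<lambda>y. bump d (x - y) *\<^sub>R f y) /\<^sub>R ?c - f x =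
        (integral UNIV (\<lambda>y. bump d (x - y) *\<^sub>R f y) - ?c *\<^sub>R f x) /\<^sub>R ?c"
      using c by (simp add: scaleR_diff_right)
    then have "norm (integral UNIV (\<lambda>y. bump d (x - y) *\<^sub>R f y) /\<^sub>R ?c - f x) =
        norm (integral UNIV (\<lambda>y. bump d (x - y) *\<^sub>R f y) - ?c *\<^sub>R f x) / ?c"
      using c by (simp add: divide_inverse_commute)
    then show ?thesis using le c by (simp add: pos_divide_le_eq)
  qed
  then show thesis using that d0(1) by blast
qed

section \<open>A Carleman estimate\<close>

text \<open>The trace of a linear map composed with a rank-one map, without coordinates. The
  divergences of products below lead to such sums.\<close>

lemma sum_Basis_linear_inner:
  fixes L :: "'a::euclidean_space \<Rightarrow> 'a"
  assumes "linear L"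
  shows "(\<Sum>b\<in>Basis. (L b \<bullet> y) * (x \<bullet> b)) = L x \<bullet> y"
proof -
  have "L x = L (\<Sum>b\<in>Basis. (x \<bullet> b) *\<^sub>R b)" by (simp add: euclidean_representation)
  also have "\<dots> = (\<Sum>b\<in>Basis. (x \<bullet> b) *\<^sub>R L b)"
    using assms by (simp add: linear_sum linear_scale)
  finally show ?thesis by (simp add: inner_sum_left mult.commute)
qed

text \<open>The integrand is the divergence of (G \<bullet> p) p - |p|^2 G / 2. The terms H p
  \<bullet> G and H G \<bullet> p cancel by the symmetry of \<open>H\<close>, so the Hessian
  survives only through its trace.\<close>

lemma rellich_identity_C1:
  fixes p G Q :: "'a::euclidean_space \<Rightarrow> 'a"
  assumes K: "compact K" "\<And>x. x \<notin> K \<Longrightarrow> p x = 0"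
    and p: "\<And>x. (p has_derivative H x) (at x)" "\<And>b. b \<in> Basis \<Longrightarrow> continuous_on UNIV (\<lambda>x. H x b)"
    and sym: "\<And>x h k. H x h \<bullet> k = h \<bullet> H x k"
    and G: "\<And>x. G x = g\<^sub>0 + Q x" and Q: "linear Q"
  shows "integral UNIV (\<lambda>x. (\<Sum>b\<in>Basis. H x b \<bullet> b) * (p x \<bullet> G x) + Q (p x) \<bullet> p x
      - (\<Sum>b\<in>Basis. Q b \<bullet> b) * (p x \<bullet> p x) / 2) = 0"
proof -
  have Qd: "(Q has_derivative Q) (at x)" for x
    using linear_imp_has_derivative[OF Q] .
  have Gd: "(G has_derivative Q) (at x)" for x
    unfolding G by (auto intro!: derivative_eq_intros Qd)
  have Qc: "continuous_on UNIV Q" using linear_continuous_on[of Q] Q by (simp add: linear_conv_bounded_linear)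
  have Gc: "continuous_on UNIV G" unfolding G by (intro continuous_intros Qc)
  have pc: "continuous_on UNIV p"
    using p(1) has_derivative_continuous by (metis continuous_at_imp_continuous_on)
  define DY where "DY = (\<lambda>x h. (G x \<bullet> p x) *\<^sub>R H x h + (G x \<bullet> H x h + Q h \<bullet> p x) *\<^sub>R p x
      - ((p x \<bullet> p x / 2) *\<^sub>R Q h + (p x \<bullet> H x h) *\<^sub>R G x))"
  have "integral UNIV (\<lambda>x. \<Sum>b\<in>Basis. DY x b \<bullet> b) = 0"
  proof (rule integral_divergence_zero[OF open_UNIV K(1) subset_UNIV,
        of "\<lambda>x. (G x \<bullet> p x) *\<^sub>R p x - (p x \<bullet> p x / 2) *\<^sub>R G x"])
    show "((\<lambda>x. (G x \<bullet> p x) *\<^sub>R p x - (p x \<bullet> p x / 2) *\<^sub>R G x) has_derivative DY x) (at x)" for x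
      unfolding DY_def
      by (auto intro!: derivative_eq_intros p(1) Gd simp: fun_eq_iff inner_commute)
    show "continuous_on UNIV (\<lambda>x. DY x b)" if "b \<in> Basis" for b
      unfolding DY_def by (intro continuous_intros p(2)[OF that] Gc pc) auto
  qed (use K(2) in simp)
  moreover have "(\<Sum>b\<in>Basis. DY x b \<bullet> b) = (\<Sum>b\<in>Basis. H x b \<bullet> b) * (p x \<bullet> G x) + Q (p x) \<bullet> p x
      - (\<Sum>b\<in>Basis. Q b \<bullet> b) * (p x \<bullet> p x) / 2" for x
  proof -
    have Hl: "linear (H x)" using p(1) has_derivative_linear by blast
    have 1: "(\<Sum>b\<in>Basis. (H x b \<bullet> G x) * (p x \<bullet> b)) = H x (p x) \<bullet> G x"
      by (rule sum_Basis_linear_inner[OF Hl])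
    have 2: "(\<Sum>b\<in>Basis. (H x b \<bullet> p x) * (G x \<bullet> b)) = H x (G x) \<bullet> p x"
      by (rule sum_Basis_linear_inner[OF Hl])
    have 3: "(\<Sum>b\<in>Basis. (Q b \<bullet> p x) * (p x \<bullet> b)) = Q (p x) \<bullet> p x"
      by (rule sum_Basis_linear_inner[OF Q])
    have "(\<Sum>b\<in>Basis. DY x b \<bullet> b) = (\<Sum>b\<in>Basis. (G x \<bullet> p x) * (H x b \<bullet> b)
        + ((H x b \<bullet> G x) * (p x \<bullet> b) + (Q b \<bullet> p x) * (p x \<bullet> b))
        - ((p x \<bullet> p x / 2) * (Q b \<bullet> b) + (H x b \<bullet> p x) * (G x \<bullet> b)))"
      unfolding DY_def
      by (rule sum.cong[OF refl]) (simp add: inner_add_left inner_diff_left inner_commute[of "G x" "H x _"]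
          inner_commute[of "p x" "H x _"] distrib_right)
    also have "\<dots> = (G x \<bullet> p x) * (\<Sum>b\<in>Basis. H x b \<bullet> b) + (H x (p x) \<bullet> G x + Q (p x) \<bullet> p x)
        - ((p x \<bullet> p x / 2) * (\<Sum>b\<in>Basis. Q b \<bullet> b) + H x (G x) \<bullet> p x)"
      by (simp only: sum.distrib sum_subtractf sum_distrib_left[symmetric] 1 2 3)
    also have "H x (G x) \<bullet> p x = H x (p x) \<bullet> G x" by (metis inner_commute sym)
    finally show ?thesis by (simp add: inner_commute algebra_simps)
  qed
  ultimately show ?thesis by simp
qed

lemma integral_tendsto_uniform_bound:
  fixes f :: "nat \<Rightarrow> 'a::euclidean_space \<Rightarrow> real"
  assumes K: "compact K" and f: "\<And>n. continuous_on UNIV (f n)" "\<And>n x. x \<notin> K \<Longrightarrow> f n x = 0"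
    and bd: "\<And>n x. \<bar>f n x\<bar> \<le> B" and lim: "\<And>x. (\<lambda>n. f n x) \<longlonglongrightarrow> g x"
  shows "(\<lambda>n. integral UNIV (f n)) \<longlonglongrightarrow> integral UNIV g"
proof -
  obtain c where c: "K \<subseteq> cbox (-c) c"
    using bounded_subset_cbox_symmetric compact_imp_bounded K by metis
  have g0: "g x = 0" if "x \<notin> K" for x
    using lim[of x] f(2)[OF that] by (simp add: LIMSEQ_const_iff)
  have "(\<lambda>n. integral (cbox (-c) c) (f n)) \<longlonglongrightarrow> integral (cbox (-c) c) g"
    by (rule dominated_convergence(2)[where h = "\<lambda>_. B"])
       (use bd lim continuous_on_subset[OF f(1) subset_UNIV] in \<open>auto intro!: integrable_continuous\<close>)
  moreover have "integral (cbox (-c) c) (f n) = integral UNIV (f n)" for n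
    using integral_eq_cbox[OF subset_UNIV c, of "f n"] f(2) by simp
  moreover have "integral (cbox (-c) c) g = integral UNIV g"
    using integral_eq_cbox[OF subset_UNIV c, of g] g0 by simp
  ultimately show ?thesis by simp
qed

lemma integral_gradient_zero:
  fixes g :: "'a::euclidean_space \<Rightarrow> 'a"
  assumes t: "test_on UNIV \<psi> g"
  shows "integral UNIV g = 0"
proof (rule euclidean_eqI)
  fix b :: 'a assume "b \<in> Basis"
  obtain K where K: "compact K" "\<And>x. x \<in> UNIV - K \<Longrightarrow> \<psi> x = 0" "\<And>x. x \<in> UNIV - K \<Longrightarrow> g x = 0"
    "\<And>x. x \<in> UNIV \<Longrightarrow> GDERIV \<psi> x :> g x" "continuous_on UNIV g"
    using test_onE[OF t open_UNIV] by metis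
  have "integral UNIV (\<lambda>x. b \<bullet> g x) = 0"
    by (rule integral_directional_derivative_zero[of \<psi> "\<lambda>x h. h \<bullet> g x" b K])
       (use K compact_imp_bounded in \<open>auto simp: gderiv_def intro!: continuous_intros\<close>)
  moreover have "g integrable_on UNIV"
    by (rule compact_support_integrable_UNIV[OF K(1,5)]) (use K(3) in simp)
  ultimately show "integral UNIV g \<bullet> b = 0 \<bullet> b"
    using integral_component_eq[of g UNIV b] by (simp add: inner_commute[of _ b])
qed

text \<open>The gradient in y of the compactly supported product of kernel and \<open>v\<close>
  integrates to zero. Hence the mollified gradient of \<open>v\<close> is the gradient of the
  mollified \<open>v\<close>, and so differentiable.\<close>

lemma convolution_gradient:
  fixes q :: "'a::euclidean_space \<Rightarrow> 'a"
  assumes t: "test_on UNIV v q"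
  shows "integral UNIV (\<lambda>y. bump d (x - y) *\<^sub>R q y) = integral UNIV (\<lambda>y. v y *\<^sub>R bump_grad d (x - y))"
proof -
  obtain K where K: "compact K" "\<And>x. x \<in> UNIV - K \<Longrightarrow> v x = 0" "\<And>x. x \<in> UNIV - K \<Longrightarrow> q x = 0"
    "continuous_on UNIV q" "continuous_on UNIV v"
    using test_onE[OF t open_UNIV] by metis
  have "test_on UNIV (\<lambda>y. bump d (x - y) * v y)
      (\<lambda>y. bump d (x - y) *\<^sub>R q y + v y *\<^sub>R (- bump_grad d (x - y)))"
    using test_on_bump[of d x] by (intro test_on_mult[OF open_UNIV t]) (auto simp: test_on_def)
  then have "integral UNIV (\<lambda>y. bump d (x - y) *\<^sub>R q y + v y *\<^sub>R (- bump_grad d (x - y))) = 0"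
    by (rule integral_gradient_zero)
  moreover have "(\<lambda>y. bump d (x - y) *\<^sub>R q y) integrable_on UNIV" "(\<lambda>y. v y *\<^sub>R bump_grad d (x - y)) integrable_on UNIV"
    by (rule compact_support_integrable_UNIV[OF K(1)]; use K in \<open>auto intro!: continuous_intros\<close>)+
  ultimately show ?thesis by (simp add: integral_diff)
qed

text \<open>The trace of the mollified Hessian: one integration by parts moves a derivative from the
  kernel to \<open>v\<close>, and the weak equation tested with the shifted kernel does the
  rest.\<close>

lemma convolution_laplacian:
  fixes q :: "'a::euclidean_space \<Rightarrow> 'a"
  assumes t: "test_on UNIV v q"
    and M: "compact K\<^sub>0" "continuous_on UNIV M" "\<And>x. x \<notin> K\<^sub>0 \<Longrightarrow> M x = 0"
    and weak: "\<And>\<psi> g. test_on UNIV \<psi> g \<Longrightarrow> integral UNIV (\<lambda>x. M x * \<psi> x + q x \<bullet> g x) = 0"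
  shows "(\<Sum>b\<in>Basis. integral UNIV (\<lambda>y. v y *\<^sub>R bump_hess d (x - y) b) \<bullet> b)
      = integral UNIV (\<lambda>y. bump d (x - y) *\<^sub>R M y)"
proof -
  obtain K where K: "compact K" "\<And>x. x \<in> UNIV - K \<Longrightarrow> v x = 0" "\<And>x. x \<in> UNIV - K \<Longrightarrow> q x = 0"
    "\<And>x. x \<in> UNIV \<Longrightarrow> GDERIV v x :> q x" "continuous_on UNIV q" "continuous_on UNIV v"
    using test_onE[OF t open_UNIV] by metis
  have i: "(\<lambda>y. q y \<bullet> bump_grad d (x - y)) integrable_on UNIV"
    "(\<lambda>y. v y *\<^sub>R bump_hess d (x - y) b) integrable_on UNIV"
    "(\<lambda>y. v y * (\<Sum>b\<in>Basis. bump_hess d (x - y) b \<bullet> b)) integrable_on UNIV" for b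
    by (rule compact_support_integrable_UNIV[OF K(1)]; use K in \<open>auto intro!: continuous_intros\<close>)+
  have iM: "(\<lambda>y. M y * bump d (x - y)) integrable_on UNIV"
    by (rule compact_support_integrable_UNIV[OF M(1)]) (use M in \<open>auto intro!: continuous_intros\<close>)
  have hess_minus: "bump_hess d z (- h) = - bump_hess d z h" for z h :: 'a
    by (simp add: bump_hess_def)
  have "integral UNIV (\<lambda>y. q y \<bullet> bump_grad d (x - y) + v y * (\<Sum>b\<in>Basis. bump_hess d (x - y) (- b) \<bullet> b)) = 0"
  proof (rule integral_div_scaleR_zero[OF open_UNIV K(1) subset_UNIV K(4,5,2)])
    fix y
    show "((\<lambda>y. bump_grad d (x - y)) has_derivative (\<lambda>h. bump_hess d (x - y) (- h))) (at y)"
      by (rule has_derivative_compose[of "\<lambda>y. x - y" "\<lambda>h. - h" y UNIV "bump_grad d",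
          OF _ has_derivative_bump_grad]) (auto intro!: derivative_eq_intros)
  qed (auto intro!: continuous_intros)
  then have "integral UNIV (\<lambda>y. q y \<bullet> bump_grad d (x - y) - v y * (\<Sum>b\<in>Basis. bump_hess d (x - y) b \<bullet> b)) = 0"
    by (simp add: hess_minus sum_negf)
  then have "integral UNIV (\<lambda>y. v y * (\<Sum>b\<in>Basis. bump_hess d (x - y) b \<bullet> b)) =
      integral UNIV (\<lambda>y. q y \<bullet> bump_grad d (x - y))"
    using i by (simp add: integral_diff)
  also have "\<dots> = integral UNIV (\<lambda>y. M y * bump d (x - y))"
    using weak[OF test_on_bump[of d x]] i(1) iM by (simp add: integral_diff)
  finally have *: "integral UNIV (\<lambda>y. v y * (\<Sum>b\<in>Basis. bump_hess d (x - y) b \<bullet> b)) =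
      integral UNIV (\<lambda>y. M y * bump d (x - y))" .
  have "(\<Sum>b\<in>Basis. integral UNIV (\<lambda>y. v y *\<^sub>R bump_hess d (x - y) b) \<bullet> b) =
      (\<Sum>b\<in>Basis. integral UNIV (\<lambda>y. (v y *\<^sub>R bump_hess d (x - y) b) \<bullet> b))"
    by (simp only: integral_component_eq[OF i(2)])
  also have "\<dots> = integral UNIV (\<lambda>y. \<Sum>b\<in>Basis. (v y *\<^sub>R bump_hess d (x - y) b) \<bullet> b)"
    by (rule integral_sum[symmetric]) (auto intro: integrable_component[OF i(2), simplified])
  finally show ?thesis using * by (simp add: sum_distrib_left mult.commute)
qed

text \<open>Here \<open>v\<close> has no second derivatives, so the C^1 identity is applied to
  mollifications. It contains the Hessian only through the trace, which is the mollified
  \<open>M\<close> and converges; convergence of the full Hessian is never at issue.\<close>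

lemma rellich_identity:
  fixes q G Q :: "'a::euclidean_space \<Rightarrow> 'a"
  assumes t: "test_on UNIV v q"
    and M: "compact K\<^sub>0" "continuous_on UNIV M" "\<And>x. x \<notin> K\<^sub>0 \<Longrightarrow> M x = 0"
    and weak: "\<And>\<psi> g. test_on UNIV \<psi> g \<Longrightarrow> integral UNIV (\<lambda>x. M x * \<psi> x + q x \<bullet> g x) = 0"
    and G: "\<And>x. G x = g\<^sub>0 + Q x" and Q: "linear Q"
  shows "integral UNIV (\<lambda>x. M x * (q x \<bullet> G x) + Q (q x) \<bullet> q x
      - (\<Sum>b\<in>Basis. Q b \<bullet> b) * (q x \<bullet> q x) / 2) = 0"
proof -
  obtain K\<^sub>1 where K1: "compact K\<^sub>1" "\<And>x. x \<in> UNIV - K\<^sub>1 \<Longrightarrow> v x = 0" "\<And>x. x \<in> UNIV - K\<^sub>1 \<Longrightarrow> q x = 0"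
    "\<And>x. x \<in> UNIV \<Longrightarrow> GDERIV v x :> q x" "continuous_on UNIV q" "continuous_on UNIV v"
    using test_onE[OF t open_UNIV] by metis
  define K where "K = K\<^sub>0 \<union> K\<^sub>1"
  have K: "compact K" "\<And>x. x \<notin> K \<Longrightarrow> v x = 0" "\<And>x. x \<notin> K \<Longrightarrow> q x = 0" "\<And>x. x \<notin> K \<Longrightarrow> M x = 0"
    unfolding K_def using K1 M by auto
  obtain e1 where e1: "0 < e1" "\<And>d x. 0 < d \<Longrightarrow> d < e1 \<Longrightarrow>
     norm (integral UNIV (\<lambda>y. bump d (x - y) *\<^sub>R q y) /\<^sub>R bump_mass d TYPE('a) - q x) \<le> 1"
    using mollifier_approximates[OF K(1) K1(5) K(3), of 1] by auto
  obtain e2 where e2: "0 < e2" "\<And>d x. 0 < d \<Longrightarrow> d < e2 \<Longrightarrow>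
     norm (integral UNIV (\<lambda>y. bump d (x - y) *\<^sub>R M y) /\<^sub>R bump_mass d TYPE('a) - M x) \<le> 1"
    using mollifier_approximates[OF K(1) M(2) K(4), of 1] by auto
  \<comment> \<open>Radii below 1 keep all supports in the fixed set \<open>S\<close>; radii below
    \<open>e1\<close> and \<open>e2\<close> bound the mollified gradient and Laplacian
    uniformly.\<close>
  define e where "e = min 1 (min e1 e2)"
  \<comment> \<open>The double \<open>Suc\<close> makes even the first radius strictly smaller than
    \<open>e\<close>.\<close>
  define d where "d = (\<lambda>n. e * inverse (real (Suc (Suc n))))"
  have e: "0 < e" using e1 e2 by (simp add: e_def)
  have d: "0 < d n" "d n < e" for n using e by (auto simp: d_def field_simps intro: add_pos_nonneg)
  have d0: "d \<longlonglongrightarrow> 0"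
    unfolding d_def using LIMSEQ_Suc[OF LIMSEQ_inverse_real_of_nat] tendsto_mult_right_zero by blast
  define c where "c = (\<lambda>n. bump_mass (d n) TYPE('a))"
  define p where "p = (\<lambda>n x. integral UNIV (\<lambda>y. v y *\<^sub>R bump_grad (d n) (x - y)) /\<^sub>R c n)"
  define H where "H = (\<lambda>n x h. integral UNIV (\<lambda>y. v y *\<^sub>R bump_hess (d n) (x - y) h) /\<^sub>R c n)"
  define m where "m = (\<lambda>n x. integral UNIV (\<lambda>y. bump (d n) (x - y) *\<^sub>R M y) /\<^sub>R c n)"
  have p_eq: "p n x = integral UNIV (\<lambda>y. bump (d n) (x - y) *\<^sub>R q y) /\<^sub>R c n" for n x
    unfolding p_def using convolution_gradient[OF t] by simp
  have trH: "(\<Sum>b\<in>Basis. H n x b \<bullet> b) = m n x" for n x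
    unfolding H_def m_def using convolution_laplacian[OF t M weak, of "d n" x]
    by (simp add: sum_distrib_left[symmetric])
  define S where "S = {x + y |x y. x \<in> K \<and> y \<in> cball 0 1}"
  have S: "compact S" unfolding S_def by (rule compact_sums[OF K(1) compact_cball])
  have bump0: "bump (d n) (x - y) = 0" if "x \<notin> S" "y \<in> K" for n x y
  proof (rule bump_eq_0)
    show "0 \<le> d n" using d(1)[of n] by simp
    show "d n \<le> norm (x - y)"
    proof (rule ccontr)
      assume "\<not> d n \<le> norm (x - y)"
      then have "x - y \<in> cball 0 1" using d(2)[of n] by (simp add: e_def)
      then have "y + (x - y) \<in> S" using that(2) unfolding S_def by blast
      then show False using that(1) by simp
    qed
  qed
  have p0: "p n x = 0" if "x \<notin> S" for n x
  proof -
    have "(\<lambda>y. bump (d n) (x - y) *\<^sub>R q y) = (\<lambda>y. 0)" using bump0[OF that] K(3) by force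
    then show ?thesis unfolding p_eq by simp
  qed
  have pd: "(p n has_derivative H n x) (at x)" for n x
    unfolding p_def H_def
    by (intro has_derivative_scaleR_right has_derivative_convolution[OF K(1) K1(6) K(2)]
        has_derivative_bump_grad) (auto intro!: continuous_intros)
  have Hc: "continuous_on UNIV (\<lambda>x. H n x h)" for n h
    unfolding H_def by (intro continuous_intros continuous_on_convolution[OF K(1) K1(6) K(2)])
  have mc: "continuous_on UNIV (m n)" for n
    using continuous_on_convolution[OF K(1) M(2) K(4), of "bump (d n)"]
    unfolding m_def by (auto intro!: continuous_intros continuous_on_bump(1)[OF continuous_on_id] simp: mult.commute)
  have sym: "H n x h \<bullet> k = h \<bullet> H n x k" for n x h k
  proof -
    have i: "(\<lambda>y. v y *\<^sub>R bump_hess (d n) (x - y) h) integrable_on UNIV" for h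
      by (rule compact_support_integrable_UNIV[OF K(1)]) (use K K1(6) in \<open>auto intro!: continuous_intros\<close>)
    have "integral UNIV (\<lambda>y. v y *\<^sub>R bump_hess (d n) (x - y) h) \<bullet> k =
        h \<bullet> integral UNIV (\<lambda>y. v y *\<^sub>R bump_hess (d n) (x - y) k)"
      using integral_linear[OF i[of h] bounded_linear_inner_left[of k]]
        integral_linear[OF i[of k] bounded_linear_inner_right[of h]]
      by (simp add: o_def bump_hess_symmetric)
    then show ?thesis by (simp add: H_def)
  qed
  define T where "T = (\<Sum>b\<in>Basis. Q b \<bullet> b)"
  define F where "F = (\<lambda>n x. m n x * (p n x \<bullet> G x) + Q (p n x) \<bullet> p n x - T * (p n x \<bullet> p n x) / 2)"
  have F0: "integral UNIV (F n) = 0" for n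
    using rellich_identity_C1[OF S p0[where n = n] pd[of n] Hc[of n] sym[of n] G Q] unfolding F_def trH T_def by simp
  have bl: "bounded_linear Q" using Q by (simp add: linear_conv_bounded_linear)
  then obtain BQ where BQ: "\<And>x. norm (Q x) \<le> norm x * BQ" "BQ \<ge> 0"
    using bounded_linear.nonneg_bounded by blast
  have Qc: "continuous_on A Q" for A using linear_continuous_on[OF bl] .
  have Gc: "continuous_on A G" for A unfolding G by (intro continuous_intros Qc)
  have pc: "continuous_on UNIV (p n)" for n
    using pd has_derivative_continuous by (metis continuous_at_imp_continuous_on)
  obtain Bq where Bq: "Bq \<ge> 0" "\<And>x. x \<in> K \<Longrightarrow> norm (q x) \<le> Bq"
    using continuous_on_compact_bound[OF K(1) continuous_on_subset[OF K1(5) subset_UNIV]] by blast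
  obtain BM where BM: "BM \<ge> 0" "\<And>x. x \<in> K \<Longrightarrow> norm (M x) \<le> BM"
    using continuous_on_compact_bound[OF K(1) continuous_on_subset[OF M(2) subset_UNIV]] by blast
  obtain BG where BG: "BG \<ge> 0" "\<And>x. x \<in> S \<Longrightarrow> norm (G x) \<le> BG"
    using continuous_on_compact_bound[OF S Gc] by blast
  have q_le: "norm (q x) \<le> Bq" for x using Bq K(3)[of x] by (cases "x \<in> K") auto
  have M_le: "norm (M x) \<le> BM" for x using BM K(4)[of x] by (cases "x \<in> K") auto
  have p_le: "norm (p n x) \<le> Bq + 1" for n x
    using e1(2)[of "d n" x] d[of n] q_le[of x] norm_triangle_ineq2[of "p n x" "q x"]
    unfolding p_eq c_def e_def by auto
  have m_le: "\<bar>m n x\<bar> \<le> BM + 1" for n x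
    using e2(2)[of "d n" x] d[of n] M_le[of x]
    unfolding m_def c_def e_def by auto
  have lim: "(\<lambda>n. integral UNIV (F n)) \<longlonglongrightarrow> integral UNIV (\<lambda>x. M x * (q x \<bullet> G x) + Q (q x) \<bullet> q x - T * (q x \<bullet> q x) / 2)"
  proof (rule integral_tendsto_uniform_bound[OF S])
    show "continuous_on UNIV (F n)" for n
      unfolding F_def by (intro continuous_intros mc pc Gc continuous_on_compose2[OF Qc]) auto
    show "F n x = 0" if "x \<notin> S" for n x
      using p0[OF that] linear_0[OF Q] by (simp add: F_def)
    show "\<bar>F n x\<bar> \<le> (BM + 1) * ((Bq + 1) * BG) + ((Bq + 1) * BQ) * (Bq + 1) + \<bar>T\<bar> * ((Bq + 1) * (Bq + 1)) / 2" for n x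
    proof (cases "x \<in> S")
      case True
      have "\<bar>p n x \<bullet> G x\<bar> \<le> (Bq + 1) * BG"
        using Cauchy_Schwarz_ineq2[of "p n x" "G x"] mult_mono[OF p_le[of n x] BG(2)[OF True]] Bq(1) by auto
      then have 1: "\<bar>m n x * (p n x \<bullet> G x)\<bar> \<le> (BM + 1) * ((Bq + 1) * BG)"
        unfolding abs_mult using m_le[of n x] BM(1) by (intro mult_mono) auto
      have "norm (Q (p n x)) \<le> (Bq + 1) * BQ"
        using BQ(1)[of "p n x"] mult_right_mono[OF p_le[of n x] BQ(2)] by linarith
      then have 2: "\<bar>Q (p n x) \<bullet> p n x\<bar> \<le> ((Bq + 1) * BQ) * (Bq + 1)"
        using Cauchy_Schwarz_ineq2[of "Q (p n x)" "p n x"] mult_mono[OF _ p_le[of n x], of "norm (Q (p n x))" "(Bq + 1) * BQ"] Bq(1) BQ(2) by auto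
      have "\<bar>p n x \<bullet> p n x\<bar> \<le> (Bq + 1) * (Bq + 1)"
        using Cauchy_Schwarz_ineq2[of "p n x" "p n x"] mult_mono[OF p_le[of n x] p_le[of n x]] Bq(1) by auto
      then have 3: "\<bar>T * (p n x \<bullet> p n x) / 2\<bar> \<le> \<bar>T\<bar> * ((Bq + 1) * (Bq + 1)) / 2"
        unfolding abs_mult abs_divide by (simp add: mult_left_mono)
      show ?thesis using 1 2 3 unfolding F_def by linarith
    next
      case False
      then show ?thesis using p0[OF False] linear_0[OF Q] Bq(1) BM(1) BG(1) BQ(2) by (simp add: F_def)
    qed
    fix x
    have "(\<lambda>n. p n x) \<longlonglongrightarrow> q x"
    proof (rule LIMSEQ_I)
      fix r :: real assume "0 < r"
      then obtain r' where r': "0 < r'" "\<And>d x. 0 < d \<Longrightarrow> d < r' \<Longrightarrow>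
          norm (integral UNIV (\<lambda>y. bump d (x - y) *\<^sub>R q y) /\<^sub>R bump_mass d TYPE('a) - q x) \<le> r / 2"
        using mollifier_approximates[OF K(1) K1(5) K(3), of "r/2"] by auto
      obtain N where "\<forall>n\<ge>N. norm (d n - 0) < r'" using LIMSEQ_D[OF d0 r'(1)] by blast
      then have "\<forall>n\<ge>N. norm (p n x - q x) \<le> r / 2" using r'(2) d unfolding p_eq c_def by auto
      then show "\<exists>N. \<forall>n\<ge>N. norm (p n x - q x) < r" using \<open>0 < r\<close> by (intro exI[of _ N]) force
    qed
    moreover have "(\<lambda>n. m n x) \<longlonglongrightarrow> M x"
    proof (rule LIMSEQ_I)
      fix r :: real assume "0 < r"
      then obtain r' where r': "0 < r'" "\<And>d x. 0 < d \<Longrightarrow> d < r' \<Longrightarrow>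
          norm (integral UNIV (\<lambda>y. bump d (x - y) *\<^sub>R M y) /\<^sub>R bump_mass d TYPE('a) - M x) \<le> r / 2"
        using mollifier_approximates[OF K(1) M(2) K(4), of "r/2"] by auto
      obtain N where "\<forall>n\<ge>N. norm (d n - 0) < r'" using LIMSEQ_D[OF d0 r'(1)] by blast
      then have "\<forall>n\<ge>N. norm (m n x - M x) \<le> r / 2" using r'(2) d unfolding m_def c_def by auto
      then show "\<exists>N. \<forall>n\<ge>N. norm (m n x - M x) < r" using \<open>0 < r\<close> by (intro exI[of _ N]) force
    qed
    ultimately show "(\<lambda>n. F n x) \<longlonglongrightarrow> M x * (q x \<bullet> G x) + Q (q x) \<bullet> q x - T * (q x \<bullet> q x) / 2"
      unfolding F_def by (intro tendsto_intros bounded_linear.tendsto[OF bl]) auto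
  qed
  then show ?thesis unfolding F0 T_def by (simp add: LIMSEQ_const_iff)
qed

text \<open>Integrated, the three summands after the square vanish: they are the Rellich identity with multiplier \<open>G\<close>,
  the equation tested with \<open>v\<close>, and the divergence of \<open>v\<^sup>2 \<bar>G\<bar>\<^sup>2 G\<close>.\<close>
lemma carleman_pointwise:
  fixes M gq v gg qq T Qqq QGG \<tau> \<kappa> :: real
  assumes "0 < \<kappa>" "8 * \<kappa> \<le> \<tau>" "- \<kappa> * qq \<le> Qqq" "v = 0 \<or> 2 * \<kappa> * gg + \<kappa> \<le> QGG"
  shows "4 * \<tau> * \<kappa> * qq + 2 * \<tau>^3 * \<kappa> * v\<^sup>2 \<le> (M - 2 * \<tau> * gq + (\<tau>\<^sup>2 * gg - \<tau> * T) * v)\<^sup>2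
    + 4 * \<tau> * (M * gq + Qqq - T * qq / 2) + (2 * \<tau> * T + 8 * \<tau> * \<kappa>) * (M * v + qq)
    + 2 * \<tau>^3 * (2 * v * gq * gg + v\<^sup>2 * (gg * T + 2 * QGG))" (is "?l \<le> ?r")
proof -
  have \<tau>: "0 < \<tau>" using assms by linarith
  let ?V = "4 * \<tau>^3 * QGG - 8 * \<tau>^3 * \<kappa> * gg - 16 * \<tau>\<^sup>2 * \<kappa>\<^sup>2"
  \<comment> \<open>The squared function is the difference of a symmetric part
    \<open>M + \<tau>\<^sup>2 * gg * v\<close> and an antisymmetric part
    \<open>2 * \<tau> * gq + \<tau> * T * v\<close>. The added terms cancel the cross term of the
    square, and the multiple 8 \<tau> \<kappa> of the equation shifts the symmetric part by 4 \<tau>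
    \<kappa> v; this is what makes the coefficient of \<open>qq\<close> positive.\<close>
  have eq: "?r = (2 * \<tau> * gq + \<tau> * T * v)\<^sup>2 + (M + \<tau>\<^sup>2 * gg * v + 4 * \<tau> * \<kappa> * v)\<^sup>2
      + (4 * \<tau> * Qqq + 8 * \<tau> * \<kappa> * qq + v\<^sup>2 * ?V)"
    by (simp add: power2_eq_square power3_eq_cube field_simps)
  have 1: "4 * \<tau> * (- \<kappa> * qq) \<le> 4 * \<tau> * Qqq"
    using assms(3) \<tau> by (intro mult_left_mono) auto
  have 2: "v\<^sup>2 * (2 * \<tau>^3 * \<kappa>) \<le> v\<^sup>2 * ?V"
  proof (cases "v = 0")
    case False
    \<comment> \<open>Convexity of the weight along its gradient leaves 4 \<tau>^3 \<kappa>; half of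
      it pays for 16 \<tau>^2 \<kappa>^2, because 8 \<kappa> \<le> \<tau>.\<close>
    then have "4 * \<tau>^3 * (2 * \<kappa> * gg + \<kappa>) \<le> 4 * \<tau>^3 * QGG"
      using assms(4) \<tau> by (intro mult_left_mono) auto
    moreover have "(2 * \<tau>\<^sup>2 * \<kappa>) * (8 * \<kappa>) \<le> (2 * \<tau>\<^sup>2 * \<kappa>) * \<tau>"
      using assms(1,2) by (intro mult_left_mono) auto
    ultimately have "2 * \<tau>^3 * \<kappa> \<le> ?V"
      by (simp add: power2_eq_square power3_eq_cube algebra_simps)
    then show ?thesis by (intro mult_left_mono) auto
  qed simp
  have "?l = 4 * \<tau> * (- \<kappa> * qq) + 8 * \<tau> * \<kappa> * qq + v\<^sup>2 * (2 * \<tau>^3 * \<kappa>)"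
    by (simp add: algebra_simps)
  also have "\<dots> \<le> 4 * \<tau> * Qqq + 8 * \<tau> * \<kappa> * qq + v\<^sup>2 * ?V"
    by (intro add_mono 1 2 order_refl)
  also have "\<dots> \<le> ?r" unfolding eq by simp
  finally show ?thesis .
qed

text \<open>Here \<open>G\<close> is the gradient of a quadratic weight \<open>\<phi>\<close>. If \<open>v = exp (\<tau> \<phi>) w\<close>, then the function squared on the
  right is \<open>exp (\<tau> \<phi>)\<close> times the Laplacian of \<open>w\<close>.\<close>
lemma carleman_estimate:
  fixes q G Q :: "'a::euclidean_space \<Rightarrow> 'a" and T :: real
  assumes t: "test_on UNIV v q"
    and M: "compact K\<^sub>0" "continuous_on UNIV M" "\<And>x. x \<notin> K\<^sub>0 \<Longrightarrow> M x = 0"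
    and weak: "\<And>\<psi> g. test_on UNIV \<psi> g \<Longrightarrow> integral UNIV (\<lambda>x. M x * \<psi> x + q x \<bullet> g x) = 0"
    and G: "\<And>x. G x = g\<^sub>0 + Q x" and Q: "linear Q" "\<And>h k. Q h \<bullet> k = h \<bullet> Q k"
    and T: "T = (\<Sum>b\<in>Basis. Q b \<bullet> b)"
    and \<kappa>: "0 < \<kappa>" "8 * \<kappa> \<le> \<tau>" "\<And>h. - \<kappa> * (h \<bullet> h) \<le> Q h \<bullet> h"
    and pc: "\<And>x. v x \<noteq> 0 \<Longrightarrow> 2 * \<kappa> * (G x \<bullet> G x) + \<kappa> \<le> Q (G x) \<bullet> G x"
  shows "integral UNIV (\<lambda>x. 4 * \<tau> * \<kappa> * (q x \<bullet> q x) + 2 * \<tau>^3 * \<kappa> * (v x)\<^sup>2) \<le>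
     integral UNIV (\<lambda>x. (M x - 2 * \<tau> * (q x \<bullet> G x) + (\<tau>\<^sup>2 * (G x \<bullet> G x) - \<tau> * T) * v x)\<^sup>2)"
proof -
  obtain K\<^sub>1 where K1: "compact K\<^sub>1" "\<And>x. x \<in> UNIV - K\<^sub>1 \<Longrightarrow> v x = 0" "\<And>x. x \<in> UNIV - K\<^sub>1 \<Longrightarrow> q x = 0"
    "\<And>x. x \<in> UNIV \<Longrightarrow> GDERIV v x :> q x" "continuous_on UNIV q" "continuous_on UNIV v"
    using test_onE[OF t open_UNIV] by metis
  define K where "K = K\<^sub>0 \<union> K\<^sub>1"
  have K: "compact K" "\<And>x. x \<notin> K \<Longrightarrow> v x = 0" "\<And>x. x \<notin> K \<Longrightarrow> q x = 0" "\<And>x. x \<notin> K \<Longrightarrow> M x = 0"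
    unfolding K_def using K1 M by auto
  have bl: "bounded_linear Q" using Q by (simp add: linear_conv_bounded_linear)
  have Qc: "continuous_on A Q" for A using linear_continuous_on[OF bl] .
  have Gc: "continuous_on A G" for A unfolding G by (intro continuous_intros Qc)
  have Gd: "(G has_derivative Q) (at x)" for x
    unfolding G using linear_imp_has_derivative[OF Q(1)] by (auto intro!: derivative_eq_intros)
  note cs = K1(5,6) M(2) Gc continuous_on_compose2[OF Qc[of UNIV] _ subset_UNIV]
  define I1 where "I1 = (\<lambda>x. M x * (q x \<bullet> G x) + Q (q x) \<bullet> q x - T * (q x \<bullet> q x) / 2)"
  define I2 where "I2 = (\<lambda>x. M x * v x + q x \<bullet> q x)"
  define I3 where "I3 = (\<lambda>x. 2 * v x * (q x \<bullet> G x) * (G x \<bullet> G x) + (v x)\<^sup>2 * ((G x \<bullet> G x) * T + 2 * (Q (G x) \<bullet> G x)))"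
  define P2 where "P2 = (\<lambda>x. (M x - 2 * \<tau> * (q x \<bullet> G x) + (\<tau>\<^sup>2 * (G x \<bullet> G x) - \<tau> * T) * v x)\<^sup>2)"
  define Lh where "Lh = (\<lambda>x. 4 * \<tau> * \<kappa> * (q x \<bullet> q x) + 2 * \<tau>^3 * \<kappa> * (v x)\<^sup>2)"
  have i: "I1 integrable_on UNIV" "I2 integrable_on UNIV" "I3 integrable_on UNIV" "P2 integrable_on UNIV" "Lh integrable_on UNIV"
    unfolding I1_def I2_def I3_def P2_def Lh_def
    by (rule compact_support_integrable_UNIV[OF K(1)]; use K linear_0[OF Q(1)] in \<open>auto intro!: continuous_intros cs\<close>)+
  have z1: "integral UNIV I1 = 0"
    unfolding I1_def T by (rule rellich_identity[OF t M weak G Q(1)])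
  have z2: "integral UNIV I2 = 0" unfolding I2_def by (rule weak[OF t])
  have z3: "integral UNIV I3 = 0"
  proof -
    have "integral UNIV (\<lambda>x. (2 * v x) *\<^sub>R q x \<bullet> ((G x \<bullet> G x) *\<^sub>R G x) +
        (v x)\<^sup>2 * (\<Sum>b\<in>Basis. ((G x \<bullet> G x) *\<^sub>R Q b + (2 * (G x \<bullet> Q b)) *\<^sub>R G x) \<bullet> b)) = 0"
    proof (rule integral_div_scaleR_zero[OF open_UNIV K(1) subset_UNIV])
      fix x
      show "GDERIV (\<lambda>x. (v x)\<^sup>2) x :> (2 * v x) *\<^sub>R q x"
        using GDERIV_mult[OF K1(4)[of x] K1(4)[of x]]
        by (simp add: power2_eq_square scaleR_left.add[symmetric])
      show "((\<lambda>x. (G x \<bullet> G x) *\<^sub>R G x) has_derivative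
          (\<lambda>h. (G x \<bullet> G x) *\<^sub>R Q h + (2 * (G x \<bullet> Q h)) *\<^sub>R G x)) (at x)"
        by (auto intro!: derivative_eq_intros Gd simp: inner_commute)
    qed (use K in \<open>auto intro!: continuous_intros cs\<close>)
    moreover have "(\<Sum>b\<in>Basis. ((G x \<bullet> G x) *\<^sub>R Q b + (2 * (G x \<bullet> Q b)) *\<^sub>R G x) \<bullet> b) =
        (G x \<bullet> G x) * T + 2 * (Q (G x) \<bullet> G x)" for x
    proof -
      have "(\<Sum>b\<in>Basis. ((G x \<bullet> G x) *\<^sub>R Q b + (2 * (G x \<bullet> Q b)) *\<^sub>R G x) \<bullet> b) =
          (\<Sum>b\<in>Basis. (G x \<bullet> G x) * (Q b \<bullet> b) + 2 * ((Q b \<bullet> G x) * (G x \<bullet> b)))"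
        by (rule sum.cong[OF refl]) (simp add: inner_add_left inner_commute[of "G x" "Q _"])
      then show ?thesis
        by (simp only: sum.distrib sum_distrib_left[symmetric] sum_Basis_linear_inner[OF Q(1)] T)
    qed
    ultimately show ?thesis unfolding I3_def by (simp add: mult_ac)
  qed
  have "Lh x \<le> P2 x + 4 * \<tau> * I1 x + (2 * \<tau> * T + 8 * \<tau> * \<kappa>) * I2 x + 2 * \<tau>^3 * I3 x" for x
    unfolding Lh_def P2_def I1_def I2_def I3_def
    by (rule carleman_pointwise) (use \<kappa> pc[of x] in auto)
  then have "integral UNIV Lh \<le> integral UNIV (\<lambda>x. P2 x + 4 * \<tau> * I1 x + (2 * \<tau> * T + 8 * \<tau> * \<kappa>) * I2 x + 2 * \<tau>^3 * I3 x)"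
    by (intro integral_le i integrable_add integrable_on_mult_right) auto
  also have "\<dots> = integral UNIV P2"
    by (simp add: integral_add integrable_add integrable_on_mult_right i z1 z2 z3)
  finally show ?thesis unfolding Lh_def P2_def .
qed

section \<open>Unique continuation\<close>

text \<open>\<open>M\<close> is the Laplacian of \<zeta> z according to the product rule. Its weak
  form is the sum of two identities: the equation for \<open>z\<close> tested with \<psi> \<zeta>,
  and the vanishing integral of the divergence of z \<psi> Z.\<close>

lemma weak_lap_cutoff:
  fixes \<Omega> K :: "'a::euclidean_space set" and z L \<zeta> :: "'a \<Rightarrow> real" and z' Z :: "'a \<Rightarrow> 'a"
    and DZ :: "'a \<Rightarrow> 'a \<Rightarrow> 'a"
  assumes \<Omega>: "open \<Omega>" and K: "compact K" "K \<subseteq> \<Omega>"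
    and z: "\<And>x. x \<in> \<Omega> \<Longrightarrow> GDERIV z x :> z' x" "continuous_on \<Omega> z'" "continuous_on \<Omega> L" "weak_lap \<Omega> z' L"
    and \<zeta>: "\<And>x. GDERIV \<zeta> x :> Z x" "\<And>x. (Z has_derivative DZ x) (at x)"
      "\<And>b. b \<in> Basis \<Longrightarrow> continuous_on UNIV (\<lambda>x. DZ x b)" "\<And>x. x \<notin> K \<Longrightarrow> \<zeta> x = 0"
  defines "v \<equiv> \<lambda>x. if x \<in> \<Omega> then \<zeta> x * z x else 0"
    and "q \<equiv> \<lambda>x. if x \<in> \<Omega> then \<zeta> x *\<^sub>R z' x + z x *\<^sub>R Z x else 0"
    and "M \<equiv> \<lambda>x. if x \<in> \<Omega> then \<zeta> x * L x + 2 * (Z x \<bullet> z' x) + z x * (\<Sum>b\<in>Basis. DZ x b \<bullet> b) else 0"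
  shows "test_on UNIV v q" "continuous_on UNIV M" "\<And>x. x \<notin> K \<Longrightarrow> M x = 0"
    "\<And>\<psi> g. test_on (UNIV :: 'a set) \<psi> g \<Longrightarrow> integral UNIV (\<lambda>x. M x * \<psi> x + q x \<bullet> g x) = 0"
proof -
  have Zc: "continuous_on UNIV Z"
    using \<zeta>(2) has_derivative_continuous by (metis continuous_at_imp_continuous_on)
  have \<zeta>c: "continuous_on UNIV \<zeta>" using \<zeta>(1) by (rule GDERIV_continuous_on)
  have zc: "continuous_on \<Omega> z" using z(1) by (rule GDERIV_continuous_on)
  have oK: "open (- K)" using K by (simp add: compact_imp_closed open_Compl)
  have Z0: "Z x = 0" if "x \<notin> K" for x
    using grad_eqI[OF \<zeta>(1)[of x]] grad_eqI[OF GDERIV_transform_open[OF GDERIV_const[of 0 x] oK]] \<zeta>(4) that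
    by (metis ComplI ComplD)
  have DZ0: "DZ x b = 0" if "x \<notin> K" for x b
  proof -
    have "(Z has_derivative (\<lambda>h. 0)) (at x)"
      by (rule has_derivative_transform_within_open[of "\<lambda>_. 0" _ _ _ "- K"]) (use that oK Z0 in auto)
    then show ?thesis using has_derivative_unique[OF \<zeta>(2)] by metis
  qed
  note cs = continuous_on_subset[OF Zc subset_UNIV] continuous_on_subset[OF \<zeta>c subset_UNIV] zc z(2,3)
    continuous_on_subset[OF \<zeta>(3) subset_UNIV]
  have "test_on \<Omega> (\<lambda>x. \<zeta> x * z x) (\<lambda>x. \<zeta> x *\<^sub>R z' x + z x *\<^sub>R Z x)"
    unfolding test_on_def
    using K \<zeta>(4) GDERIV_mult[OF \<zeta>(1) z(1)]
    by (auto intro!: exI[of _ K] continuous_intros cs)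
  from test_on_extend[OF \<Omega> this] show "test_on UNIV v q" unfolding v_def q_def .
  show "continuous_on UNIV M"
    unfolding M_def
    by (rule extend_by_zero_continuous[OF \<Omega> compact_imp_closed[OF K(1)] K(2)])
       (use \<zeta>(4) Z0 DZ0 in \<open>auto intro!: continuous_intros cs\<close>)
  show "M x = 0" if "x \<notin> K" for x using \<zeta>(4) Z0 DZ0 that by (simp add: M_def)
  fix \<psi> g assume "test_on (UNIV :: 'a set) \<psi> g"
  then have \<psi>: "\<And>x. GDERIV \<psi> x :> g x" "continuous_on UNIV g" by (auto simp: test_on_def)
  have \<psi>c: "continuous_on UNIV \<psi>" using \<psi>(1) by (rule GDERIV_continuous_on)
  note cs' = cs continuous_on_subset[OF \<psi>c subset_UNIV] continuous_on_subset[OF \<psi>(2) subset_UNIV]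
  have t\<zeta>: "test_on \<Omega> (\<lambda>x. \<psi> x * \<zeta> x) (\<lambda>x. \<psi> x *\<^sub>R Z x + \<zeta> x *\<^sub>R g x)"
    unfolding test_on_def
    using K \<zeta>(4) GDERIV_mult[OF \<psi>(1) \<zeta>(1)]
    by (auto intro!: exI[of _ K] continuous_intros cs')
  then have A: "integral \<Omega> (\<lambda>x. L x * (\<psi> x * \<zeta> x) + z' x \<bullet> (\<psi> x *\<^sub>R Z x + \<zeta> x *\<^sub>R g x)) = 0"
    using z(4) unfolding weak_lap_def by blast
  have B: "integral \<Omega> (\<lambda>x. (z x *\<^sub>R g x + \<psi> x *\<^sub>R z' x) \<bullet> Z x + (z x * \<psi> x) * (\<Sum>b\<in>Basis. DZ x b \<bullet> b)) = 0"
    by (rule integral_div_scaleR_zero_product[OF \<Omega> K])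
       (use GDERIV_mult[OF z(1) \<psi>(1)] \<zeta>(2) Z0 in \<open>auto intro!: continuous_intros cs'\<close>)
  have "integral UNIV (\<lambda>x. M x * \<psi> x + q x \<bullet> g x) =
      integral UNIV (\<lambda>x. if x \<in> \<Omega> then (L x * (\<psi> x * \<zeta> x) + z' x \<bullet> (\<psi> x *\<^sub>R Z x + \<zeta> x *\<^sub>R g x)) +
        ((z x *\<^sub>R g x + \<psi> x *\<^sub>R z' x) \<bullet> Z x + (z x * \<psi> x) * (\<Sum>b\<in>Basis. DZ x b \<bullet> b)) else 0)"
    by (rule integral_cong)
       (simp add: M_def q_def inner_add_left inner_add_right inner_commute algebra_simps)
  also have "\<dots> = integral \<Omega> (\<lambda>x. (L x * (\<psi> x * \<zeta> x) + z' x \<bullet> (\<psi> x *\<^sub>R Z x + \<zeta> x *\<^sub>R g x)) +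
        ((z x *\<^sub>R g x + \<psi> x *\<^sub>R z' x) \<bullet> Z x + (z x * \<psi> x) * (\<Sum>b\<in>Basis. DZ x b \<bullet> b)))"
    by (rule integral_restrict_UNIV)
  also have "\<dots> = 0"
  proof -
    have "(\<lambda>x. L x * (\<psi> x * \<zeta> x) + z' x \<bullet> (\<psi> x *\<^sub>R Z x + \<zeta> x *\<^sub>R g x)) integrable_on \<Omega>"
      by (rule compact_support_integrable[OF \<Omega> K]) (use Z0 \<zeta>(4) in \<open>auto intro!: continuous_intros cs'\<close>)
    moreover have "(\<lambda>x. (z x *\<^sub>R g x + \<psi> x *\<^sub>R z' x) \<bullet> Z x + (z x * \<psi> x) * (\<Sum>b\<in>Basis. DZ x b \<bullet> b)) integrable_on \<Omega>"
      by (rule compact_support_integrable[OF \<Omega> K]) (use Z0 DZ0 in \<open>auto intro!: continuous_intros cs'\<close>)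
    ultimately show ?thesis using A B by (simp only: integral_add)
  qed
  finally show "integral UNIV (\<lambda>x. M x * \<psi> x + q x \<bullet> g x) = 0" .
qed

text \<open>The weight \<open>\<phi>\<close> vanishes at \<open>p\<close> and is at most \<open>- c \<bar>x - p\<bar>\<^sup>2\<close> outside the ball, so that for large \<open>\<tau>\<close> the
  error made by the cutoff \<open>\<eta>\<close> is negligible against the mass of \<open>z\<close> near \<open>p\<close>.\<close>
lemma unique_continuation_across_sphere:
  fixes z L :: "'a::euclidean_space \<Rightarrow> real" and z' :: "'a \<Rightarrow> 'a"
  assumes \<Omega>: "open \<Omega>"
    and z: "\<And>x. x \<in> \<Omega> \<Longrightarrow> GDERIV z x :> z' x" "continuous_on \<Omega> z'" "continuous_on \<Omega> L" "weak_lap \<Omega> z' L"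
    and bound: "\<And>C. compact C \<Longrightarrow> C \<subseteq> \<Omega> \<Longrightarrow> \<exists>B. \<forall>x\<in>C. \<bar>L x\<bar> \<le> B * (\<bar>z x\<bar> + norm (z' x))"
    and R: "0 < R" "ball a R \<subseteq> \<Omega>" "\<And>x. x \<in> ball a R \<Longrightarrow> z x = 0" and p: "p \<in> \<Omega>" "dist a p = R"
  obtains s where "0 < s" "ball p s \<subseteq> \<Omega>" "\<And>x. x \<in> ball p s \<Longrightarrow> z x = 0"
proof -
  obtain \<rho>\<^sub>0 where \<rho>0: "0 < \<rho>\<^sub>0" "cball p \<rho>\<^sub>0 \<subseteq> \<Omega>" using \<Omega> p open_contains_cball by blast
  \<comment> \<open>With this \<kappa> the concave term of the weight is -2 |x - p|^2 / R. It beats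
    the linear term even when that is doubled, since outside the ball 2 (x - p) \<bullet> e \<le> |x
    - p|^2 / R. The radius \<rho> makes \<kappa> \<rho> \<le> 1/1000, so that the gradient of the
    weight stays close to \<open>e\<close>.\<close>
  define \<kappa> where "\<kappa> = 4 / R"
  define \<rho> where "\<rho> = min \<rho>\<^sub>0 (R / 4000)"
  define e where "e = (a - p) /\<^sub>R R"
  have \<rho>: "0 < \<rho>" "cball p \<rho> \<subseteq> \<Omega>" "\<kappa> * \<rho> \<le> 1 / 1000"
    using \<rho>0 R by (auto simp: \<rho>_def \<kappa>_def min_def field_simps)
  have \<kappa>: "0 < \<kappa>" using R by (simp add: \<kappa>_def)
  have ne: "norm e = 1" using p(2) R(1) by (simp add: e_def dist_norm)
  have ee: "e \<bullet> e = 1" using ne by (simp add: norm_eq_1)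
  have ap: "a = p + R *\<^sub>R e" using R(1) by (simp add: e_def)
  define Q where "Q = (\<lambda>h. (14 * \<kappa> * (h \<bullet> e)) *\<^sub>R e - \<kappa> *\<^sub>R h)"
  define G where "G = (\<lambda>x. (e - Q p) + Q x)"
  \<comment> \<open>The linear term makes the weight grow towards the centre of the ball, the
    isotropic term bends its level sets so that it is negative outside, and the square along
    \<open>e\<close> restores convexity in the gradient direction: at \<open>p\<close> the Hessian
    gives 13 \<kappa> there, where 3 \<kappa> is asked for.\<close>
  define \<phi> where "\<phi> = (\<lambda>x. (x - p) \<bullet> e + 7 * \<kappa> * ((x - p) \<bullet> e)\<^sup>2 - \<kappa> / 2 * ((x - p) \<bullet> (x - p)))"
  define T where "T = (\<Sum>b\<in>Basis. Q b \<bullet> b)"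
  have Ql: "linear Q" unfolding Q_def by (rule linearI) (auto simp: inner_add_left algebra_simps)
  have Qin: "Q h \<bullet> k = 14 * \<kappa> * ((h \<bullet> e) * (k \<bullet> e)) - \<kappa> * (h \<bullet> k)" for h k
    by (simp add: Q_def inner_diff_left inner_commute[of e])
  have Qs: "Q h \<bullet> k = h \<bullet> Q k" for h k
    using Qin[of h k] Qin[of k h] by (simp add: inner_commute)
  have Qlow: "- \<kappa> * (h \<bullet> h) \<le> Q h \<bullet> h" for h
  proof -
    have "Q h \<bullet> h = 14 * \<kappa> * (h \<bullet> e)\<^sup>2 - \<kappa> * (h \<bullet> h)"
      by (simp add: Qin power2_eq_square)
    then show ?thesis using \<kappa> by simp
  qed
  have G_eq: "G x = e + Q (x - p)" for x
    by (simp add: G_def linear_diff[OF Ql])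
  have Qn: "norm (Q h) \<le> 15 * \<kappa> * norm h" for h
  proof -
    have "\<bar>h \<bullet> e\<bar> \<le> norm h" using Cauchy_Schwarz_ineq2[of h e] ne by simp
    then have "norm ((14 * \<kappa> * (h \<bullet> e)) *\<^sub>R e) \<le> 14 * \<kappa> * norm h" using ne \<kappa> by (simp add: abs_mult)
    moreover have "norm (\<kappa> *\<^sub>R h) = \<kappa> * norm h" using \<kappa> by simp
    ultimately show ?thesis unfolding Q_def
      using norm_triangle_ineq4[of "(14 * \<kappa> * (h \<bullet> e)) *\<^sub>R e" "\<kappa> *\<^sub>R h"] by linarith
  qed
  have \<phi>d: "GDERIV \<phi> x :> G x" for x
    unfolding gderiv_def \<phi>_def G_eq Q_def
    by (auto intro!: derivative_eq_intros simp: fun_eq_iff inner_add_left inner_diff_left inner_add_right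
        inner_diff_right inner_commute algebra_simps)
  have \<phi>c: "continuous_on A \<phi>" for A unfolding \<phi>_def by (intro continuous_intros)
  have bl: "bounded_linear Q" using Ql by (simp add: linear_conv_bounded_linear)
  have Gd: "(G has_derivative Q) (at x)" for x
    unfolding G_def using linear_imp_has_derivative[OF Ql] by (auto intro!: derivative_eq_intros)
  have Gc: "continuous_on A G" for A
    unfolding G_def by (intro continuous_intros linear_continuous_on bl)
  have near: "norm (x - p) \<le> \<rho>" if "x \<in> cball p \<rho>" for x
    using that by (simp add: dist_norm norm_minus_commute)
  have Gnear: "norm (G x - e) \<le> 15 / 1000" if "x \<in> cball p \<rho>" for x
  proof -
    have "norm (G x - e) \<le> 15 * (\<kappa> * norm (x - p))" using Qn[of "x - p"] by (simp add: G_eq)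
    also have "\<dots> \<le> 15 * (\<kappa> * \<rho>)" using near[OF that] \<kappa> by simp
    finally show ?thesis using \<rho>(3) by linarith
  qed
  have Gle: "norm (G x) \<le> 2" if "x \<in> cball p \<rho>" for x
    using Gnear[OF that] norm_triangle_ineq2[of "G x" e] ne by linarith
  have pc: "2 * \<kappa> * (G x \<bullet> G x) + \<kappa> \<le> Q (G x) \<bullet> G x" if "x \<in> cball p \<rho>" for x
  proof -
    have "norm (G x) \<le> 1015 / 1000"
      using Gnear[OF that] norm_triangle_ineq2[of "G x" e] ne by linarith
    then have "(norm (G x))\<^sup>2 \<le> (1015 / 1000)\<^sup>2" by (intro power_mono) auto
    moreover have "(1015 / 1000 :: real)\<^sup>2 \<le> 11 / 10" by (simp add: power2_eq_square)
    ultimately have GG: "G x \<bullet> G x \<le> 11 / 10" unfolding power2_norm_eq_inner by linarith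
    have "\<bar>(G x - e) \<bullet> e\<bar> \<le> 15 / 1000"
      using Cauchy_Schwarz_ineq2[of "G x - e" e] Gnear[OF that] ne by simp
    moreover have "(G x - e) \<bullet> e = G x \<bullet> e - 1" by (simp add: inner_diff_left ee)
    ultimately have "9 / 10 \<le> G x \<bullet> e" by linarith
    then have "(9 / 10)\<^sup>2 \<le> (G x \<bullet> e)\<^sup>2" by (intro power_mono) auto
    then have Ge: "8 / 10 \<le> (G x \<bullet> e)\<^sup>2" by (simp add: power2_eq_square)
    have "3 * (G x \<bullet> G x) + 1 \<le> 14 * (G x \<bullet> e)\<^sup>2" using GG Ge by linarith
    then have "\<kappa> * (3 * (G x \<bullet> G x) + 1) \<le> \<kappa> * (14 * (G x \<bullet> e)\<^sup>2)" using \<kappa> by (intro mult_left_mono) auto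
    moreover have "Q (G x) \<bullet> G x = \<kappa> * (14 * (G x \<bullet> e)\<^sup>2) - \<kappa> * (G x \<bullet> G x)"
      by (simp add: Qin power2_eq_square)
    ultimately show ?thesis by (simp add: algebra_simps)
  qed
  have \<phi>_neg: "\<phi> x \<le> - (norm (x - p))\<^sup>2 / R" if "x \<in> cball p \<rho>" "x \<notin> ball a R" for x
  proof -
    let ?s = "(x - p) \<bullet> e"
    let ?n = "(norm (x - p))\<^sup>2"
    have xa: "x - a = (x - p) - R *\<^sub>R e" unfolding ap by simp
    have "R \<le> norm (x - a)" using that(2) by (simp add: dist_norm norm_minus_commute)
    then have "R\<^sup>2 \<le> (norm (x - a))\<^sup>2" using R(1) by (intro power_mono) auto
    also have "\<dots> = ?n - 2 * R * ?s + R\<^sup>2"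
      unfolding xa power2_norm_eq_inner
      by (simp add: inner_diff_left inner_diff_right inner_commute ee power2_eq_square algebra_simps)
    finally have s: "2 * R * ?s \<le> ?n" by simp
    have "\<bar>?s\<bar> \<le> \<rho>" using Cauchy_Schwarz_ineq2[of "x - p" e] ne near[OF that(1)] by simp
    then have "\<kappa> * \<bar>?s\<bar> \<le> 1 / 1000" using \<rho>(3) \<kappa> by (meson mult_left_mono less_imp_le order_trans)
    then have "7 * (\<kappa> * \<bar>?s\<bar>) * \<bar>?s\<bar> \<le> 7 * (1 / 1000) * \<bar>?s\<bar>" by (intro mult_right_mono) auto
    moreover have "7 * \<kappa> * ?s\<^sup>2 = 7 * (\<kappa> * \<bar>?s\<bar>) * \<bar>?s\<bar>" by (simp add: power2_eq_square)
    ultimately have q: "7 * \<kappa> * ?s\<^sup>2 \<le> \<bar>?s\<bar>" by linarith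
    have "\<phi> x = ?s + 7 * \<kappa> * ?s\<^sup>2 - 2 * ?n / R"
      unfolding \<phi>_def \<kappa>_def power2_norm_eq_inner by simp
    also have "\<dots> \<le> ?n / R - 2 * ?n / R"
    proof (cases "0 \<le> ?s")
      case True
      then have "?s + 7 * \<kappa> * ?s\<^sup>2 \<le> 2 * ?s" using q by simp
      moreover have "2 * ?s \<le> ?n / R" using s R(1) by (simp add: field_simps)
      ultimately show ?thesis by simp
    next
      case False
      then have "?s + 7 * \<kappa> * ?s\<^sup>2 \<le> 0" using q by simp
      moreover have "0 \<le> ?n / R" using R(1) by simp
      ultimately show ?thesis by linarith
    qed
    finally show ?thesis by simp
  qed
  define \<eta> where "\<eta> = (\<lambda>x. bump \<rho> (x - p))"
  define \<eta>' where "\<eta>' = (\<lambda>x. bump_grad \<rho> (x - p))"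
  define \<eta>\<^sub>2 where "\<eta>\<^sub>2 = (\<lambda>x. bump_hess \<rho> (x - p))"
  define lap_eta where "lap_eta = (\<lambda>x. \<Sum>b\<in>Basis. \<eta>\<^sub>2 x b \<bullet> b)"
  have \<eta>d: "GDERIV \<eta> x :> \<eta>' x" for x
    unfolding gderiv_def \<eta>_def \<eta>'_def
    by (rule has_derivative_compose[of "\<lambda>x. x - p" "\<lambda>h. h" x UNIV "bump \<rho>",
          OF _ GDERIV_bump[unfolded gderiv_def]]) (auto intro!: derivative_eq_intros)
  have \<eta>'d: "(\<eta>' has_derivative \<eta>\<^sub>2 x) (at x)" for x
    unfolding \<eta>'_def \<eta>\<^sub>2_def
    by (rule has_derivative_compose[of "\<lambda>x. x - p" "\<lambda>h. h" x UNIV "bump_grad \<rho>",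
          OF _ has_derivative_bump_grad]) (auto intro!: derivative_eq_intros)
  have \<eta>c: "continuous_on A \<eta>" "continuous_on A \<eta>'" "continuous_on A (\<lambda>x. \<eta>\<^sub>2 x h)" "continuous_on A lap_eta" for A h
    unfolding \<eta>_def \<eta>'_def \<eta>\<^sub>2_def lap_eta_def by (auto intro!: continuous_intros)
  have \<eta>0: "\<eta> x = 0" if "x \<notin> cball p \<rho>" for x
    using bump_eq_0[of \<rho> "x - p"] that \<rho>(1) by (simp add: \<eta>_def dist_norm norm_minus_commute)
  have \<eta>_nn: "0 \<le> \<eta> x" for x by (simp add: \<eta>_def bump_nonneg)
  let ?C = "cball p \<rho>"
  obtain B\<^sub>0 where B0: "\<And>x. x \<in> ?C \<Longrightarrow> \<bar>L x\<bar> \<le> B\<^sub>0 * (\<bar>z x\<bar> + norm (z' x))"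
    using bound[OF compact_cball \<rho>(2)] by blast
  obtain x1 where x1: "x1 \<ge> 0" "\<And>x. x \<in> ?C \<Longrightarrow> norm (\<eta> x) \<le> x1"
    using continuous_on_compact_bound[OF compact_cball \<eta>c(1)] by blast
  obtain b1 where b1: "b1 \<ge> 0" "\<And>x. x \<in> ?C \<Longrightarrow> norm (\<eta>' x) \<le> b1"
    using continuous_on_compact_bound[OF compact_cball \<eta>c(2)] by blast
  obtain b2 where b2: "b2 \<ge> 0" "\<And>x. x \<in> ?C \<Longrightarrow> norm (lap_eta x) \<le> b2"
    using continuous_on_compact_bound[OF compact_cball \<eta>c(4)] by blast
  have zc: "continuous_on \<Omega> z" using z(1) by (rule GDERIV_continuous_on)
  have "continuous_on ?C (\<lambda>x. \<bar>z x\<bar> + norm (z' x))"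
    by (intro continuous_intros continuous_on_subset[OF zc \<rho>(2)] continuous_on_subset[OF z(2) \<rho>(2)])
  then obtain B\<^sub>1 where B1: "B\<^sub>1 \<ge> 0" "\<And>x. x \<in> ?C \<Longrightarrow> norm (\<bar>z x\<bar> + norm (z' x)) \<le> B\<^sub>1"
    using continuous_on_compact_bound[OF compact_cball] by blast
  have "\<And>x. x \<in> cball p (\<rho>/2) \<Longrightarrow> 0 < \<eta> x"
    unfolding \<eta>_def using \<rho>(1) by (intro bump_pos) (simp add: dist_norm norm_minus_commute)
  then obtain x0 where x0: "x0 > 0" "\<And>x. x \<in> cball p (\<rho>/2) \<Longrightarrow> x0 \<le> \<eta> x"
    using continuous_on_compact_pos_lower_bound[OF compact_cball \<eta>c(1)] by blast
  define N where "N = x1 * \<bar>B\<^sub>0\<bar> + 2 * b1 + b2"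
  have N: "0 \<le> N" using x1(1) b1(1) b2(1) by (simp add: N_def)
  \<comment> \<open>The Laplacian of \<eta> z by the product rule, before the exponential weight is
    applied.\<close>
  define F where "F = (\<lambda>x. \<eta> x * L x + 2 * (\<eta>' x \<bullet> z' x) + z x * lap_eta x)"
  have F_le: "\<bar>F x\<bar> \<le> N * (\<bar>z x\<bar> + norm (z' x))" if "x \<in> ?C" for x
  proof -
    let ?w = "\<bar>z x\<bar> + norm (z' x)"
    have "0 \<le> ?w" by simp
    then have "\<bar>L x\<bar> \<le> \<bar>B\<^sub>0\<bar> * ?w"
      using order_trans[OF B0[OF that] mult_right_mono[OF abs_ge_self[of B\<^sub>0]]] by blast
    then have "\<bar>\<eta> x * L x\<bar> \<le> x1 * (\<bar>B\<^sub>0\<bar> * ?w)"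
      unfolding abs_mult using x1(2)[OF that] x1(1) by (intro mult_mono) auto
    moreover have "\<bar>\<eta>' x \<bullet> z' x\<bar> \<le> b1 * ?w"
      using Cauchy_Schwarz_ineq2[of "\<eta>' x" "z' x"] mult_mono[OF b1(2)[OF that], of "norm (z' x)" ?w] b1(1) by auto
    moreover have "\<bar>z x * lap_eta x\<bar> \<le> ?w * b2"
      unfolding abs_mult using b2(2)[OF that] b2(1) by (intro mult_mono) auto
    moreover have "\<bar>F x\<bar> \<le> \<bar>\<eta> x * L x\<bar> + 2 * \<bar>\<eta>' x \<bullet> z' x\<bar> + \<bar>z x * lap_eta x\<bar>"
      unfolding F_def by linarith
    moreover have "N * ?w = x1 * (\<bar>B\<^sub>0\<bar> * ?w) + 2 * (b1 * ?w) + ?w * b2"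
      unfolding N_def by (simp add: algebra_simps)
    ultimately show ?thesis by linarith
  qed
  \<comment> \<open>Near \<open>p\<close>, \<open>z\<close> and its gradient are recovered from
    \<open>v\<close> and \<open>q\<close> by division by \<eta> \<ge> x0. One division gives 1 / x0;
    the term with the gradient of \<eta> takes a second one and gives the summand with
    \<open>b1\<close>.\<close>
  define N\<^sub>1 where "N\<^sub>1 = N * (1 / x0 + b1 / x0\<^sup>2)"
  have N1: "0 \<le> N\<^sub>1" using N x0(1) b1(1) by (simp add: N\<^sub>1_def)
  \<comment> \<open>The depth of the weight on the shell: if |x - p| \<ge> \<rho> / 2 outside the
    ball, then \<phi> x \<le> -\<epsilon>.\<close>
  define \<epsilon> where "\<epsilon> = \<rho>\<^sup>2 / (4 * R)"
  have \<epsilon>: "0 < \<epsilon>" using \<rho>(1) R(1) by (simp add: \<epsilon>_def)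
  define w where "w = (\<lambda>x. if x \<in> \<Omega> then \<eta> x * z x else 0)"
  \<comment> \<open>A continuous, compactly supported majorant of the indicator of
    \<open>cball p \<rho>\<close>, where (2 \<rho>)^2 - |x - p|^2 \<ge> 3 \<rho>^2; it keeps the
    error term integrable.\<close>
  define \<beta> where "\<beta> = (\<lambda>x. bump (2 * \<rho>) (x - p) / (3 * \<rho>\<^sup>2)^3)"
  have \<beta>nn: "0 \<le> \<beta> x" for x by (simp add: \<beta>_def bump_nonneg)
  have \<beta>1: "1 \<le> \<beta> x" if "x \<in> ?C" for x
  proof -
    have "(norm (x - p))\<^sup>2 \<le> \<rho>\<^sup>2" using near[OF that] by (intro power_mono) auto
    then have "3 * \<rho>\<^sup>2 \<le> max 0 ((2 * \<rho>)\<^sup>2 - (x - p) \<bullet> (x - p))"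
      by (simp add: power2_norm_eq_inner power_mult_distrib)
    then have "(3 * \<rho>\<^sup>2)^3 \<le> bump (2 * \<rho>) (x - p)"
      unfolding bump_def by (intro power_mono) auto
    then show ?thesis using \<rho>(1) by (simp add: \<beta>_def)
  qed
  have \<beta>c: "continuous_on UNIV \<beta>" unfolding \<beta>_def using \<rho>(1) by (auto intro!: continuous_intros)
  have \<beta>0: "\<beta> x = 0" if "x \<notin> cball p (2 * \<rho>)" for x
    using bump_eq_0[of "2 * \<rho>" "x - p"] that \<rho>(1) by (simp add: \<beta>_def dist_norm norm_minus_commute)
  have \<beta>i: "\<beta> integrable_on UNIV" by (rule compact_support_integrable_UNIV[OF compact_cball \<beta>c \<beta>0])
  define I\<beta> where "I\<beta> = integral UNIV \<beta>"
  \<comment> \<open>The lower bounds on \<tau> let the left side of the Carleman estimate absorb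
    what the equation contributes near \<open>p\<close>: 2 N1^2 |q|^2 goes into 4 \<tau> \<kappa>
    |q|^2, and 18 N1^2 \<tau>^2 v^2 into half of 2 \<tau>^3 \<kappa> v^2. The other half remains on
    the left.\<close>
  have main: "\<tau>^3 * \<kappa> * integral UNIV (\<lambda>x. (exp (\<tau> * \<phi> x) * w x)\<^sup>2) \<le> B\<^sub>1\<^sup>2 * N\<^sup>2 * exp (- 2 * \<tau> * \<epsilon>) * I\<beta>"
    if \<tau>: "1 \<le> \<tau>" "8 * \<kappa> \<le> \<tau>" "N\<^sub>1\<^sup>2 \<le> \<tau> * \<kappa>" "18 * N\<^sub>1\<^sup>2 \<le> \<tau> * \<kappa>" for \<tau>
  proof -
    define E where "E = (\<lambda>x. exp (\<tau> * \<phi> x))"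
    have Epos: "0 < E x" for x by (simp add: E_def)
    have Ec: "continuous_on A E" for A unfolding E_def by (intro continuous_intros \<phi>c)
    have Ed: "GDERIV E x :> (\<tau> * E x) *\<^sub>R G x" for x
    proof -
      have "GDERIV (\<lambda>x. \<tau> * \<phi> x) x :> \<tau> *\<^sub>R G x"
        using GDERIV_mult[OF GDERIV_const[of \<tau> x] \<phi>d[of x]] by simp
      from GDERIV_DERIV_compose[OF this DERIV_exp]
      show ?thesis unfolding E_def by (simp add: mult.commute)
    qed
    \<comment> \<open>The exponential weight is made part of the cutoff, so that the weak equation
      of the conjugated function follows from the cutoff lemma alone.\<close>
    define \<zeta> where "\<zeta> = (\<lambda>x. E x * \<eta> x)"
    define Z where "Z = (\<lambda>x. E x *\<^sub>R (\<eta>' x + (\<tau> * \<eta> x) *\<^sub>R G x))"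
    define DZ where "DZ = (\<lambda>x h. E x *\<^sub>R (\<eta>\<^sub>2 x h + ((\<tau> * \<eta> x) *\<^sub>R Q h + (\<tau> * (h \<bullet> \<eta>' x)) *\<^sub>R G x))
        + (h \<bullet> ((\<tau> * E x) *\<^sub>R G x)) *\<^sub>R (\<eta>' x + (\<tau> * \<eta> x) *\<^sub>R G x))"
    have \<zeta>d: "GDERIV \<zeta> x :> Z x" for x
      unfolding \<zeta>_def Z_def using GDERIV_mult[OF Ed \<eta>d]
      by (rule GDERIV_subst) (simp add: algebra_simps)
    have Zd: "(Z has_derivative DZ x) (at x)" for x
    proof -
      have 1: "((\<lambda>x. \<tau> * \<eta> x) has_derivative (\<lambda>h. \<tau> * (h \<bullet> \<eta>' x))) (at x)"
        by (intro has_derivative_mult_right \<eta>d[unfolded gderiv_def])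
      show ?thesis unfolding Z_def DZ_def
        by (rule has_derivative_scaleR[OF Ed[unfolded gderiv_def]
              has_derivative_add[OF \<eta>'d has_derivative_scaleR[OF 1 Gd]]])
    qed
    have DZc: "continuous_on UNIV (\<lambda>x. DZ x b)" for b
      unfolding DZ_def by (intro continuous_intros Ec \<eta>c Gc)
    define v where "v = (\<lambda>x. if x \<in> \<Omega> then \<zeta> x * z x else 0)"
    define q where "q = (\<lambda>x. if x \<in> \<Omega> then \<zeta> x *\<^sub>R z' x + z x *\<^sub>R Z x else 0)"
    define M where "M = (\<lambda>x. if x \<in> \<Omega> then \<zeta> x * L x + 2 * (Z x \<bullet> z' x) + z x * (\<Sum>b\<in>Basis. DZ x b \<bullet> b) else 0)"
    have \<zeta>0: "\<zeta> x = 0" if "x \<notin> ?C" for x using \<eta>0[OF that] by (simp add: \<zeta>_def)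
    have cut1: "test_on UNIV v q"
      unfolding v_def q_def
      by (rule weak_lap_cutoff(1)[OF \<Omega> compact_cball \<rho>(2) _ z(2,3,4) \<zeta>d Zd DZc]) (use z(1) \<zeta>0 in auto)
    have cut2: "continuous_on UNIV M"
      unfolding M_def
      by (rule weak_lap_cutoff(2)[OF \<Omega> compact_cball \<rho>(2) _ z(2,3,4) \<zeta>d Zd DZc]) (use z(1) \<zeta>0 in auto)
    have cut3: "M x = 0" if "x \<notin> ?C" for x
      unfolding M_def
      by (rule weak_lap_cutoff(3)[OF \<Omega> compact_cball \<rho>(2) _ z(2,3,4) \<zeta>d Zd DZc _ that]) (use z(1) \<zeta>0 in auto)
    have cut4: "integral UNIV (\<lambda>x. M x * \<psi> x + q x \<bullet> g x) = 0" if "test_on UNIV \<psi> g" for \<psi> g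
      unfolding M_def q_def
      by (rule weak_lap_cutoff(4)[OF \<Omega> compact_cball \<rho>(2) _ z(2,3,4) \<zeta>d Zd DZc _ that]) (use z(1) \<zeta>0 in auto)
    note cut = cut1 cut2 cut3 cut4
    have vC: "v x = 0" if "x \<notin> ?C" for x using \<zeta>0[OF that] by (simp add: v_def)
    have carl: "integral UNIV (\<lambda>x. 4 * \<tau> * \<kappa> * (q x \<bullet> q x) + 2 * \<tau>^3 * \<kappa> * (v x)\<^sup>2) \<le>
        integral UNIV (\<lambda>x. (M x - 2 * \<tau> * (q x \<bullet> G x) + (\<tau>\<^sup>2 * (G x \<bullet> G x) - \<tau> * T) * v x)\<^sup>2)"
    proof (rule carleman_estimate[OF cut(1) compact_cball cut(2,3,4) _ Ql Qs T_def \<kappa> \<tau>(2) Qlow])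
      show "2 * \<kappa> * (G x \<bullet> G x) + \<kappa> \<le> Q (G x) \<bullet> G x" if "v x \<noteq> 0" for x using pc vC that by blast
    qed (simp_all add: G_def)
    define P where "P = (\<lambda>x. M x - 2 * \<tau> * (q x \<bullet> G x) + (\<tau>\<^sup>2 * (G x \<bullet> G x) - \<tau> * T) * v x)"
    have trDZ: "(\<Sum>b\<in>Basis. DZ x b \<bullet> b) = E x * (lap_eta x + \<tau> * \<eta> x * T + 2 * \<tau> * (\<eta>' x \<bullet> G x) + \<tau>\<^sup>2 * \<eta> x * (G x \<bullet> G x))" for x
    proof -
      have "(\<Sum>b\<in>Basis. DZ x b \<bullet> b) = (\<Sum>b\<in>Basis. E x * (\<eta>\<^sub>2 x b \<bullet> b) + E x * \<tau> * \<eta> x * (Q b \<bullet> b)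
          + 2 * \<tau> * E x * ((\<eta>' x \<bullet> b) * (G x \<bullet> b)) + \<tau>\<^sup>2 * E x * \<eta> x * ((G x \<bullet> b) * (G x \<bullet> b)))"
        unfolding DZ_def
        by (rule sum.cong[OF refl]) (simp add: inner_add_left inner_commute power2_eq_square algebra_simps)
      also have "\<dots> = E x * lap_eta x + E x * \<tau> * \<eta> x * T + 2 * \<tau> * E x * (\<eta>' x \<bullet> G x) + \<tau>\<^sup>2 * E x * \<eta> x * (G x \<bullet> G x)"
        by (simp only: sum.distrib sum_distrib_left[symmetric] euclidean_inner[symmetric] lap_eta_def T_def)
      finally show ?thesis by (simp add: algebra_simps)
    qed
    \<comment> \<open>Conjugation undone: the operator of the Carleman estimate, applied to the
      weighted function, returns the weight times the Laplacian of \<eta> z, and all terms with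
      \<tau> cancel.\<close>
    have P_eq: "P x = (if x \<in> \<Omega> then E x * F x else 0)" for x
    proof (cases "x \<in> \<Omega>")
      case True
      have q1: "q x \<bullet> G x = E x * (\<eta> x * (z' x \<bullet> G x) + z x * (\<eta>' x \<bullet> G x) + z x * \<tau> * \<eta> x * (G x \<bullet> G x))"
        using True by (simp add: q_def \<zeta>_def Z_def inner_add_left algebra_simps)
      have M1: "M x = E x * (\<eta> x * L x + 2 * (\<eta>' x \<bullet> z' x) + 2 * \<tau> * \<eta> x * (z' x \<bullet> G x)
          + z x * (lap_eta x + \<tau> * \<eta> x * T + 2 * \<tau> * (\<eta>' x \<bullet> G x) + \<tau>\<^sup>2 * \<eta> x * (G x \<bullet> G x)))"
        using True by (simp add: M_def trDZ \<zeta>_def Z_def inner_add_left inner_commute[of "G x" "z' x"] algebra_simps)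
      have v1: "v x = E x * \<eta> x * z x" using True by (simp add: v_def \<zeta>_def)
      show ?thesis unfolding P_def q1 M1 v1 F_def using True
        by (simp add: power2_eq_square algebra_simps)
    next
      case False
      then show ?thesis by (simp add: P_def M_def q_def v_def)
    qed
    have P_le: "(P x)\<^sup>2 \<le> 2 * N\<^sub>1\<^sup>2 * (q x \<bullet> q x) + 18 * N\<^sub>1\<^sup>2 * \<tau>\<^sup>2 * (v x)\<^sup>2 + B\<^sub>1\<^sup>2 * N\<^sup>2 * exp (- 2 * \<tau> * \<epsilon>) * \<beta> x" for x
    proof -
      have nn: "0 \<le> 2 * N\<^sub>1\<^sup>2 * (q x \<bullet> q x) + 18 * N\<^sub>1\<^sup>2 * \<tau>\<^sup>2 * (v x)\<^sup>2" "0 \<le> B\<^sub>1\<^sup>2 * N\<^sup>2 * exp (- 2 * \<tau> * \<epsilon>) * \<beta> x"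
        using \<beta>nn[of x] by auto
      \<comment> \<open>Off the cutoff everything vanishes; in the ball \<open>z\<close> and its
        gradient vanish; near \<open>p\<close>, where \<eta> \<ge> x0, the terms are bounded by
        \<open>v\<close> and \<open>q\<close>; on the remaining shell the smallness of the weight
        has to suffice.\<close>
      consider "x \<notin> ?C" | "x \<in> ball a R" "x \<in> ?C" | "x \<in> cball p (\<rho>/2)" | "x \<in> ?C" "x \<notin> cball p (\<rho>/2)" "x \<notin> ball a R"
        by blast
      then show ?thesis
      proof cases
        case 1
        have "grad v x = q x" using cut(1) unfolding test_on_def by (intro grad_eqI) blast
        moreover have "grad v x = 0"
          by (rule grad_eqI, rule GDERIV_transform_open[OF GDERIV_const[of 0 x], of "- ?C"])
             (use 1 vC in auto)
        ultimately have "q x = 0" by simp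
        then have "P x = 0" using cut(3)[OF 1] vC[OF 1] by (simp add: P_def)
        then show ?thesis using nn by simp
      next
        case 2
        have "grad z x = z' x" using z(1) 2(1) R(2) by (intro grad_eqI) blast
        moreover have "grad z x = 0"
          by (rule grad_eqI, rule GDERIV_transform_open[OF GDERIV_const[of 0 x], of "ball a R"])
             (use 2(1) R(3) in auto)
        ultimately have "z x = 0" "z' x = 0" using R(3)[OF 2(1)] by auto
        then have "F x = 0" using F_le[OF 2(2)] by simp
        then show ?thesis using nn by (simp add: P_eq)
      next
        case 3
        have xC: "x \<in> ?C" using 3 \<rho>(1) by auto
        then have x\<Omega>: "x \<in> \<Omega>" using \<rho>(2) by blast
        have c: "0 < \<eta> x" "x0 \<le> \<eta> x" using x0 3 by fastforce+
        have v_eq: "v x = E x * \<eta> x * z x" using x\<Omega> by (simp add: v_def \<zeta>_def)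
        have q_eq: "q x = (E x * \<eta> x) *\<^sub>R z' x + (E x * z x) *\<^sub>R \<eta>' x + (\<tau> * v x) *\<^sub>R G x"
          using x\<Omega> by (simp add: q_def \<zeta>_def Z_def v_eq algebra_simps)
        have a1: "E x * \<bar>z x\<bar> \<le> \<bar>v x\<bar> / x0"
        proof -
          have "x0 * (E x * \<bar>z x\<bar>) \<le> \<eta> x * (E x * \<bar>z x\<bar>)"
            using c Epos[of x] by (intro mult_right_mono) auto
          also have "\<dots> = \<bar>v x\<bar>" using c(1) Epos[of x] by (simp add: v_eq abs_mult)
          finally show ?thesis using x0(1) by (simp add: field_simps)
        qed
        have Gv: "norm ((\<tau> * v x) *\<^sub>R G x) \<le> 2 * \<tau> * \<bar>v x\<bar>"
          using mult_left_mono[OF Gle[OF xC], of "\<tau> * \<bar>v x\<bar>"] \<tau>(1) by (simp add: abs_mult mult_ac)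
        have zv: "norm ((E x * z x) *\<^sub>R \<eta>' x) \<le> b1 * (\<bar>v x\<bar> / x0)"
        proof -
          have "norm ((E x * z x) *\<^sub>R \<eta>' x) = (E x * \<bar>z x\<bar>) * norm (\<eta>' x)" using Epos[of x] by (simp add: abs_mult)
          also have "\<dots> \<le> (\<bar>v x\<bar> / x0) * b1" using a1 b1(2)[OF xC] Epos[of x] x0(1) by (intro mult_mono) auto
          finally show ?thesis by (simp add: mult.commute)
        qed
        have a2: "E x * norm (z' x) \<le> (norm (q x) + 2 * \<tau> * \<bar>v x\<bar> + b1 * (\<bar>v x\<bar> / x0)) / x0"
        proof -
          have "x0 * (E x * norm (z' x)) \<le> \<eta> x * (E x * norm (z' x))"
            using c Epos[of x] by (intro mult_right_mono) auto
          also have "\<dots> = norm ((E x * \<eta> x) *\<^sub>R z' x)" using c(1) Epos[of x] by (simp add: abs_mult)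
          also have "(E x * \<eta> x) *\<^sub>R z' x = q x - (\<tau> * v x) *\<^sub>R G x - (E x * z x) *\<^sub>R \<eta>' x" by (simp add: q_eq)
          also have "norm \<dots> \<le> norm (q x) + 2 * \<tau> * \<bar>v x\<bar> + b1 * (\<bar>v x\<bar> / x0)"
            using Gv zv norm_triangle_ineq4[of "q x - (\<tau> * v x) *\<^sub>R G x" "(E x * z x) *\<^sub>R \<eta>' x"]
              norm_triangle_ineq4[of "q x" "(\<tau> * v x) *\<^sub>R G x"] by linarith
          finally show ?thesis using x0(1) by (simp add: field_simps)
        qed
        have "\<bar>P x\<bar> \<le> E x * (N * (\<bar>z x\<bar> + norm (z' x)))"
          using F_le[OF xC] Epos[of x] x\<Omega> by (simp add: P_eq abs_mult)
        also have "\<dots> = N * (E x * \<bar>z x\<bar> + E x * norm (z' x))" by (simp add: algebra_simps)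
        also have "\<dots> \<le> N * (\<bar>v x\<bar> / x0 + (norm (q x) + 2 * \<tau> * \<bar>v x\<bar> + b1 * (\<bar>v x\<bar> / x0)) / x0)"
          using a1 a2 N by (intro mult_left_mono add_mono) auto
        also have "\<dots> \<le> N\<^sub>1 * (norm (q x) + 3 * \<tau> * \<bar>v x\<bar>)"
        proof -
          have "\<bar>v x\<bar> / x0 + (norm (q x) + 2 * \<tau> * \<bar>v x\<bar> + b1 * (\<bar>v x\<bar> / x0)) / x0 =
              (1 / x0) * (norm (q x) + 2 * \<tau> * \<bar>v x\<bar> + \<bar>v x\<bar>) + (b1 / x0\<^sup>2) * \<bar>v x\<bar>"
            using x0(1) by (simp add: field_simps power2_eq_square)
          also have "\<dots> \<le> (1 / x0) * (norm (q x) + 3 * \<tau> * \<bar>v x\<bar>) + (b1 / x0\<^sup>2) * (norm (q x) + 3 * \<tau> * \<bar>v x\<bar>)"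
          proof -
            have "\<bar>v x\<bar> \<le> \<tau> * \<bar>v x\<bar>" using mult_right_mono[OF \<tau>(1), of "\<bar>v x\<bar>"] by simp
            then have "norm (q x) + 2 * \<tau> * \<bar>v x\<bar> + \<bar>v x\<bar> \<le> norm (q x) + 3 * \<tau> * \<bar>v x\<bar>"
              "\<bar>v x\<bar> \<le> norm (q x) + 3 * \<tau> * \<bar>v x\<bar>"
              using norm_ge_zero[of "q x"] abs_ge_zero[of "v x"] by linarith+
            then show ?thesis
              using x0(1) b1(1) by (intro add_mono[OF mult_left_mono mult_left_mono]) auto
          qed
          finally show ?thesis unfolding N\<^sub>1_def using mult_left_mono[OF _ N] by (simp add: distrib_right mult.assoc)
        qed
        finally have le: "\<bar>P x\<bar> \<le> N\<^sub>1 * (norm (q x) + 3 * \<tau> * \<bar>v x\<bar>)" .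
        have "(P x)\<^sup>2 \<le> (N\<^sub>1 * (norm (q x) + 3 * \<tau> * \<bar>v x\<bar>))\<^sup>2"
          using le by (metis abs_ge_zero power2_abs power_mono)
        also have "\<dots> \<le> N\<^sub>1\<^sup>2 * (2 * (norm (q x))\<^sup>2 + 2 * (3 * \<tau> * \<bar>v x\<bar>)\<^sup>2)"
        proof -
          have "(norm (q x) + 3 * \<tau> * \<bar>v x\<bar>)\<^sup>2 \<le> 2 * (norm (q x))\<^sup>2 + 2 * (3 * \<tau> * \<bar>v x\<bar>)\<^sup>2"
            using sum_squares_bound[of "norm (q x)" "3 * \<tau> * \<bar>v x\<bar>"] unfolding power2_sum by simp
          then show ?thesis unfolding power_mult_distrib[of N\<^sub>1] by (intro mult_left_mono) auto
        qed
        also have "\<dots> = 2 * N\<^sub>1\<^sup>2 * (q x \<bullet> q x) + 18 * N\<^sub>1\<^sup>2 * \<tau>\<^sup>2 * (v x)\<^sup>2"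
          by (simp add: power2_norm_eq_inner power_mult_distrib algebra_simps)
        finally show ?thesis using nn(2) by linarith
      next
        case 4
        have "(\<rho> / 2)\<^sup>2 \<le> (norm (x - p))\<^sup>2"
          using 4(2) \<rho>(1) by (intro power_mono) (auto simp: dist_norm norm_minus_commute)
        then have "\<epsilon> \<le> (norm (x - p))\<^sup>2 / R"
          using divide_right_mono[of "(\<rho> / 2)\<^sup>2" "(norm (x - p))\<^sup>2" R] R(1) by (simp add: \<epsilon>_def power_divide)
        then have "\<phi> x \<le> - \<epsilon>" using \<phi>_neg[OF 4(1,3)] by simp
        then have "\<tau> * \<phi> x \<le> \<tau> * (- \<epsilon>)" using \<tau>(1) by (intro mult_left_mono) auto
        then have Ele: "E x \<le> exp (- \<tau> * \<epsilon>)" by (simp add: E_def)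
        have "\<bar>F x\<bar> \<le> N * B\<^sub>1"
          using F_le[OF 4(1)] mult_left_mono[OF _ N, of "\<bar>z x\<bar> + norm (z' x)" B\<^sub>1] B1(2)[OF 4(1)] by auto
        then have "\<bar>P x\<bar> \<le> exp (- \<tau> * \<epsilon>) * (N * B\<^sub>1)"
          using Ele Epos[of x] N B1(1) unfolding P_eq by (auto simp: abs_mult intro!: mult_mono)
        then have "(P x)\<^sup>2 \<le> (exp (- \<tau> * \<epsilon>) * (N * B\<^sub>1))\<^sup>2"
          by (metis abs_ge_zero power2_abs power_mono)
        also have "\<dots> = B\<^sub>1\<^sup>2 * N\<^sup>2 * exp (- 2 * \<tau> * \<epsilon>)"
          by (simp add: power_mult_distrib power2_eq_square[of "exp _"] exp_add[symmetric] mult_ac)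
        also have "\<dots> \<le> B\<^sub>1\<^sup>2 * N\<^sup>2 * exp (- 2 * \<tau> * \<epsilon>) * \<beta> x"
          using mult_left_mono[OF \<beta>1[OF 4(1)], of "B\<^sub>1\<^sup>2 * N\<^sup>2 * exp (- 2 * \<tau> * \<epsilon>)"] by simp
        finally show ?thesis using nn(1) by linarith
      qed
    qed
    obtain K\<^sub>q where Kq: "compact K\<^sub>q" "\<And>x. x \<in> UNIV - K\<^sub>q \<Longrightarrow> v x = 0" "\<And>x. x \<in> UNIV - K\<^sub>q \<Longrightarrow> q x = 0"
      "continuous_on UNIV q" "continuous_on UNIV v"
      using test_onE[OF cut(1) open_UNIV] by metis
    have cK: "compact (K\<^sub>q \<union> ?C)" using Kq(1) by (intro compact_Un compact_cball)
    have iq: "(\<lambda>x. q x \<bullet> q x) integrable_on UNIV" and iv: "(\<lambda>x. (v x)\<^sup>2) integrable_on UNIV"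
      by (rule compact_support_integrable_UNIV[OF Kq(1)]; use Kq in \<open>auto intro!: continuous_intros\<close>)+
    have iP: "(\<lambda>x. (P x)\<^sup>2) integrable_on UNIV"
      unfolding P_def
      by (rule compact_support_integrable_UNIV[OF cK]; use Kq cut(2,3) in \<open>auto intro!: continuous_intros Gc\<close>)
    let ?k = "B\<^sub>1\<^sup>2 * N\<^sup>2 * exp (- 2 * \<tau> * \<epsilon>)"
    have "integral UNIV (\<lambda>x. (P x)\<^sup>2) \<le> integral UNIV (\<lambda>x. 2 * N\<^sub>1\<^sup>2 * (q x \<bullet> q x) + 18 * N\<^sub>1\<^sup>2 * \<tau>\<^sup>2 * (v x)\<^sup>2 + ?k * \<beta> x)"
      by (intro integral_le iP integrable_add integrable_on_mult_right iq iv \<beta>i P_le)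
    also have "\<dots> = 2 * N\<^sub>1\<^sup>2 * integral UNIV (\<lambda>x. q x \<bullet> q x) + 18 * N\<^sub>1\<^sup>2 * \<tau>\<^sup>2 * integral UNIV (\<lambda>x. (v x)\<^sup>2) + ?k * I\<beta>"
      by (simp add: integral_add integrable_add integrable_on_mult_right iq iv \<beta>i I\<beta>_def)
    finally have up: "integral UNIV (\<lambda>x. (P x)\<^sup>2) \<le> 2 * N\<^sub>1\<^sup>2 * integral UNIV (\<lambda>x. q x \<bullet> q x)
        + 18 * N\<^sub>1\<^sup>2 * \<tau>\<^sup>2 * integral UNIV (\<lambda>x. (v x)\<^sup>2) + ?k * I\<beta>" .
    have low: "4 * \<tau> * \<kappa> * integral UNIV (\<lambda>x. q x \<bullet> q x) + 2 * \<tau>^3 * \<kappa> * integral UNIV (\<lambda>x. (v x)\<^sup>2) \<le> integral UNIV (\<lambda>x. (P x)\<^sup>2)"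
      using carl unfolding P_def by (simp add: integral_add integrable_on_mult_right iq iv)
    have q0: "0 \<le> integral UNIV (\<lambda>x. q x \<bullet> q x)" "0 \<le> integral UNIV (\<lambda>x. (v x)\<^sup>2)"
      by (auto intro!: integral_nonneg iq iv)
    have "2 * N\<^sub>1\<^sup>2 * integral UNIV (\<lambda>x. q x \<bullet> q x) \<le> 4 * \<tau> * \<kappa> * integral UNIV (\<lambda>x. q x \<bullet> q x)"
    proof (intro mult_right_mono q0)
      have "0 \<le> \<tau> * \<kappa>" using \<tau>(1) \<kappa> by simp
      then show "2 * N\<^sub>1\<^sup>2 \<le> 4 * \<tau> * \<kappa>" using \<tau>(3) by linarith
    qed
    moreover have "18 * N\<^sub>1\<^sup>2 * \<tau>\<^sup>2 * integral UNIV (\<lambda>x. (v x)\<^sup>2) \<le> \<tau>^3 * \<kappa> * integral UNIV (\<lambda>x. (v x)\<^sup>2)"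
    proof (intro mult_right_mono q0)
      show "18 * N\<^sub>1\<^sup>2 * \<tau>\<^sup>2 \<le> \<tau>^3 * \<kappa>"
        using mult_right_mono[OF \<tau>(4), of "\<tau>\<^sup>2"] by (simp add: power2_eq_square power3_eq_cube mult_ac)
    qed
    ultimately have "\<tau>^3 * \<kappa> * integral UNIV (\<lambda>x. (v x)\<^sup>2) \<le> ?k * I\<beta>"
      using up low by linarith
    moreover have "v x = exp (\<tau> * \<phi> x) * w x" for x by (simp add: v_def w_def \<zeta>_def E_def)
    ultimately show ?thesis by simp
  qed
  have wc: "continuous_on UNIV w"
    unfolding w_def
    by (rule extend_by_zero_continuous[OF \<Omega> closed_cball \<rho>(2)])
       (use \<eta>0 in \<open>auto intro!: continuous_intros \<eta>c zc\<close>)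
  have w0: "w x = 0" if "x \<notin> ?C" for x using \<eta>0[OF that] by (simp add: w_def)
  have "isCont \<phi> p" using \<phi>c[of UNIV] by (simp add: continuous_on_eq_continuous_at)
  moreover have "\<phi> p = 0" by (simp add: \<phi>_def)
  ultimately obtain s\<^sub>0 where s0: "0 < s\<^sub>0" "\<And>x. dist x p < s\<^sub>0 \<Longrightarrow> dist (\<phi> x) 0 < \<epsilon> / 2"
    unfolding continuous_at_eps_delta using \<epsilon> by (metis half_gt_zero)
  \<comment> \<open>On this ball \<phi> > -\<epsilon>/2, so the squared weight is at least exp
    (-\<tau> \<epsilon>), against an error of order exp (-2 \<tau> \<epsilon>). The mass of
    \<open>z\<close> near \<open>p\<close> is therefore at most a multiple of exp (-\<tau>
    \<epsilon>), for all large \<tau>.\<close>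
  define s where "s = min (s\<^sub>0 / 2) (\<rho> / 2)"
  have s: "0 < s" "s < s\<^sub>0" "s < \<rho>" using s0(1) \<rho>(1) by (auto simp: s_def)
  define h where "h = (\<lambda>x. (w x)\<^sup>2 * bump s (x - p))"
  have hc: "continuous_on UNIV h" unfolding h_def by (intro continuous_intros wc)
  have h0: "h x = 0" if "x \<notin> cball p s" for x
    using bump_eq_0[of s "x - p"] that s(1) by (simp add: h_def dist_norm norm_minus_commute)
  have hi: "h integrable_on UNIV" by (rule compact_support_integrable_UNIV[OF compact_cball hc h0])
  have h_le: "exp (- \<tau> * \<epsilon>) * h x \<le> (s\<^sup>2)^3 * (exp (\<tau> * \<phi> x) * w x)\<^sup>2" if "0 \<le> \<tau>" for \<tau> x
  proof (cases "x \<in> cball p s")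
    case True
    then have "- \<epsilon> \<le> 2 * \<phi> x" using s0(2)[of x] s(2) by (auto simp: dist_commute dist_real_def abs_less_iff)
    then have "\<tau> * (- \<epsilon>) \<le> \<tau> * (2 * \<phi> x)" using that by (intro mult_left_mono) auto
    then have "exp (- \<tau> * \<epsilon>) \<le> exp (\<tau> * \<phi> x) ^ 2" by (simp add: exp_double[symmetric] mult_ac)
    moreover have "bump s (x - p) \<le> (s\<^sup>2)^3"
      unfolding bump_def by (intro power_mono) auto
    ultimately have "exp (- \<tau> * \<epsilon>) * bump s (x - p) \<le> exp (\<tau> * \<phi> x) ^ 2 * (s\<^sup>2)^3"
      by (intro mult_mono) (auto simp: bump_nonneg)
    from mult_right_mono[OF this, of "(w x)\<^sup>2"] show ?thesis
      by (simp add: h_def power_mult_distrib mult_ac)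
  qed (use h0 in simp)
  define c where "c = (s\<^sup>2)^3 * B\<^sub>1\<^sup>2 * N\<^sup>2 * I\<beta> / \<kappa>"
  have I\<beta>: "0 \<le> I\<beta>" unfolding I\<beta>_def using \<beta>nn by (intro integral_nonneg \<beta>i) auto
  define \<tau>\<^sub>0 where "\<tau>\<^sub>0 = max 1 (max (8 * \<kappa>) (18 * N\<^sub>1\<^sup>2 / \<kappa>))"
  have h_int: "integral UNIV h \<le> c * exp (- \<tau> * \<epsilon>)" if "\<tau>\<^sub>0 \<le> \<tau>" for \<tau>
  proof -
    have \<tau>: "1 \<le> \<tau>" "8 * \<kappa> \<le> \<tau>" "18 * N\<^sub>1\<^sup>2 \<le> \<tau> * \<kappa>"
      using that \<kappa> by (auto simp: \<tau>\<^sub>0_def pos_divide_le_eq)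
    then have "N\<^sub>1\<^sup>2 \<le> \<tau> * \<kappa>" using zero_le_power2[of N\<^sub>1] by linarith
    define Iv where "Iv = integral UNIV (\<lambda>x. (exp (\<tau> * \<phi> x) * w x)\<^sup>2)"
    have ivv: "(\<lambda>x. (exp (\<tau> * \<phi> x) * w x)\<^sup>2) integrable_on UNIV"
      by (rule compact_support_integrable_UNIV[OF compact_cball[of p \<rho>]])
         (use w0 in \<open>auto intro!: continuous_intros \<phi>c wc\<close>)
    have Iv0: "0 \<le> Iv" unfolding Iv_def by (intro integral_nonneg ivv) auto
    have "\<kappa> * Iv \<le> \<tau>^3 * \<kappa> * Iv"
      using \<tau>(1) \<kappa> Iv0 one_le_power[OF \<tau>(1), of 3] by (intro mult_right_mono) auto
    also have "\<dots> \<le> B\<^sub>1\<^sup>2 * N\<^sup>2 * exp (- 2 * \<tau> * \<epsilon>) * I\<beta>"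
      unfolding Iv_def by (rule main[OF \<tau>(1,2) \<open>N\<^sub>1\<^sup>2 \<le> \<tau> * \<kappa>\<close> \<tau>(3)])
    finally have Ivle: "Iv \<le> B\<^sub>1\<^sup>2 * N\<^sup>2 * exp (- 2 * \<tau> * \<epsilon>) * I\<beta> / \<kappa>"
      using \<kappa> by (simp add: pos_le_divide_eq mult.commute)
    have "exp (- \<tau> * \<epsilon>) * integral UNIV h = integral UNIV (\<lambda>x. exp (- \<tau> * \<epsilon>) * h x)" by simp
    also have "\<dots> \<le> integral UNIV (\<lambda>x. (s\<^sup>2)^3 * (exp (\<tau> * \<phi> x) * w x)\<^sup>2)"
      by (rule integral_le) (use h_le \<tau>(1) hi ivv in \<open>auto intro!: integrable_on_mult_right\<close>)
    also have "\<dots> = (s\<^sup>2)^3 * Iv" unfolding Iv_def by simp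
    also have "\<dots> \<le> (s\<^sup>2)^3 * (B\<^sub>1\<^sup>2 * N\<^sup>2 * exp (- 2 * \<tau> * \<epsilon>) * I\<beta> / \<kappa>)"
      using Ivle by (intro mult_left_mono) auto
    also have "\<dots> = exp (- \<tau> * \<epsilon>) * (c * exp (- \<tau> * \<epsilon>))"
    proof -
      have "exp (- 2 * \<tau> * \<epsilon>) = exp (- \<tau> * \<epsilon>) * exp (- \<tau> * \<epsilon>)" by (simp add: exp_add[symmetric])
      then show ?thesis unfolding c_def by simp
    qed
    finally show ?thesis by simp
  qed
  have "((\<lambda>\<tau>. c * exp (- \<tau> * \<epsilon>)) \<longlongrightarrow> c * 0) at_top"
  proof (intro tendsto_mult tendsto_const)
    have "filterlim (\<lambda>\<tau>. - \<tau> * \<epsilon>) at_bot at_top"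
      using filterlim_tendsto_neg_mult_at_bot[of "\<lambda>_. - \<epsilon>" "- \<epsilon>" at_top "\<lambda>x. x"] \<epsilon>
      by (simp add: filterlim_ident mult.commute)
    then show "((\<lambda>\<tau>. exp (- \<tau> * \<epsilon>)) \<longlongrightarrow> 0) at_top"
      by (rule filterlim_compose[OF exp_at_bot])
  qed
  then have hle: "integral UNIV h \<le> c * 0"
    by (rule tendsto_lowerbound) (use h_int in \<open>auto simp: eventually_at_top_linorder intro!: exI[of _ \<tau>\<^sub>0]\<close>)
  have hz: "h x = 0" for x
  proof (rule compact_support_integral_nonpos_imp_zero[OF open_UNIV compact_cball[of p s] subset_UNIV hc _ _ _ UNIV_I])
    show "h x = 0" if "x \<in> UNIV - cball p s" for x using h0 that by blast
    show "0 \<le> h x" for x by (simp add: h_def bump_nonneg)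
    show "integral UNIV h \<le> 0" using hle by simp
  qed
  show thesis
  proof (rule that[OF s(1)])
    show sub: "ball p s \<subseteq> \<Omega>" 
    proof
      fix x assume "x \<in> ball p s"
      then have "x \<in> cball p \<rho>" using s(3) by simp
      then show "x \<in> \<Omega>" using \<rho>(2) by blast
    qed
    fix x assume x: "x \<in> ball p s"
    then have "norm (x - p) < s" by (simp add: dist_norm norm_minus_commute)
    then have "0 < bump s (x - p)" "0 < \<eta> x" unfolding \<eta>_def using s(3) by (auto intro: bump_pos)
    moreover have "w x = \<eta> x * z x" using x sub by (auto simp: w_def)
    ultimately show "z x = 0" using hz[of x] by (simp add: h_def)
  qed
qed

text \<open>If the interior of the zero set were not all of \<Omega>, a ball inside it would touch
  its complement at a point of \<Omega>, and the zeros would continue across the sphere at that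
  point.\<close>

theorem unique_continuation:
  fixes z L :: "'a::euclidean_space \<Rightarrow> real" and z' :: "'a \<Rightarrow> 'a"
  assumes \<Omega>: "open \<Omega>" "connected \<Omega>"
    and z: "\<And>x. x \<in> \<Omega> \<Longrightarrow> GDERIV z x :> z' x" "continuous_on \<Omega> z'" "continuous_on \<Omega> L" "weak_lap \<Omega> z' L"
    and bound: "\<And>C. compact C \<Longrightarrow> C \<subseteq> \<Omega> \<Longrightarrow> \<exists>B. \<forall>x\<in>C. \<bar>L x\<bar> \<le> B * (\<bar>z x\<bar> + norm (z' x))"
    and U: "open U" "U \<noteq> {}" "U \<subseteq> \<Omega>" "\<And>x. x \<in> U \<Longrightarrow> z x = 0" and x: "x \<in> \<Omega>"
  shows "z x = 0"
proof -
  define P where "P = interior {x \<in> \<Omega>. z x = 0}"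
  have P: "open P" "P \<subseteq> \<Omega>" "\<And>x. x \<in> P \<Longrightarrow> z x = 0"
    unfolding P_def using interior_subset[of "{x \<in> \<Omega>. z x = 0}"] by (simp, blast, blast)
  have "U \<subseteq> P" unfolding P_def by (rule interior_maximal) (use U in auto)
  then have "P \<noteq> {}" using U(2) by blast
  have "P = \<Omega>"
  proof (rule ccontr)
    assume "P \<noteq> \<Omega>"
    then obtain a R p where R: "0 < R" "ball a R \<subseteq> P" "cball a R \<subseteq> \<Omega>" "p \<in> \<Omega> - P" "dist a p = R"
      using touching_ball[OF \<Omega> P(1,2) \<open>P \<noteq> {}\<close>] by metis
    have "ball a R \<subseteq> \<Omega>" "\<And>x. x \<in> ball a R \<Longrightarrow> z x = 0" "p \<in> \<Omega>" using R P by auto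
    then obtain s where s: "0 < s" "ball p s \<subseteq> \<Omega>" "\<And>x. x \<in> ball p s \<Longrightarrow> z x = 0"
      using unique_continuation_across_sphere[OF \<Omega>(1) z bound R(1) _ _ _ R(5)] by metis
    then have "ball p s \<subseteq> P" unfolding P_def by (intro interior_maximal) auto
    then show False using R(4) s(1) centre_in_ball by blast
  qed
  then show ?thesis using P(3) x by blast
qed

section \<open>Discrete transport and recurrence\<close>

definition weakly_div_free :: "'a::euclidean_space set \<Rightarrow> ('a \<Rightarrow> 'a) \<Rightarrow> bool" where
  "weakly_div_free \<Omega> V \<longleftrightarrow> (\<forall>\<psi> g. test_on \<Omega> \<psi> g \<longrightarrow> integral \<Omega> (\<lambda>x. V x \<bullet> g x) = 0)"

lemma compact_neighbourhood:
  fixes K :: "'a::euclidean_space set"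
  assumes "compact K" "K \<subseteq> \<Omega>" "open \<Omega>"
  obtains r where "0 < r" "compact {x + y |x y. x \<in> K \<and> y \<in> cball 0 r}" "{x + y |x y. x \<in> K \<and> y \<in> cball 0 r} \<subseteq> \<Omega>"
proof -
  obtain r where r: "r > 0" "(\<Union>x\<in>K. cball x r) \<subseteq> \<Omega>"
    using compact_subset_open_imp_cball_epsilon_subset[OF assms(1,3,2)] by blast
  have "{x + y |x y. x \<in> K \<and> y \<in> cball 0 r} \<subseteq> \<Omega>"
  proof clarify
    fix x y :: 'a assume "x \<in> K" "y \<in> cball 0 r"
    then have "x + y \<in> cball x r" by (simp add: dist_norm)
    then show "x + y \<in> \<Omega>" using r(2) \<open>x \<in> K\<close> by blast
  qed
  then show thesis using that r(1) compact_sums[OF assms(1) compact_cball] by blast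
qed

lemma in_neighbourhoodI:
  fixes x :: "'a::euclidean_space"
  assumes "x \<in> K" "dist x y \<le> r"
  shows "y \<in> {x + y |x y. x \<in> K \<and> y \<in> cball 0 r}"
proof -
  have "y = x + (y - x)" "y - x \<in> cball 0 r" using assms(2) by (auto simp: dist_norm norm_minus_commute)
  then show ?thesis using assms(1) by blast
qed

text \<open>Equality to 1 on a whole neighbourhood of \<open>K\<close> leaves room for a
  mollification kernel. Continuity suffices, as the product with the field is mollified
  afterwards.\<close>

lemma cutoff_function:
  fixes K :: "'a::euclidean_space set"
  assumes "compact K" "K \<subseteq> \<Omega>" "open \<Omega>" "K \<noteq> {}"
  obtains \<eta> r S where "continuous_on UNIV \<eta>" "0 < r" "\<And>x y. x \<in> K \<Longrightarrow> dist x y \<le> r \<Longrightarrow> \<eta> y = (1::real)"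
    "compact S" "S \<subseteq> \<Omega>" "\<And>x. x \<notin> S \<Longrightarrow> \<eta> x = 0"
proof -
  obtain r where r: "0 < r" "compact {x + y |x y. x \<in> K \<and> y \<in> cball 0 r}" "{x + y |x y. x \<in> K \<and> y \<in> cball 0 r} \<subseteq> \<Omega>"
    using compact_neighbourhood[OF assms(1-3)] .
  define \<eta> where "\<eta> = (\<lambda>x. max 0 (min 1 (2 - 2 * infdist x K / r)))"
  show thesis
  proof (rule that[of \<eta> "r/2" "{x + y |x y. x \<in> K \<and> y \<in> cball 0 r}"])
    show "continuous_on UNIV \<eta>" unfolding \<eta>_def using r(1) by (intro continuous_intros) auto
    show "\<eta> y = 1" if "x \<in> K" "dist x y \<le> r / 2" for x y
    proof -
      have "infdist y K \<le> r / 2" using infdist_le[OF that(1), of y] that(2) by (simp add: dist_commute)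
      then have "2 * infdist y K / r \<le> 1" using r(1) by (simp add: field_simps)
      then show ?thesis by (simp add: \<eta>_def)
    qed
    show "\<eta> x = 0" if "x \<notin> {x + y |x y. x \<in> K \<and> y \<in> cball 0 r}" for x
    proof -
      obtain k where k: "k \<in> K" "infdist x K = dist x k"
        using infdist_attains_inf[OF compact_imp_closed[OF assms(1)] assms(4)] by blast
      have "r < dist x k" using in_neighbourhoodI[OF k(1), of x r] that by (force simp: dist_commute)
      then have "2 * infdist x K / r > 2" using k(2) r(1) by (simp add: field_simps)
      then show ?thesis by (simp add: \<eta>_def)
    qed
  qed (use r in auto)
qed

text \<open>The field is cut off and then mollified at a radius at most \<open>r\<close>. Around a
  point of \<open>K\<close> the kernel sees only the region where the cutoff is 1, so the divergence
  there is, up to the mass, \<open>V\<close> tested with a shifted bump, hence 0. The compact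
  support provides the global bounds on \<open>W\<close> and its derivative.\<close>

lemma divergence_free_approximation:
  fixes V :: "'a::euclidean_space \<Rightarrow> 'a"
  assumes \<Omega>: "open \<Omega>" and V: "continuous_on \<Omega> V" "weakly_div_free \<Omega> V"
    and K: "compact K" "K \<subseteq> \<Omega>" "K \<noteq> {}" and \<delta>: "0 < \<delta>"
  obtains W DW L B where "\<And>x. (W has_derivative DW x) (at x)"
    "\<And>b. b \<in> Basis \<Longrightarrow> continuous_on UNIV (\<lambda>x. DW x b)"
    "0 \<le> L" "\<And>x h. norm (DW x h) \<le> L * norm h" "0 \<le> B" "\<And>x. norm (W x) \<le> B"
    "\<And>x. x \<in> K \<Longrightarrow> (\<Sum>b\<in>Basis. DW x b \<bullet> b) = 0" "\<And>x. x \<in> K \<Longrightarrow> norm (W x - V x) \<le> \<delta>"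
proof -
  obtain \<eta> r S where \<eta>: "continuous_on UNIV \<eta>" "0 < r" "\<And>x y. x \<in> K \<Longrightarrow> dist x y \<le> r \<Longrightarrow> \<eta> y = (1::real)"
    and S: "compact S" "S \<subseteq> \<Omega>" "\<And>x. x \<notin> S \<Longrightarrow> \<eta> x = 0"
    using cutoff_function[OF K(1,2) \<Omega> K(3)] by metis
  define f where "f = (\<lambda>x. if x \<in> \<Omega> then \<eta> x *\<^sub>R V x else 0)"
  have fc: "continuous_on UNIV f"
    unfolding f_def
    by (rule extend_by_zero_continuous[OF \<Omega> compact_imp_closed[OF S(1)] S(2)])
       (use S V in \<open>auto intro!: continuous_intros continuous_on_subset[OF \<eta>(1)]\<close>)
  have f0: "f x = 0" if "x \<notin> S" for x using S(3)[OF that] by (simp add: f_def)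
  obtain d\<^sub>0 where d0: "0 < d\<^sub>0" "\<And>d x. 0 < d \<Longrightarrow> d < d\<^sub>0 \<Longrightarrow>
     norm (integral UNIV (\<lambda>y. bump d (x - y) *\<^sub>R f y) /\<^sub>R bump_mass d TYPE('a) - f x) \<le> \<delta>"
    using mollifier_approximates[OF S(1) fc f0 \<delta>] by blast
  define d where "d = min (d\<^sub>0 / 2) r"
  have d: "0 < d" "d < d\<^sub>0" "d \<le> r" using d0(1) \<eta>(2) by (auto simp: d_def)
  define c where "c = bump_mass d TYPE('a)"
  have bc: "continuous_on UNIV (\<lambda>y. f y \<bullet> b)" for b by (intro continuous_intros fc)
  have b0: "f y \<bullet> b = 0" if "y \<notin> S" for y b using f0[OF that] by simp
  \<comment> \<open>Components are convolved one at a time, since the convolution lemmas take a real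
    density.\<close>
  define W where "W = (\<lambda>x. (\<Sum>b\<in>Basis. integral UNIV (\<lambda>y. (f y \<bullet> b) *\<^sub>R bump d (x - y)) *\<^sub>R b) /\<^sub>R c)"
  define DW where "DW = (\<lambda>x h. (\<Sum>b\<in>Basis. integral UNIV (\<lambda>y. (f y \<bullet> b) *\<^sub>R (h \<bullet> bump_grad d (x - y))) *\<^sub>R b) /\<^sub>R c)"
  have Wd: "(W has_derivative DW x) (at x)" for x
    unfolding W_def DW_def
    by (intro has_derivative_scaleR_right has_derivative_sum has_derivative_scaleR_left
        has_derivative_convolution[OF S(1) bc b0] GDERIV_bump[unfolded gderiv_def])
       (auto intro!: continuous_intros continuous_on_bump(2)[OF continuous_on_id])
  have DWc: "continuous_on UNIV (\<lambda>x. DW x h)" for h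
    unfolding DW_def
    by (intro continuous_intros continuous_on_convolution[OF S(1) bc b0])
       (auto intro!: continuous_intros continuous_on_bump(2)[OF continuous_on_id])
  have Wc: "continuous_on UNIV W"
    using Wd has_derivative_continuous by (metis continuous_at_imp_continuous_on)
  have i: "(\<lambda>y. bump d (x - y) *\<^sub>R f y) integrable_on UNIV" "(\<lambda>y. (f y \<bullet> b) * (h \<bullet> bump_grad d (x - y))) integrable_on UNIV" for x b h
    by (rule compact_support_integrable_UNIV[OF S(1)]; use f0 fc in \<open>auto intro!: continuous_intros\<close>)+
  have W_eq: "W x = integral UNIV (\<lambda>y. bump d (x - y) *\<^sub>R f y) /\<^sub>R c" for x
  proof -
    have "(\<Sum>b\<in>Basis. integral UNIV (\<lambda>y. (f y \<bullet> b) *\<^sub>R bump d (x - y)) *\<^sub>R b) =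
        (\<Sum>b\<in>Basis. (integral UNIV (\<lambda>y. bump d (x - y) *\<^sub>R f y) \<bullet> b) *\<^sub>R b)"
      by (rule sum.cong[OF refl]) (simp add: integral_component_eq[OF i(1), symmetric] mult.commute)
    then show ?thesis unfolding W_def by (simp add: euclidean_representation)
  qed
  define S' where "S' = {x + y |x y. x \<in> S \<and> y \<in> cball 0 d}"
  have S': "compact S'" unfolding S'_def by (rule compact_sums[OF S(1) compact_cball])
  have bump_far: "bump d (x - y) = 0" "bump_grad d (x - y) = 0" if "\<not> dist y x \<le> d" for x y
  proof -
    have "d\<^sup>2 \<le> (norm (x - y))\<^sup>2"
      using that d(1) by (intro power_mono) (auto simp: dist_norm norm_minus_commute)
    then show "bump d (x - y) = 0" "bump_grad d (x - y) = 0"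
      by (simp_all add: bump_def bump_grad_def power2_norm_eq_inner)
  qed
  have far: "dist y x > d" if "x \<notin> S'" "y \<in> S" for x y
    using in_neighbourhoodI[OF that(2), of x d] that(1) unfolding S'_def by force
  have W0: "W x = 0" if "x \<notin> S'" for x
  proof -
    have "(\<lambda>y. bump d (x - y) *\<^sub>R f y) = (\<lambda>_. 0)"
      using far[OF that] bump_far(1) f0 by (force simp: fun_eq_iff)
    then show ?thesis unfolding W_eq by simp
  qed
  have DW0: "DW x h = 0" if "x \<notin> S'" for x h
  proof -
    have "(f y \<bullet> b) *\<^sub>R (h \<bullet> bump_grad d (x - y)) = 0" for y b
      using far[OF that, of y] bump_far(2)[of y x] f0[of y] by (cases "y \<in> S") auto
    then have "(\<lambda>y. (f y \<bullet> b) *\<^sub>R (h \<bullet> bump_grad d (x - y))) = (\<lambda>_. 0)" for b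
      by (intro ext)
    then show ?thesis unfolding DW_def by (simp only:) simp
  qed
  obtain B where B: "B \<ge> 0" "\<And>x. x \<in> S' \<Longrightarrow> norm (W x) \<le> B"
    using continuous_on_compact_bound[OF S' continuous_on_subset[OF Wc subset_UNIV]] by blast
  have "\<forall>b. \<exists>l\<ge>0. \<forall>x\<in>S'. norm (DW x b) \<le> l"
    using continuous_on_compact_bound[OF S' continuous_on_subset[OF DWc subset_UNIV]] by metis
  then obtain l where l: "\<And>b. l b \<ge> 0" "\<And>b x. x \<in> S' \<Longrightarrow> norm (DW x b) \<le> l b" by metis
  have Lip: "norm (DW x h) \<le> (\<Sum>b\<in>Basis. l b) * norm h" for x h
  proof -
    have le: "norm (DW x b) \<le> l b" for b using l DW0 by (cases "x \<in> S'") auto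
    have lin: "linear (DW x)" using Wd has_derivative_linear by blast
    have "DW x h = DW x (\<Sum>b\<in>Basis. (h \<bullet> b) *\<^sub>R b)" by (simp add: euclidean_representation)
    also have "\<dots> = (\<Sum>b\<in>Basis. (h \<bullet> b) *\<^sub>R DW x b)" using lin by (simp add: linear_sum linear_scale)
    also have "norm \<dots> \<le> (\<Sum>b\<in>Basis. norm ((h \<bullet> b) *\<^sub>R DW x b))" by (rule norm_sum)
    also have "\<dots> \<le> (\<Sum>b\<in>Basis. norm h * l b)"
      using le by (intro sum_mono) (auto intro!: mult_mono Basis_le_norm)
    finally show ?thesis by (simp add: sum_distrib_left mult.commute)
  qed
  show thesis
  proof (rule that[OF Wd DWc _ Lip B(1)])
    show "0 \<le> (\<Sum>b\<in>Basis. l b)" using l(1) by (intro sum_nonneg)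
    show "norm (W x) \<le> B" for x using B W0 by (cases "x \<in> S'") auto
    fix x assume x: "x \<in> K"
    have "\<eta> x = 1" using \<eta>(3)[OF x, of x] \<eta>(2) by simp
    then have "f x = V x" using x K(2) by (auto simp: f_def)
    then show "norm (W x - V x) \<le> \<delta>" using d0(2)[OF d(1,2), of x] unfolding W_eq c_def by simp
    have sub: "cball x d \<subseteq> \<Omega>"
    proof
      fix y assume "y \<in> cball x d"
      then have "\<eta> y = 1" using \<eta>(3)[OF x, of y] d(3) by simp
      then show "y \<in> \<Omega>" using S by force
    qed
    have "test_on \<Omega> (\<lambda>y. bump d (x - y)) (\<lambda>y. - bump_grad d (x - y))"
      using test_on_bump[of d x] bump_far(1) sub unfolding test_on_def
      by (auto intro!: exI[of _ "cball x d"] continuous_intros simp: dist_commute)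
    then have "integral \<Omega> (\<lambda>y. V y \<bullet> - bump_grad d (x - y)) = 0"
      using V(2) unfolding weakly_div_free_def by blast
    then have z: "integral \<Omega> (\<lambda>y. V y \<bullet> bump_grad d (x - y)) = 0" by simp
    have "c * (\<Sum>b\<in>Basis. DW x b \<bullet> b) = (\<Sum>b\<in>Basis. integral UNIV (\<lambda>y. (f y \<bullet> b) * (b \<bullet> bump_grad d (x - y))))"
    proof -
      have "(\<Sum>b'\<in>Basis. integral UNIV (\<lambda>y. (f y \<bullet> b') *\<^sub>R (b \<bullet> bump_grad d (x - y))) *\<^sub>R b') \<bullet> b =
          integral UNIV (\<lambda>y. (f y \<bullet> b) * (b \<bullet> bump_grad d (x - y)))" if "b \<in> Basis" for b
        using that by (simp add: inner_sum_left_Basis)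
      moreover have "c \<noteq> 0" using bump_mass_pos[OF d(1)] unfolding c_def by (metis less_irrefl)
      ultimately have "DW x b \<bullet> b = integral UNIV (\<lambda>y. (f y \<bullet> b) * (b \<bullet> bump_grad d (x - y))) / c" if "b \<in> Basis" for b
        using that unfolding DW_def by (simp add: divide_inverse mult.commute[of "inverse c"])
      then have "(\<Sum>b\<in>Basis. DW x b \<bullet> b) = (\<Sum>b\<in>Basis. integral UNIV (\<lambda>y. (f y \<bullet> b) * (b \<bullet> bump_grad d (x - y)))) / c"
        by (simp add: sum_divide_distrib)
      then show ?thesis using \<open>c \<noteq> 0\<close> by simp
    qed
    also have "\<dots> = integral UNIV (\<lambda>y. \<Sum>b\<in>Basis. (f y \<bullet> b) * (b \<bullet> bump_grad d (x - y)))"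
      by (rule integral_sum[symmetric]) (auto intro: i)
    also have "\<dots> = integral UNIV (\<lambda>y. f y \<bullet> bump_grad d (x - y))"
    proof -
      have "(\<Sum>b\<in>Basis. (f y \<bullet> b) * (b \<bullet> k)) = f y \<bullet> k" for y k
        by (subst euclidean_inner) (simp add: inner_commute[of k])
      then show ?thesis by simp
    qed
    also have "\<dots> = integral UNIV (\<lambda>y. if y \<in> \<Omega> then V y \<bullet> bump_grad d (x - y) else 0)"
    proof (rule integral_cong)
      fix y
      show "f y \<bullet> bump_grad d (x - y) = (if y \<in> \<Omega> then V y \<bullet> bump_grad d (x - y) else 0)"
      proof (cases "dist y x \<le> d")
        case True
        then have "\<eta> y = 1" using \<eta>(3)[OF x, of y] d(3) by (simp add: dist_commute)
        then show ?thesis by (simp add: f_def)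
      qed (simp add: bump_far(2))
    qed
    also have "\<dots> = 0" using z by (simp add: integral_restrict_UNIV)
    finally have "c * (\<Sum>b\<in>Basis. DW x b \<bullet> b) = 0" .
    then show "(\<Sum>b\<in>Basis. DW x b \<bullet> b) = 0" using bump_mass_pos[OF d(1), where 'a = 'a] unfolding c_def by simp
  qed
qed

text \<open>Jacobian determinants are avoided by differentiating \<open>\<integral> F (x + s W)\<close> in \<open>s\<close>: up to \<open>O(s)\<close> the derivative is the
  integral of \<open>W\<close> against the gradient of \<open>F \<circ> (id + s W)\<close>, which is zero for divergence free \<open>W\<close>.\<close>
lemma transport_step:
  fixes W :: "'a::euclidean_space \<Rightarrow> 'a" and F' :: "'a \<Rightarrow> 'a"
  assumes W: "\<And>x. (W has_derivative DW x) (at x)" "\<And>b. b \<in> Basis \<Longrightarrow> continuous_on UNIV (\<lambda>x. DW x b)"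
    "0 \<le> L" "\<And>x h. norm (DW x h) \<le> L * norm h" "0 \<le> B" "\<And>x. norm (W x) \<le> B"
    and K': "\<And>x. x \<in> K' \<Longrightarrow> (\<Sum>b\<in>Basis. DW x b \<bullet> b) = 0" "compact K'" "K' \<subseteq> cbox u w"
    and near: "\<And>x y. y \<in> K \<Longrightarrow> dist y x \<le> r \<Longrightarrow> x \<in> K'"
    and F: "test_on UNIV F F'" "\<And>x. x \<notin> K \<Longrightarrow> F x = 0" "\<And>x. norm (F' x) \<le> \<Lambda>" "compact K"
    and h: "0 \<le> h" "h * B \<le> r"
  shows "\<exists>G. test_on UNIV (\<lambda>x. F (x + h *\<^sub>R W x)) G \<and> (\<forall>x. norm (G x) \<le> (1 + h * L) * \<Lambda>)"
    "\<bar>integral UNIV (\<lambda>x. F (x + h *\<^sub>R W x)) - integral UNIV F\<bar> \<le> h\<^sup>2 * (\<Lambda> * L * B * measure lborel (cbox u w))"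
proof -
  have \<Lambda>: "0 \<le> \<Lambda>" using F(3)[of undefined] norm_ge_zero order_trans by blast
  have Fd: "GDERIV F x :> F' x" for x using F(1) by (auto simp: test_on_def)
  have F'c: "continuous_on UNIV F'" using F(1) by (auto simp: test_on_def)
  have Fc: "continuous_on UNIV F" by (rule GDERIV_continuous_on) (rule Fd)
  have F'0: "F' x = 0" if "x \<notin> K" for x
    using grad_eqI[OF Fd[of x]] grad_eqI[OF GDERIV_transform_open[OF GDERIV_const[of 0 x], of "- K" F]] that F(2,4)
    by (simp add: compact_imp_closed open_Compl)
  have Wc: "continuous_on UNIV W"
    using W(1) has_derivative_continuous by (metis continuous_at_imp_continuous_on)
  have lin: "linear (DW x)" for x using W(1) has_derivative_linear by blast
  \<comment> \<open>Points that a step of length at most \<open>r\<close> carries into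
    \<open>K\<close> lie in \<open>K'\<close>, where \<open>W\<close> is divergence free; all
    integrands below vanish off \<open>K'\<close>.\<close>
  have inK': "x \<in> K'" if "x + s *\<^sub>R W x \<in> K" "0 \<le> s" "s \<le> h" for x s
  proof (rule near[OF that(1)])
    have "norm (s *\<^sub>R W x) \<le> h * B" using that W(6)[of x] W(5) by (auto intro!: mult_mono)
    then show "dist (x + s *\<^sub>R W x) x \<le> r" using h(2) by (simp add: dist_norm)
  qed
  define J where "J = (\<lambda>s x k. k + s *\<^sub>R DW x k)"
  have Jl: "linear (J s x)" for s x
    unfolding J_def by (rule linearI) (auto simp: linear_add[OF lin] linear_scale[OF lin] algebra_simps)
  have \<Phi>d: "((\<lambda>x. x + s *\<^sub>R W x) has_derivative J s x) (at x)" for s x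
    unfolding J_def by (auto intro!: derivative_eq_intros W(1))
  have Fs: "((\<lambda>x. F (x + s *\<^sub>R W x)) has_derivative (\<lambda>k. J s x k \<bullet> F' (x + s *\<^sub>R W x))) (at x)" for s x
    by (rule has_derivative_compose[OF \<Phi>d Fd[unfolded gderiv_def]])
  have Jc: "continuous_on UNIV (\<lambda>x. J s x b)" if "b \<in> Basis" for s b
    unfolding J_def by (intro continuous_intros W(2) that)
  have F'\<Phi>c: "continuous_on UNIV (\<lambda>x. F' (x + s *\<^sub>R W x))" for s
    by (intro continuous_on_compose2[OF F'c] continuous_intros Wc) auto
  have F\<Phi>c: "continuous_on UNIV (\<lambda>x. F (x + s *\<^sub>R W x))" for s
    by (intro continuous_on_compose2[OF Fc] continuous_intros Wc) auto
  define G where "G = (\<lambda>x. \<Sum>b\<in>Basis. (J h x b \<bullet> F' (x + h *\<^sub>R W x)) *\<^sub>R b)"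
  have G_eq: "k \<bullet> G x = J h x k \<bullet> F' (x + h *\<^sub>R W x)" for k x
  proof -
    have "k \<bullet> G x = (\<Sum>b\<in>Basis. (J h x b \<bullet> F' (x + h *\<^sub>R W x)) * (k \<bullet> b))"
      by (simp add: G_def inner_sum_right)
    then show ?thesis using sum_Basis_linear_inner[OF Jl] by simp
  qed
  show "\<exists>G. test_on UNIV (\<lambda>x. F (x + h *\<^sub>R W x)) G \<and> (\<forall>x. norm (G x) \<le> (1 + h * L) * \<Lambda>)"
  proof (intro exI conjI allI)
    show "test_on UNIV (\<lambda>x. F (x + h *\<^sub>R W x)) G"
      unfolding test_on_def
    proof (intro conjI ballI)
      show "GDERIV (\<lambda>x. F (x + h *\<^sub>R W x)) x :> G x" for x
        unfolding gderiv_def G_eq by (rule Fs)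
      show "continuous_on UNIV G" unfolding G_def by (intro continuous_intros Jc F'\<Phi>c)
      show "\<exists>K. compact K \<and> K \<subseteq> UNIV \<and> (\<forall>x\<in>UNIV - K. F (x + h *\<^sub>R W x) = 0)"
        using K'(2) inK'[of _ h] h(1) F(2) by (intro exI[of _ K']) auto
    qed
    fix x
    have "norm (J h x k) \<le> (1 + h * L) * norm k" for k
    proof -
      have "norm (J h x k) \<le> norm k + h * norm (DW x k)"
        unfolding J_def using norm_triangle_ineq[of k "h *\<^sub>R DW x k"] h(1) by simp
      also have "\<dots> \<le> norm k + h * (L * norm k)" using W(4) h(1) by (intro add_left_mono mult_left_mono) auto
      finally show ?thesis by (simp add: algebra_simps)
    qed
    then have "G x \<bullet> G x \<le> ((1 + h * L) * norm (G x)) * \<Lambda>"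
      unfolding G_eq[of "G x" x]
      by (intro order_trans[OF norm_cauchy_schwarz] mult_mono F(3)) (use h(1) W(3) in auto)
    then have "norm (G x) * norm (G x) \<le> norm (G x) * ((1 + h * L) * \<Lambda>)"
      by (simp add: power2_norm_eq_inner[symmetric] power2_eq_square mult_ac)
    then show "norm (G x) \<le> (1 + h * L) * \<Lambda>"
      by (cases "norm (G x) = 0") (use h(1) W(3) \<Lambda> in \<open>auto simp: mult_le_cancel_left\<close>)
  qed
  define g where "g = (\<lambda>s. integral (cbox u w) (\<lambda>x. F (x + s *\<^sub>R W x)))"
  define g' where "g' = (\<lambda>s. integral (cbox u w) (\<lambda>x. W x \<bullet> F' (x + s *\<^sub>R W x)))"
  have gd: "(g has_field_derivative g' s) (at s within UNIV)" for s
    unfolding g_def g'_def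
  proof (rule leibniz_rule_field_derivative)
    fix s :: real and x :: 'a
    have "((\<lambda>s. F (x + s *\<^sub>R W x)) has_derivative (\<lambda>t. (t *\<^sub>R W x) \<bullet> F' (x + s *\<^sub>R W x))) (at s)"
      by (rule has_derivative_compose[of "\<lambda>s. x + s *\<^sub>R W x", OF _ Fd[unfolded gderiv_def]])
         (auto intro!: derivative_eq_intros)
    moreover have "(\<lambda>t. (t *\<^sub>R W x) \<bullet> F' (x + s *\<^sub>R W x)) = (*) (W x \<bullet> F' (x + s *\<^sub>R W x))"
      by (simp add: fun_eq_iff)
    ultimately show "((\<lambda>s. F (x + s *\<^sub>R W x)) has_field_derivative W x \<bullet> F' (x + s *\<^sub>R W x)) (at s within UNIV)"
      by (simp add: has_field_derivative_def)
  next
    show "(\<lambda>x. F (x + s *\<^sub>R W x)) integrable_on cbox u w" for s :: real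
      by (intro integrable_continuous continuous_on_subset[OF F\<Phi>c]) auto
    show "continuous_on (UNIV \<times> cbox u w) (\<lambda>(s, x). W x \<bullet> F' (x + s *\<^sub>R W x))"
      unfolding split_beta
      by (intro continuous_intros continuous_on_compose2[OF F'c] continuous_on_compose2[OF Wc]) auto
  qed auto
  have g'_le: "\<bar>g' s\<bar> \<le> h * (\<Lambda> * L * B * measure lborel (cbox u w))" if s: "0 \<le> s" "s \<le> h" for s
  proof -
    let ?F = "\<lambda>x. F' (x + s *\<^sub>R W x)"
    have out: "x + s *\<^sub>R W x \<notin> K" if "x \<notin> K'" for x using inK' that s by blast
    have "integral UNIV (\<lambda>x. \<Sum>b\<in>Basis. (F (x + s *\<^sub>R W x) *\<^sub>R DW x b + (J s x b \<bullet> ?F x) *\<^sub>R W x) \<bullet> b) = 0"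
    proof (rule integral_divergence_zero[OF open_UNIV K'(2) subset_UNIV, of "\<lambda>x. F (x + s *\<^sub>R W x) *\<^sub>R W x"])
      show "((\<lambda>x. F (x + s *\<^sub>R W x) *\<^sub>R W x) has_derivative
          (\<lambda>k. F (x + s *\<^sub>R W x) *\<^sub>R DW x k + (J s x k \<bullet> ?F x) *\<^sub>R W x)) (at x)" for x
        by (rule has_derivative_scaleR[OF Fs W(1)])
      show "continuous_on UNIV (\<lambda>x. F (x + s *\<^sub>R W x) *\<^sub>R DW x b + (J s x b \<bullet> ?F x) *\<^sub>R W x)" if "b \<in> Basis" for b
        by (intro continuous_intros F\<Phi>c F'\<Phi>c Wc W(2) Jc that)
    qed (use out F(2) in auto)
    moreover have "(\<Sum>b\<in>Basis. (F (x + s *\<^sub>R W x) *\<^sub>R DW x b + (J s x b \<bullet> ?F x) *\<^sub>R W x) \<bullet> b) =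
        W x \<bullet> ?F x + s * (DW x (W x) \<bullet> ?F x)" for x
    proof -
      have "F (x + s *\<^sub>R W x) * (\<Sum>b\<in>Basis. DW x b \<bullet> b) = 0"
        using out[of x] F(2) K'(1)[of x] by (cases "x \<in> K'") auto
      moreover have "(\<Sum>b\<in>Basis. (J s x b \<bullet> ?F x) * (W x \<bullet> b)) = J s x (W x) \<bullet> ?F x"
        by (rule sum_Basis_linear_inner[OF Jl])
      ultimately show ?thesis
        by (simp add: inner_add_left sum.distrib sum_distrib_left J_def)
    qed
    ultimately have z: "integral UNIV (\<lambda>x. W x \<bullet> ?F x + s * (DW x (W x) \<bullet> ?F x)) = 0" by simp
    have DWWc: "continuous_on UNIV (\<lambda>x. DW x (W x))"
    proof -
      have "DW x (W x) = (\<Sum>b\<in>Basis. (W x \<bullet> b) *\<^sub>R DW x b)" for x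
      proof -
        have "DW x (W x) = DW x (\<Sum>b\<in>Basis. (W x \<bullet> b) *\<^sub>R b)" by (simp add: euclidean_representation)
        then show ?thesis using lin by (simp add: linear_sum linear_scale)
      qed
      then show ?thesis by (simp) (intro continuous_intros Wc W(2))
    qed
    have "integral (cbox u w) (\<lambda>x. W x \<bullet> ?F x + s * (DW x (W x) \<bullet> ?F x)) = 0"
      using z integral_eq_cbox[OF subset_UNIV K'(3), of "\<lambda>x. W x \<bullet> ?F x + s * (DW x (W x) \<bullet> ?F x)"] out F'0 by simp
    moreover have "(\<lambda>x. W x \<bullet> ?F x) integrable_on cbox u w" "(\<lambda>x. DW x (W x) \<bullet> ?F x) integrable_on cbox u w"
    proof -
      have "continuous_on UNIV (\<lambda>x. W x \<bullet> ?F x)" "continuous_on UNIV (\<lambda>x. DW x (W x) \<bullet> ?F x)"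
        by (intro continuous_intros Wc F'\<Phi>c DWWc)+
      then show "(\<lambda>x. W x \<bullet> ?F x) integrable_on cbox u w" "(\<lambda>x. DW x (W x) \<bullet> ?F x) integrable_on cbox u w"
        using continuous_on_subset by (blast intro: integrable_continuous)+
    qed
    ultimately have "g' s = - s * integral (cbox u w) (\<lambda>x. DW x (W x) \<bullet> ?F x)"
      unfolding g'_def by (simp add: integral_add integrable_on_mult_right)
    moreover have "norm (integral (cbox u w) (\<lambda>x. DW x (W x) \<bullet> ?F x)) \<le> (\<Lambda> * L * B) * measure lborel (cbox u w)"
    proof (rule has_integral_bound[OF _ integrable_integral])
      show "0 \<le> \<Lambda> * L * B" using \<Lambda> W by simp
      show "(\<lambda>x. DW x (W x) \<bullet> ?F x) integrable_on cbox u w" by fact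
      show "norm (DW x (W x) \<bullet> ?F x) \<le> \<Lambda> * L * B" for x
      proof -
        have "norm (DW x (W x)) \<le> L * B"
          using W(4)[of x "W x"] mult_left_mono[OF W(6)[of x] W(3)] by linarith
        then have "norm (DW x (W x)) * norm (?F x) \<le> (L * B) * \<Lambda>"
          using F(3) W(3,5) by (intro mult_mono) auto
        then show ?thesis using Cauchy_Schwarz_ineq2[of "DW x (W x)" "?F x"] by (simp add: mult_ac)
      qed
    qed
    ultimately show ?thesis
      using s by (simp add: abs_mult mult_mono)
  qed
  have "\<bar>g h - g 0\<bar> \<le> h * (h * (\<Lambda> * L * B * measure lborel (cbox u w)))"
  proof (cases "h = 0")
    case False
    then have "0 < h" using h(1) by simp
    then obtain s where s: "0 < s" "s < h" "g h - g 0 = (h - 0) * g' s"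
      using MVT2[of 0 h g g'] gd by auto
    then show ?thesis using g'_le[of s] h(1) by (simp add: abs_mult mult_left_mono)
  qed simp
  moreover have "g h = integral UNIV (\<lambda>x. F (x + h *\<^sub>R W x))" "g 0 = integral UNIV F"
    unfolding g_def
    using integral_eq_cbox[OF subset_UNIV K'(3), of "\<lambda>x. F (x + h *\<^sub>R W x)"]
      integral_eq_cbox[OF subset_UNIV K'(3), of F] inK'[of _ h] inK'[of _ 0] h(1) F(2) by force+
  ultimately show "\<bar>integral UNIV (\<lambda>x. F (x + h *\<^sub>R W x)) - integral UNIV F\<bar> \<le> h\<^sup>2 * (\<Lambda> * L * B * measure lborel (cbox u w))"
    by (simp add: power2_eq_square mult_ac)
qed

text \<open>Each step multiplies the gradient bound by \<open>1 + h * L\<close> and changes the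
  integral by O(h^2), so the total error is O(h) as long as N h stays bounded. The hypothesis
  \<open>supp\<close> says that no point outside \<open>K\<close> is carried into the support of
  \<open>F\<close> within N steps; it keeps every iterate supported in \<open>K\<close>.\<close>

lemma transport_iterate:
  fixes W :: "'a::euclidean_space \<Rightarrow> 'a" and F' :: "'a \<Rightarrow> 'a"
  assumes W: "\<And>x. (W has_derivative DW x) (at x)" "\<And>b. b \<in> Basis \<Longrightarrow> continuous_on UNIV (\<lambda>x. DW x b)"
    "0 \<le> L" "\<And>x h. norm (DW x h) \<le> L * norm h" "0 \<le> B" "\<And>x. norm (W x) \<le> B"
    and K': "\<And>x. x \<in> K' \<Longrightarrow> (\<Sum>b\<in>Basis. DW x b \<bullet> b) = 0" "compact K'" "K' \<subseteq> cbox u w"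
    and near: "\<And>x y. y \<in> K \<Longrightarrow> dist y x \<le> r \<Longrightarrow> x \<in> K'"
    and F: "test_on UNIV F F'" "\<And>x. norm (F' x) \<le> \<Lambda>" "compact K"
    and h: "0 \<le> h" "h * B \<le> r"
    and supp: "\<And>k x. k \<le> N \<Longrightarrow> x \<notin> K \<Longrightarrow> F (((\<lambda>x. x + h *\<^sub>R W x) ^^ k) x) = 0"
    and k: "k \<le> N"
  shows "(\<exists>G. test_on UNIV (\<lambda>x. F (((\<lambda>x. x + h *\<^sub>R W x) ^^ k) x)) G \<and> (\<forall>x. norm (G x) \<le> (1 + h * L) ^ k * \<Lambda>)) \<and>
    \<bar>integral UNIV (\<lambda>x. F (((\<lambda>x. x + h *\<^sub>R W x) ^^ k) x)) - integral UNIV F\<bar> \<le>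
      real k * (h\<^sup>2 * ((1 + h * L) ^ N * \<Lambda> * L * B * measure lborel (cbox u w)))"
  using k
proof (induction k)
  case 0
  then show ?case using F by auto
next
  case (Suc k)
  let ?\<Phi> = "\<lambda>x. x + h *\<^sub>R W x"
  let ?F = "\<lambda>x. F ((?\<Phi> ^^ k) x)"
  let ?c = "measure lborel (cbox u w)"
  have \<Lambda>: "0 \<le> \<Lambda>" using F(2)[of undefined] norm_ge_zero order_trans by blast
  have kN: "k \<le> N" using Suc.prems by simp
  then obtain G where G: "test_on UNIV ?F G" "\<And>x. norm (G x) \<le> (1 + h * L) ^ k * \<Lambda>"
    and IH: "\<bar>integral UNIV ?F - integral UNIV F\<bar> \<le> real k * (h\<^sup>2 * ((1 + h * L) ^ N * \<Lambda> * L * B * ?c))"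
    using Suc.IH by blast
  have step1: "\<exists>G. test_on UNIV (\<lambda>x. ?F (x + h *\<^sub>R W x)) G \<and> (\<forall>x. norm (G x) \<le> (1 + h * L) * ((1 + h * L) ^ k * \<Lambda>))"
    by (rule transport_step(1)[OF W K' near G(1) supp[OF kN] G(2) F(3) h]) assumption+
  have step2: "\<bar>integral UNIV (\<lambda>x. ?F (x + h *\<^sub>R W x)) - integral UNIV ?F\<bar> \<le> h\<^sup>2 * ((1 + h * L) ^ k * \<Lambda> * L * B * ?c)"
    by (rule transport_step(2)[OF W K' near G(1) supp[OF kN] G(2) F(3) h]) assumption+
  have eq: "(\<lambda>x. F ((?\<Phi> ^^ Suc k) x)) = (\<lambda>x. ?F (x + h *\<^sub>R W x))"
    by (simp only: funpow_Suc_right comp_def)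
  have "(1 + h * L) ^ k * \<Lambda> * L * B * ?c \<le> (1 + h * L) ^ N * \<Lambda> * L * B * ?c"
    using h(1) W(3,5) \<Lambda> kN by (intro mult_right_mono power_increasing) auto
  then have "h\<^sup>2 * ((1 + h * L) ^ k * \<Lambda> * L * B * ?c) \<le> h\<^sup>2 * ((1 + h * L) ^ N * \<Lambda> * L * B * ?c)"
    by (rule mult_left_mono) simp
  with step2 have "\<bar>integral UNIV (\<lambda>x. ?F (x + h *\<^sub>R W x)) - integral UNIV ?F\<bar> \<le> h\<^sup>2 * ((1 + h * L) ^ N * \<Lambda> * L * B * ?c)"
    by linarith
  then have "\<bar>integral UNIV (\<lambda>x. ?F (x + h *\<^sub>R W x)) - integral UNIV F\<bar> \<le>
      real (Suc k) * (h\<^sup>2 * ((1 + h * L) ^ N * \<Lambda> * L * B * ?c))"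
    using IH unfolding of_nat_Suc distrib_right by linarith
  moreover have "\<exists>G. test_on UNIV (\<lambda>x. ?F (x + h *\<^sub>R W x)) G \<and> (\<forall>x. norm (G x) \<le> (1 + h * L) ^ Suc k * \<Lambda>)"
    using step1 by (simp add: mult.assoc)
  ultimately show ?case unfolding eq by blast
qed

text \<open>If no orbit exits, then the functions \<open>f \<circ> \<Phi>\<^sup>i\<^sup>l\<close> for \<open>i < m\<close>, with \<open>h l \<ge> \<tau>\<close>, have nearly equal
  integrals. For large \<open>m\<close> these exceed the volume available to functions with disjoint supports.\<close>
lemma recurrence_or_exit:
  fixes V :: "'a::euclidean_space \<Rightarrow> 'a"
  assumes \<Omega>: "open \<Omega>" "bounded \<Omega>" and V: "continuous_on \<Omega> V" "weakly_div_free \<Omega> V"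
    and f: "test_on UNIV f f'" "\<And>x. 0 \<le> f x" "\<And>x. f x \<le> 1" "\<And>x. x \<notin> K\<^sub>0 \<Longrightarrow> f x = 0" "0 < integral UNIV f"
    and \<tau>: "0 < \<tau>"
  obtains T where "0 < T" "\<And>K \<delta>. compact K \<Longrightarrow> K \<subseteq> \<Omega> \<Longrightarrow> K\<^sub>0 \<subseteq> K \<Longrightarrow> 0 < \<delta> \<Longrightarrow>
    \<exists>W h n X. 0 < h \<and> h \<le> \<delta> \<and> (\<forall>x\<in>K. norm (W x - V x) \<le> \<delta>) \<and> (\<forall>x. h * norm (W x) \<le> \<delta>) \<and>
      real n * h \<le> T \<and> (\<forall>j<n. X (Suc j) = X j + h *\<^sub>R W (X j)) \<and> (\<forall>j\<le>n. X j \<in> K) \<and> X n \<in> K\<^sub>0 \<and>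
      ((\<exists>y. y \<notin> K \<and> dist (X 0) y \<le> \<delta>) \<or> (X 0 \<in> K\<^sub>0 \<and> \<tau> \<le> real n * h))"
proof -
  define I where "I = integral UNIV f"
  have I: "0 < I" using f(5) by (simp add: I_def)
  obtain c where c: "\<Omega> \<subseteq> cbox (-c) c" using bounded_subset_cbox_symmetric \<Omega>(2) by blast
  define vol where "vol = measure lborel (cbox (-c) c)"
  have vol: "0 \<le> vol" by (simp add: vol_def)
  \<comment> \<open>Half of \<open>I\<close> is what the transport error will leave of each
    integral; \<open>m\<close> such halves exceed the available volume.\<close>
  obtain m :: nat where m: "vol < real m * (I / 2)"
    using ex_less_of_nat_mult[of "I / 2" vol] I by auto
  then have m0: "0 < m" using vol by (cases m) auto
  \<comment> \<open>The total time of \<open>m\<close> blocks of \<open>l\<close> steps. A block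
    lasts at most \<tau> + 1, since rounding \<tau> / h up costs at most one step and h \<le>
    1.\<close>
  define T where "T = real m * (\<tau> + 1)"
  have T: "0 < T" using m0 \<tau> by (simp add: T_def)
  obtain K\<^sub>f where Kf: "compact K\<^sub>f" "\<And>x. x \<in> UNIV - K\<^sub>f \<Longrightarrow> f' x = 0" "continuous_on UNIV f'"
    using test_onE[OF f(1) open_UNIV] by metis
  obtain \<Lambda> where \<Lambda>: "\<Lambda> \<ge> 0" "\<And>x. x \<in> K\<^sub>f \<Longrightarrow> norm (f' x) \<le> \<Lambda>"
    using continuous_on_compact_bound[OF Kf(1) continuous_on_subset[OF Kf(3) subset_UNIV]] by blast
  have f'_le: "norm (f' x) \<le> \<Lambda>" for x using \<Lambda> Kf(2)[of x] by (cases "x \<in> K\<^sub>f") auto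
  have "\<exists>x. f x \<noteq> 0"
  proof (rule ccontr)
    assume "\<not> (\<exists>x. f x \<noteq> 0)"
    then have "f = (\<lambda>_. 0)" by auto
    then show False using f(5) by simp
  qed
  then have K0ne: "K\<^sub>0 \<noteq> {}" using f(4) by blast
  show thesis
  proof (rule that[OF T])
    fix K \<delta> assume K: "compact K" "K \<subseteq> \<Omega>" "K\<^sub>0 \<subseteq> K" and \<delta>: "0 < (\<delta>::real)"
    obtain r where r: "0 < r" "compact {x + y |x y. x \<in> K \<and> y \<in> cball 0 r}" "{x + y |x y. x \<in> K \<and> y \<in> cball 0 r} \<subseteq> \<Omega>"
      using compact_neighbourhood[OF K(1,2) \<Omega>(1)] .
    define K' where "K' = {x + y |x y. x \<in> K \<and> y \<in> cball 0 r}"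
    have near: "x \<in> K'" if "y \<in> K" "dist y x \<le> r" for x y
      unfolding K'_def by (rule in_neighbourhoodI[OF that])
    have K': "compact K'" "K' \<subseteq> \<Omega>" using r by (auto simp: K'_def)
    have KK': "K \<subseteq> K'" using near[of _ _] r(1) by (metis dist_self less_imp_le subsetI)
    then have "K' \<noteq> {}" using K(3) K0ne by blast
    then obtain W DW L B where W: "\<And>x. (W has_derivative DW x) (at x)"
      "\<And>b. b \<in> Basis \<Longrightarrow> continuous_on UNIV (\<lambda>x. DW x b)"
      "0 \<le> L" "\<And>x h. norm (DW x h) \<le> L * norm h" "0 \<le> B" "\<And>x. norm (W x) \<le> B"
      and Wdiv: "\<And>x. x \<in> K' \<Longrightarrow> (\<Sum>b\<in>Basis. DW x b \<bullet> b) = 0"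
      and WV: "\<And>x. x \<in> K' \<Longrightarrow> norm (W x - V x) \<le> \<delta>"
      using divergence_free_approximation[OF \<Omega>(1) V K' _ \<delta>] by blast
    have K'c: "K' \<subseteq> cbox (-c) c" using K'(2) c by blast
    define C where "C = exp (T * L) * \<Lambda> * L * B * vol"
    have C: "0 \<le> C" using \<Lambda>(1) W(3,5) vol by (simp add: C_def)
    \<comment> \<open>A step is then at most as long as \<delta> and \<open>r\<close>, and the total
      transport error \<open>h * (T * C)\<close> is at most half of \<open>I\<close>.\<close>
    define h where "h = min (min 1 \<delta>) (min (min \<delta> r / (B + 1)) (I / (2 * (T * C + 1))))"
    have TC: "0 \<le> T * C" using T C by simp
    have h: "0 < h" "h \<le> 1" "h \<le> \<delta>"
      using \<delta> r(1) W(5) I TC by (auto simp: h_def)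
    have "h \<le> min \<delta> r / (B + 1)" by (simp add: h_def)
    then have "h * (B + 1) \<le> min \<delta> r" using W(5) by (simp add: pos_le_divide_eq)
    moreover have "h * B \<le> h * (B + 1)" using h(1) by simp
    ultimately have hB: "h * B \<le> \<delta>" "h * B \<le> r" by auto
    have "h \<le> I / (2 * (T * C + 1))" by (simp add: h_def)
    then have "h * (2 * (T * C + 1)) \<le> I" using TC by (simp add: pos_le_divide_eq)
    then have hC: "h * (T * C) \<le> I / 2" using h(1) by (simp add: algebra_simps)
    have hW: "h * norm (W x) \<le> \<delta>" for x
      using mult_left_mono[OF W(6)[of x], of h] h(1) hB(1) by linarith
    define \<Phi> where "\<Phi> = (\<lambda>x. x + h *\<^sub>R W x)"
    define l where "l = nat \<lceil>\<tau> / h\<rceil>"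
    define N where "N = m * l"
    have "\<tau> / h \<le> real l" unfolding l_def by linarith
    then have l1: "\<tau> \<le> real l * h" using h(1) by (simp add: pos_divide_le_eq)
    have "0 < \<tau> / h" using \<tau> h(1) by simp
    then have "real l \<le> \<tau> / h + 1" unfolding l_def by linarith
    then have "real l * h \<le> (\<tau> / h + 1) * h" using h(1) by (intro mult_right_mono) auto
    then have "real l * h \<le> \<tau> + 1" using h(1,2) by (simp add: distrib_right)
    then have NT: "real N * h \<le> T"
      unfolding N_def T_def of_nat_mult mult.assoc by (intro mult_left_mono) auto
    have l0: "0 < l" using l1 \<tau> by (cases l) auto
    consider (exit) x k where "k \<le> N" "x \<notin> K" "(\<Phi> ^^ k) x \<in> K\<^sub>0"
      | (stay) "\<And>x k. k \<le> N \<Longrightarrow> x \<notin> K \<Longrightarrow> (\<Phi> ^^ k) x \<notin> K\<^sub>0" by blast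
    then show "\<exists>W h n X. 0 < h \<and> h \<le> \<delta> \<and> (\<forall>x\<in>K. norm (W x - V x) \<le> \<delta>) \<and> (\<forall>x. h * norm (W x) \<le> \<delta>) \<and>
      real n * h \<le> T \<and> (\<forall>j<n. X (Suc j) = X j + h *\<^sub>R W (X j)) \<and> (\<forall>j\<le>n. X j \<in> K) \<and> X n \<in> K\<^sub>0 \<and>
      ((\<exists>y. y \<notin> K \<and> dist (X 0) y \<le> \<delta>) \<or> (X 0 \<in> K\<^sub>0 \<and> \<tau> \<le> real n * h))"
    proof cases
      case exit
      define P where "P = (\<lambda>k. \<exists>x. x \<notin> K \<and> (\<Phi> ^^ k) x \<in> K\<^sub>0)"
      \<comment> \<open>Minimality forces all later points of the orbit into \<open>K\<close>. The
        polygon starts after the first step, hence within \<delta> of the point \<open>x0\<close>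
        outside \<open>K\<close>.\<close>
      define k0 where "k0 = (LEAST k. P k)"
      have "P k" using exit by (auto simp: P_def)
      then have "P k0" "k0 \<le> k" unfolding k0_def by (auto intro: LeastI Least_le)
      then obtain x0 where x0: "x0 \<notin> K" "(\<Phi> ^^ k0) x0 \<in> K\<^sub>0" by (auto simp: P_def)
      have "k0 \<noteq> 0" using x0 K(3) by (intro notI) auto
      then obtain n where n: "k0 = Suc n" by (cases k0) auto
      define X where "X = (\<lambda>j. (\<Phi> ^^ Suc j) x0)"
      have XK: "X j \<in> K" if "j \<le> n" for j
      proof (rule ccontr)
        assume "X j \<notin> K"
        moreover have "(\<Phi> ^^ (n - j)) (X j) = (\<Phi> ^^ k0) x0"
          using that unfolding X_def n by (metis comp_apply funpow_add Suc_diff_le add.commute le_add_diff_inverse2 add_Suc_right)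
        ultimately have "P (n - j)" using x0(2) by (auto simp: P_def)
        then have "k0 \<le> n - j" unfolding k0_def by (rule Least_le)
        then show False using n by simp
      qed
      have XS: "X (Suc j) = X j + h *\<^sub>R W (X j)" for j by (simp add: X_def \<Phi>_def)
      have Xn: "X n \<in> K\<^sub>0" using x0(2) by (simp add: X_def n)
      have "real n * h \<le> real N * h" using n \<open>k0 \<le> k\<close> exit(1) h(1) by (intro mult_right_mono) auto
      then have nT: "real n * h \<le> T" using NT by linarith
      have "dist (X 0) x0 \<le> \<delta>" using hW[of x0] h(1) by (simp add: X_def \<Phi>_def dist_norm)
      then show ?thesis
        using h(1,3) WV KK' hW nT XS XK Xn x0(1)
        by (intro exI[of _ W] exI[of _ h] exI[of _ n] exI[of _ X]) blast
    next
      case stay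
      have supp: "f ((\<Phi> ^^ k) x) = 0" if "k \<le> N" "x \<notin> K" for k x using stay[OF that] f(4) by blast
      have intk: "I / 2 \<le> integral UNIV (\<lambda>x. f ((\<Phi> ^^ k) x))" "continuous_on UNIV (\<lambda>x. f ((\<Phi> ^^ k) x))"
        if kN: "k \<le> N" for k
      proof -
        have it: "(\<exists>G. test_on UNIV (\<lambda>x. f ((\<Phi> ^^ k) x)) G \<and> (\<forall>x. norm (G x) \<le> (1 + h * L) ^ k * \<Lambda>)) \<and>
            \<bar>integral UNIV (\<lambda>x. f ((\<Phi> ^^ k) x)) - integral UNIV f\<bar> \<le> real k * (h\<^sup>2 * ((1 + h * L) ^ N * \<Lambda> * L * B * vol))"
          unfolding \<Phi>_def vol_def
          by (rule transport_iterate[OF W Wdiv K'(1) K'c near f(1) f'_le K(1) less_imp_le[OF h(1)] hB(2)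
              supp[unfolded \<Phi>_def] kN]) assumption+
        then obtain G where "test_on UNIV (\<lambda>x. f ((\<Phi> ^^ k) x)) G" by blast
        then show "continuous_on UNIV (\<lambda>x. f ((\<Phi> ^^ k) x))"
          unfolding test_on_def by (intro GDERIV_continuous_on) auto
        have "(1 + h * L) ^ N \<le> exp (h * L) ^ N"
          using h(1) W(3) exp_ge_add_one_self[of "h * L"] by (intro power_mono) auto
        also have "\<dots> = exp (real N * (h * L))" by (simp add: exp_of_nat_mult)
        also have "\<dots> \<le> exp (T * L)"
          using mult_right_mono[OF NT W(3)] by (simp add: mult.assoc)
        finally have "(1 + h * L) ^ N * \<Lambda> * L * B * vol \<le> C"
          unfolding C_def using \<Lambda>(1) W(3,5) vol by (intro mult_right_mono) auto
        then have "real k * (h\<^sup>2 * ((1 + h * L) ^ N * \<Lambda> * L * B * vol)) \<le> real N * (h\<^sup>2 * C)"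
          using kN \<Lambda>(1) W(3,5) vol h(1) by (intro mult_mono) auto
        also have "\<dots> = (real N * h) * (h * C)" by (simp add: power2_eq_square)
        also have "\<dots> \<le> T * (h * C)" using NT h(1) C by (intro mult_right_mono) auto
        also have "\<dots> \<le> I / 2" using hC by (simp add: mult_ac)
        finally have "real k * (h\<^sup>2 * ((1 + h * L) ^ N * \<Lambda> * L * B * vol)) \<le> I / 2" .
        then show "I / 2 \<le> integral UNIV (\<lambda>x. f ((\<Phi> ^^ k) x))"
          using it unfolding I_def by linarith
      qed
      have "\<exists>x i j. i < j \<and> j < m \<and> (\<Phi> ^^ (i * l)) x \<in> K\<^sub>0 \<and> (\<Phi> ^^ (j * l)) x \<in> K\<^sub>0"
      proof (rule ccontr)
        assume neg: "\<not> ?thesis"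
        have iN: "i * l \<le> N" if "i < m" for i using that by (simp add: N_def)
        have sum_le: "(\<Sum>i<m. f ((\<Phi> ^^ (i * l)) x)) \<le> 1" for x
        proof (cases "\<exists>i<m. (\<Phi> ^^ (i * l)) x \<in> K\<^sub>0")
          case True
          then obtain i where i: "i < m" "(\<Phi> ^^ (i * l)) x \<in> K\<^sub>0" by blast
          have "f ((\<Phi> ^^ (j * l)) x) = 0" if "j \<in> {..<m} - {i}" for j
            using neg i that f(4) by (metis DiffE insertI1 lessThan_iff linorder_neqE_nat)
          then have "(\<Sum>j<m. f ((\<Phi> ^^ (j * l)) x)) = f ((\<Phi> ^^ (i * l)) x)"
            using i(1) by (subst sum.remove[of _ i]) auto
          then show ?thesis using f(3) by simp
        next
          case False
          then have "(\<Sum>j<m. f ((\<Phi> ^^ (j * l)) x)) = 0" using f(4) by (intro sum.neutral) blast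
          then show ?thesis by simp
        qed
        have sum0: "(\<Sum>i<m. f ((\<Phi> ^^ (i * l)) x)) = 0" if "x \<notin> K" for x
          using supp iN that by (intro sum.neutral) blast
        have sc: "continuous_on UNIV (\<lambda>x. \<Sum>i<m. f ((\<Phi> ^^ (i * l)) x))"
          using intk(2) iN by (intro continuous_intros) auto
        have fi: "(\<lambda>x. f ((\<Phi> ^^ (i * l)) x)) integrable_on UNIV" if "i < m" for i
          by (rule compact_support_integrable_UNIV[OF K(1) intk(2)[OF iN[OF that]]]) (use supp iN that in blast)
        have "real m * (I / 2) = (\<Sum>i<m. I / 2)" by simp
        also have "\<dots> \<le> (\<Sum>i<m. integral UNIV (\<lambda>x. f ((\<Phi> ^^ (i * l)) x)))"
          using intk(1) iN by (intro sum_mono) auto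
        also have "\<dots> = integral UNIV (\<lambda>x. \<Sum>i<m. f ((\<Phi> ^^ (i * l)) x))"
          using fi by (intro integral_sum[symmetric]) auto
        also have "\<dots> = integral (cbox (-c) c) (\<lambda>x. \<Sum>i<m. f ((\<Phi> ^^ (i * l)) x))"
          using integral_eq_cbox[OF subset_UNIV order_trans[OF K(2) c], of "\<lambda>x. \<Sum>i<m. f ((\<Phi> ^^ (i * l)) x)"] sum0
          by simp
        also have "\<dots> \<le> integral (cbox (-c) c) (\<lambda>x. 1)"
          by (rule integral_le) (use sum_le sc in \<open>auto intro!: integrable_continuous intro: continuous_on_subset\<close>)
        also have "\<dots> = vol" by (simp add: vol_def)
        finally show False using m by linarith
      qed
      then obtain x i j where ij: "i < j" "j < m" "(\<Phi> ^^ (i * l)) x \<in> K\<^sub>0" "(\<Phi> ^^ (j * l)) x \<in> K\<^sub>0" by blast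
      define n where "n = (j - i) * l"
      define X where "X = (\<lambda>a. (\<Phi> ^^ (i * l + a)) x)"
      have "j = i + (j - i)" using ij(1) by simp
      then have "j * l = (i + (j - i)) * l" by simp
      then have jn: "j * l = i * l + n" by (simp only: n_def add_mult_distrib)
      have nN: "n \<le> N" using ij(2) unfolding n_def N_def by (intro mult_le_mono1) simp
      have XK: "X a \<in> K" if "a \<le> n" for a
      proof (rule ccontr)
        assume "X a \<notin> K"
        moreover have "(\<Phi> ^^ (n - a)) (X a) = (\<Phi> ^^ (j * l)) x"
        proof -
          have "(\<Phi> ^^ (n - a + (i * l + a))) x = (\<Phi> ^^ (n - a)) (X a)"
            by (simp only: X_def funpow_add comp_apply)
          moreover have "n - a + (i * l + a) = j * l" using that jn by simp
          ultimately show ?thesis by simp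
        qed
        moreover have "n - a \<le> N" using nN by linarith
        ultimately show False using stay[of "n - a" "X a"] ij(4) by auto
      qed
      have XS: "X (Suc a) = X a + h *\<^sub>R W (X a)" for a by (simp add: X_def \<Phi>_def)
      have "real n * h \<le> real N * h" using nN h(1) by (intro mult_right_mono) auto
      then have nT: "real n * h \<le> T" using NT by linarith
      have "l \<le> n" using ij(1) unfolding n_def by (cases "j - i") auto
      then have "real l * h \<le> real n * h" using h(1) by (intro mult_right_mono) auto
      then have "\<tau> \<le> real n * h" using l1 by linarith
      moreover have "X 0 \<in> K\<^sub>0" "X n \<in> K\<^sub>0" using ij jn by (auto simp: X_def)
      ultimately show ?thesis
        using h(1,3) WV KK' hW nT XS XK
        by (intro exI[of _ W] exI[of _ h] exI[of _ n] exI[of _ X]) blast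
    qed
  qed
qed

section \<open>Limits of polygons\<close>

lemma step_function_has_integral:
  fixes a :: "nat \<Rightarrow> 'b::euclidean_space"
  assumes "0 < h"
  shows "((\<lambda>t. a (nat \<lfloor>t / h\<rfloor>)) has_integral (h *\<^sub>R (\<Sum>i<j. a i))) {0..real j * h}"
proof (induction j)
  case (Suc j)
  have eq: "a (nat \<lfloor>t / h\<rfloor>) = a j" if "t \<in> box (real j * h) (real (Suc j) * h)" for t
  proof -
    have "real j < t / h" "t / h < real j + 1"
      using that assms by (auto simp: box_real field_simps)
    then have "\<lfloor>t / h\<rfloor> = int j" by (intro floor_unique) auto
    then show ?thesis by simp
  qed
  have "((\<lambda>t. a j) has_integral (h *\<^sub>R a j)) {real j * h..real (Suc j) * h}"
    using has_integral_const_real[of "a j" "real j * h" "real (Suc j) * h"] assms by (simp add: distrib_right)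
  then have "((\<lambda>t. a (nat \<lfloor>t / h\<rfloor>)) has_integral (h *\<^sub>R a j)) (cbox (real j * h) (real (Suc j) * h))"
    unfolding cbox_interval[symmetric] by (rule has_integral_spike_interior) (rule eq)
  then have "((\<lambda>t. a (nat \<lfloor>t / h\<rfloor>)) has_integral (h *\<^sub>R (\<Sum>i<j. a i) + h *\<^sub>R a j)) {0..real (Suc j) * h}"
    using assms by (intro has_integral_combine[OF _ _ Suc.IH]) auto
  then show ?case by (simp add: scaleR_add_right)
qed (simp add: has_integral_refl)

lemma step_function_integrable:
  fixes a :: "nat \<Rightarrow> 'b::euclidean_space" and h s t :: real
  assumes "0 < h" "0 \<le> s"
  shows "(\<lambda>t. a (nat \<lfloor>t / h\<rfloor>)) integrable_on {s..t}"
proof -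
  define j where "j = nat \<lceil>t / h\<rceil>"
  have "t / h \<le> real j" unfolding j_def by linarith
  then have "t \<le> real j * h" using assms(1) by (simp add: pos_divide_le_eq)
  then have "{s..t} \<subseteq> {0..real j * h}" using assms by auto
  then show ?thesis
    using integrable_on_subinterval[OF has_integral_integrable[OF step_function_has_integral[OF assms(1)]]] by blast
qed

text \<open>Arzela-Ascoli for the interpolating polygons \<open>P\<close>. The slopes have no
  uniform bound, so equicontinuity is taken from the energy. The slopes need not converge pointwise;
  the convergence of their integrals is recorded instead, from which the derivative of the limit is
  computed later.\<close>

lemma polygon_limit:
  fixes X a :: "nat \<Rightarrow> nat \<Rightarrow> 'a::euclidean_space" and h \<epsilon> s :: "nat \<Rightarrow> real"
  assumes h: "\<And>m. 0 < h m" and X: "\<And>m j. X m (Suc j) = X m j + h m *\<^sub>R a m j"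
    and step: "\<And>m j. norm (h m *\<^sub>R a m j) \<le> \<epsilon> m" "\<epsilon> \<longlonglongrightarrow> 0"
    and energy: "\<And>m j. (\<Sum>i<j. h m * (a m i \<bullet> a m i)) \<le> E"
    and bd: "\<And>m j. norm (X m j) \<le> B" and T: "0 < T" and s: "\<And>m. s m \<in> {0..T}"
  obtains \<gamma> r s\<^sub>0 where "strict_mono r" "(\<lambda>m. s (r m)) \<longlonglongrightarrow> s\<^sub>0" "s\<^sub>0 \<in> {0..T}" "continuous_on {0..T} \<gamma>"
    "\<And>e. 0 < e \<Longrightarrow> \<exists>N. \<forall>m\<ge>N. \<forall>t\<in>{0..T}. norm (X (r m) (nat \<lfloor>t / h (r m)\<rfloor>) - \<gamma> t) < e"
    "\<And>u v. 0 \<le> u \<Longrightarrow> u \<le> v \<Longrightarrow> v \<le> T \<Longrightarrow>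
       (\<lambda>m. integral {u..v} (\<lambda>t. a (r m) (nat \<lfloor>t / h (r m)\<rfloor>))) \<longlonglongrightarrow> \<gamma> v - \<gamma> u"
proof -
  define q where "q = (\<lambda>m t. a m (nat \<lfloor>t / h m\<rfloor>))"
  define P where "P = (\<lambda>m t. X m 0 + integral {0..t} (q m))"
  have qi: "q m integrable_on {u..v}" if "0 \<le> u" for m u v
    unfolding q_def by (rule step_function_integrable[OF h that])
  have Pdiff: "P m v - P m u = integral {u..v} (q m)" if "0 \<le> u" "u \<le> v" for m u v
    using Henstock_Kurzweil_Integration.integral_combine[OF that qi[of 0 m v]] unfolding P_def by (simp add: algebra_simps)
  have Xsum: "X m j = X m 0 + h m *\<^sub>R (\<Sum>i<j. a m i)" for m j
    by (induction j) (auto simp: X scaleR_add_right)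
  have PX: "P m (real j * h m) = X m j" for m j
    unfolding P_def q_def Xsum[of m j] using integral_unique[OF step_function_has_integral[OF h, of "a m" m j]] by simp
  have near: "norm (P m t - X m (nat \<lfloor>t / h m\<rfloor>)) \<le> \<epsilon> m" if t: "0 \<le> t" for m t
  proof -
    define j where "j = nat \<lfloor>t / h m\<rfloor>"
    have "0 \<le> t / h m" using t h[of m] by simp
    then have "real j \<le> t / h m" "t / h m \<le> real j + 1" unfolding j_def by linarith+
    then have j: "real j * h m \<le> t" "t \<le> real j * h m + h m"
      using h[of m] by (auto simp: field_simps)
    have j0: "0 \<le> real j * h m" using h[of m] by simp
    have e0: "0 \<le> \<epsilon> m" using step(1)[of m 0] norm_ge_zero order_trans by blast
    have q_le: "norm (q m x) \<le> \<epsilon> m / h m" for x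
      using step(1)[of m "nat \<lfloor>x / h m\<rfloor>"] h[of m] by (simp add: q_def field_simps)
    have "norm (integral {real j * h m..t} (q m)) \<le> \<epsilon> m / h m * measure lborel {real j * h m..t}"
      by (rule has_integral_bound_real[OF _ finite.emptyI integrable_integral[OF qi[OF j0]]]) (use q_le e0 h[of m] in auto)
    also have "\<dots> \<le> \<epsilon> m / h m * h m"
      using j e0 h[of m] by (intro mult_left_mono) auto
    finally show ?thesis
      using Pdiff[OF j0 j(1), of m] h[of m] by (simp add: PX j_def[symmetric])
  qed
  have E: "0 \<le> E" using energy[of 0 0] by simp
  have q2i: "(\<lambda>t. q m t \<bullet> q m t) integrable_on {u..v}" if "0 \<le> u" for m u v
    using step_function_integrable[OF h that, of "\<lambda>j. a m j \<bullet> a m j"] unfolding q_def .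
  have q2E: "integral {u..v} (\<lambda>t. q m t \<bullet> q m t) \<le> E" if "0 \<le> u" for m u v
  proof -
    define j where "j = nat \<lceil>v / h m\<rceil>"
    have "v / h m \<le> real j" unfolding j_def by linarith
    then have "v \<le> real j * h m" using h[of m] by (simp add: pos_divide_le_eq)
    then have "integral {u..v} (\<lambda>t. q m t \<bullet> q m t) \<le> integral {0..real j * h m} (\<lambda>t. q m t \<bullet> q m t)"
      using that by (intro integral_subset_le q2i) auto
    also have "\<dots> = h m * (\<Sum>i<j. a m i \<bullet> a m i)"
      using integral_unique[OF step_function_has_integral[OF h, of "\<lambda>i. a m i \<bullet> a m i" m j]] by (simp add: q_def)
    also have "\<dots> \<le> E" using energy[of m j] by (simp add: sum_distrib_left)
    finally show ?thesis .
  qed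
  \<comment> \<open>Young's inequality |q| \<le> l / 2 + |q|^2 / (2 l), integrated. The free
    parameter \<open>l\<close> replaces the square root of the Cauchy-Schwarz bound.\<close>
  have holder: "norm (P m v - P m u) \<le> l * (v - u) / 2 + E / (2 * l)" if "0 \<le> u" "u \<le> v" "0 < l" for m u v l
  proof -
    have "norm (P m v - P m u) \<le> integral {u..v} (\<lambda>t. l / 2 + (1 / (2 * l)) * (q m t \<bullet> q m t))"
      unfolding Pdiff[OF that(1,2)]
    proof (rule integral_norm_bound_integral[OF qi[OF that(1)]])
      show "(\<lambda>t. l / 2 + 1 / (2 * l) * (q m t \<bullet> q m t)) integrable_on {u..v}"
        by (intro integrable_add integrable_on_mult_right q2i[OF that(1)] integrable_const_ivl)
      fix t
      have "0 \<le> (norm (q m t) - l)\<^sup>2" by simp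
      then have "2 * l * norm (q m t) \<le> l\<^sup>2 + q m t \<bullet> q m t"
        by (simp add: power2_diff power2_norm_eq_inner[symmetric] mult_ac)
      then show "norm (q m t) \<le> l / 2 + 1 / (2 * l) * (q m t \<bullet> q m t)"
        using that(3) by (simp add: field_simps power2_eq_square)
    qed
    also have "\<dots> = l * (v - u) / 2 + (1 / (2 * l)) * integral {u..v} (\<lambda>t. q m t \<bullet> q m t)"
    proof -
      have "(\<lambda>t. 1 / (2 * l) * (q m t \<bullet> q m t)) integrable_on {u..v}"
        by (rule integrable_on_mult_right[OF q2i[OF that(1)]])
      from integral_add[OF integrable_const_ivl[of "l / 2"] this] show ?thesis using that(2) by simp
    qed
    also have "\<dots> \<le> l * (v - u) / 2 + (1 / (2 * l)) * E"
      using q2E[OF that(1)] that(3) by (intro add_left_mono mult_left_mono) auto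
    finally show ?thesis by simp
  qed
  obtain D where D: "\<And>m. \<epsilon> m \<le> D"
  proof -
    have "Bseq \<epsilon>" using step(2) convergent_imp_Bseq convergentI by blast
    then obtain D where "\<And>m. norm (\<epsilon> m) \<le> D" unfolding Bseq_def by blast
    then show thesis using that[of D] by (metis abs_le_D1 real_norm_def)
  qed
  obtain s\<^sub>0 r1 where r1: "s\<^sub>0 \<in> {0..T}" "strict_mono r1" "(s \<circ> r1) \<longlonglongrightarrow> s\<^sub>0"
    using compact_Icc[of 0 T] s unfolding compact_def by blast
  obtain \<gamma> r2 where r2: "continuous_on {0..T} \<gamma>" "strict_mono (r2 :: nat \<Rightarrow> nat)"
    "\<And>e. 0 < e \<Longrightarrow> \<exists>N. \<forall>n x. n \<ge> N \<and> x \<in> {0..T} \<longrightarrow> norm (P (r1 (r2 n)) x - \<gamma> x) < e"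
  proof (rule Arzela_Ascoli[of "{0..T}" "\<lambda>m. P (r1 m)" "B + D"])
    show "norm (P (r1 n) x) \<le> B + D" if "x \<in> {0..T}" for n x
      using near[of x "r1 n"] bd[of "r1 n" "nat \<lfloor>x / h (r1 n)\<rfloor>"] D[of "r1 n"] that
        norm_triangle_sub[of "P (r1 n) x" "X (r1 n) (nat \<lfloor>x / h (r1 n)\<rfloor>)"] by auto
    fix x e :: real assume x: "x \<in> {0..T}" and e: "0 < e"
    \<comment> \<open>Makes the energy term E / (2 l) smaller than e / 2; the other term is then
      below e / 2 as soon as |x - y| < e / l.\<close>
    define l where "l = (E + 1) / e"
    have l: "0 < l" using E e by (simp add: l_def)
    have "E / (2 * l) < e / 2" using E e l by (simp add: l_def field_simps)
    have "norm (P (r1 n) x - P (r1 n) y) < e" if "y \<in> {0..T}" "norm (x - y) < e / l" for n y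
    proof -
      have *: "norm (P (r1 n) v - P (r1 n) u) < e" if "0 \<le> u" "u \<le> v" "v - u < e / l" for u v
      proof -
        have "l * (v - u) < e" using that(3) l by (simp add: pos_less_divide_eq mult.commute)
        then show ?thesis using holder[OF that(1,2) l, of "r1 n"] \<open>E / (2 * l) < e / 2\<close> by linarith
      qed
      show ?thesis
        using *[of x y] *[of y x] that x by (cases "x \<le> y") (auto simp: norm_minus_commute)
    qed
    then show "\<exists>d>0. \<forall>n y. y \<in> {0..T} \<and> norm (x - y) < d \<longrightarrow> norm (P (r1 n) x - P (r1 n) y) < e"
      using e l by (intro exI[of _ "e / l"]) auto
  qed auto
  define r where "r = r1 \<circ> r2"
  have r: "strict_mono r" unfolding r_def using r1(2) r2(2) by (rule strict_mono_o)
  have Plim: "(\<lambda>n. P (r n) x) \<longlonglongrightarrow> \<gamma> x" if "x \<in> {0..T}" for x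
    using r2(3) that unfolding r_def by (intro LIMSEQ_I) fastforce
  show thesis
  proof (rule that[OF r _ r1(1) r2(1)])
    show "(\<lambda>m. s (r m)) \<longlonglongrightarrow> s\<^sub>0"
      using LIMSEQ_subseq_LIMSEQ[OF r1(3) r2(2)] by (simp add: r_def o_def)
    show "\<exists>N. \<forall>m\<ge>N. \<forall>t\<in>{0..T}. norm (X (r m) (nat \<lfloor>t / h (r m)\<rfloor>) - \<gamma> t) < e" if e: "0 < e" for e
    proof -
      obtain N1 where N1: "\<And>n x. n \<ge> N1 \<Longrightarrow> x \<in> {0..T} \<Longrightarrow> norm (P (r n) x - \<gamma> x) < e / 2"
        using r2(3)[of "e/2"] e unfolding r_def by auto
      obtain N2 where N2: "\<And>n. n \<ge> N2 \<Longrightarrow> norm (\<epsilon> (r n) - 0) < e / 2"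
        using LIMSEQ_D[OF LIMSEQ_subseq_LIMSEQ[OF step(2) r], of "e/2"] e by auto
      have "norm (X (r m) (nat \<lfloor>t / h (r m)\<rfloor>) - \<gamma> t) < e" if "m \<ge> max N1 N2" "t \<in> {0..T}" for m t
        using N1[of m t] N2[of m] near[of t "r m"] that
          norm_triangle_ineq[of "X (r m) (nat \<lfloor>t / h (r m)\<rfloor>) - P (r m) t" "P (r m) t - \<gamma> t"]
        by (auto simp: norm_minus_commute)
      then show ?thesis by blast
    qed
    show "(\<lambda>m. integral {u..v} (\<lambda>t. a (r m) (nat \<lfloor>t / h (r m)\<rfloor>))) \<longlonglongrightarrow> \<gamma> v - \<gamma> u"
      if "0 \<le> u" "u \<le> v" "v \<le> T" for u v
      using tendsto_diff[OF Plim[of v] Plim[of u]] that Pdiff[OF that(1,2)] by (simp add: q_def)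
  qed
qed

section \<open>Energy of the polygons, and limit curves that come from the frontier\<close>

lemma compact_exhaustion:
  fixes \<Omega> :: "'a::euclidean_space set"
  assumes "open \<Omega>" "bounded \<Omega>"
  obtains K :: "nat \<Rightarrow> 'a set" where "\<And>m. compact (K m)" "\<And>m. K m \<subseteq> \<Omega>"
    "\<And>C. compact C \<Longrightarrow> C \<subseteq> \<Omega> \<Longrightarrow> \<exists>m\<^sub>0. \<forall>m\<ge>m\<^sub>0. C \<subseteq> K m"
proof -
  define K where "K = (\<lambda>m::nat. \<Inter>y\<in>- \<Omega>. {x. inverse (real (Suc m)) \<le> dist x y})"
  have sub: "K m \<subseteq> \<Omega>" for m
  proof
    fix x assume x: "x \<in> K m"
    show "x \<in> \<Omega>"
    proof (rule ccontr)
      assume "x \<notin> \<Omega>"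
      then have "inverse (real (Suc m)) \<le> dist x x" using x unfolding K_def by blast
      then show False by simp
    qed
  qed
  show thesis
  proof (rule that[of K])
    fix m
    have "closed (K m)" unfolding K_def by (intro closed_INT ballI closed_Collect_le continuous_intros)
    then show "compact (K m)" using sub[of m] assms(2) bounded_subset compact_eq_bounded_closed by blast
    show "K m \<subseteq> \<Omega>" by (rule sub)
  next
    fix C assume C: "compact C" "C \<subseteq> \<Omega>"
    obtain e where e: "e > 0" "(\<Union>x\<in>C. ball x e) \<subseteq> \<Omega>"
      using compact_subset_open_imp_ball_epsilon_subset[OF C(1) assms(1) C(2)] by blast
    obtain m0 where m0: "inverse (real (Suc m0)) < e" using reals_Archimedean[OF e(1)] by blast
    have "C \<subseteq> K m" if "m \<ge> m0" for m
    proof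
      fix x assume x: "x \<in> C"
      have "inverse (real (Suc m)) \<le> inverse (real (Suc m0))" using that by (simp add: field_simps)
      then have "inverse (real (Suc m)) \<le> e" using m0 by linarith
      moreover have "e \<le> dist x y" if "y \<in> - \<Omega>" for y
        using e(2) x that by (force simp: not_less[symmetric])
      ultimately show "x \<in> K m" unfolding K_def by fastforce
    qed
    then show "\<exists>m0. \<forall>m\<ge>m0. C \<subseteq> K m" by blast
  qed
qed

text \<open>With the slack 1 the inequality is an open condition on the pair of base point and
  velocity, and it holds on the graph of \<open>V\<close> over \<open>K\<close>, which is compact;
  so it persists in a uniform neighbourhood. The slack later costs only the total time.\<close>

lemma uniform_descent_condition:
  fixes V w' :: "'a::euclidean_space \<Rightarrow> 'a"
  assumes "open \<Omega>" "continuous_on \<Omega> V" "continuous_on \<Omega> w'"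
    and le: "\<And>x. x \<in> \<Omega> \<Longrightarrow> c * (V x \<bullet> V x) \<le> w' x \<bullet> V x" and K: "compact K" "K \<subseteq> \<Omega>"
  obtains \<delta> where "0 < \<delta>" "\<And>x \<xi> U. x \<in> K \<Longrightarrow> dist \<xi> x \<le> \<delta> \<Longrightarrow> norm (U - V x) \<le> \<delta> \<Longrightarrow>
    \<xi> \<in> \<Omega> \<and> c * (U \<bullet> U) - 1 \<le> w' \<xi> \<bullet> U"
proof -
  define O' where "O' = {z \<in> \<Omega> \<times> (UNIV :: 'a set). w' (fst z) \<bullet> snd z - c * (snd z \<bullet> snd z) \<in> {-1<..}}"
  have "open (\<Omega> \<times> (UNIV :: 'a set))" using assms(1) by (simp add: open_Times)
  moreover have "continuous_on (\<Omega> \<times> (UNIV :: 'a set)) (\<lambda>z. w' (fst z) \<bullet> snd z - c * (snd z \<bullet> snd z))"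
    by (intro continuous_intros continuous_on_compose2[OF assms(3)]) auto
  ultimately have "open ((\<Omega> \<times> UNIV) \<inter> (\<lambda>z. w' (fst z) \<bullet> snd z - c * (snd z \<bullet> snd z)) -` {-1<..})"
    by (intro continuous_open_preimage) auto
  also have "(\<Omega> \<times> UNIV) \<inter> (\<lambda>z. w' (fst z) \<bullet> snd z - c * (snd z \<bullet> snd z)) -` {-1<..} = O'"
    by (auto simp: O'_def)
  finally have "open O'" .
  moreover have "compact ((\<lambda>x. (x, V x)) ` K)"
    by (intro compact_continuous_image K continuous_intros continuous_on_subset[OF assms(2) K(2)])
  moreover have "(\<lambda>x. (x, V x)) ` K \<subseteq> O'"
    using K(2) le by (force simp: O'_def)
  ultimately obtain e where e: "e > 0" "(\<Union>z\<in>(\<lambda>x. (x, V x)) ` K. ball z e) \<subseteq> O'"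
    using compact_subset_open_imp_ball_epsilon_subset by metis
  show thesis
  proof (rule that[of "e / 3"])
    fix x \<xi> U assume x: "x \<in> K" "dist \<xi> x \<le> e / 3" "norm (U - V x) \<le> e / 3"
    have "dist (x, V x) (\<xi>, U) \<le> norm (\<xi> - x) + norm (U - V x)"
      using norm_Pair_le[of "\<xi> - x" "U - V x"] 
      by (subst dist_commute) (simp add: dist_norm)
    also have "\<dots> < e" using x e(1) by (simp add: dist_norm)
    finally have "(\<xi>, U) \<in> ball (x, V x) e" by simp
    then have "(\<xi>, U) \<in> O'" using e(2) x(1) by blast
    then show "\<xi> \<in> \<Omega> \<and> c * (U \<bullet> U) - 1 \<le> w' \<xi> \<bullet> U" by (auto simp: O'_def)
  qed (use e(1) in simp)
qed

text \<open>By the mean value theorem \<open>w\<close> gains at least h (c |W|^2 - 1) on each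
  segment, the intermediate point being covered by \<open>cond\<close>; the gains telescope to the
  oscillation of \<open>w\<close>.\<close>

lemma discrete_energy:
  fixes W :: "'a::euclidean_space \<Rightarrow> 'a" and X :: "nat \<Rightarrow> 'a"
  assumes w: "\<And>x. x \<in> \<Omega> \<Longrightarrow> GDERIV w x :> w' x" "\<And>x. x \<in> \<Omega> \<Longrightarrow> \<bar>w x\<bar> \<le> Bw"
    and cond: "\<And>x \<xi> U. x \<in> K \<Longrightarrow> dist \<xi> x \<le> \<delta> \<Longrightarrow> norm (U - V x) \<le> \<delta> \<Longrightarrow>
      \<xi> \<in> \<Omega> \<and> c * (U \<bullet> U) - 1 \<le> w' \<xi> \<bullet> U"
    and W: "\<And>x. x \<in> K \<Longrightarrow> norm (W x - V x) \<le> \<delta>" "\<And>x. h * norm (W x) \<le> \<delta>" and h: "0 < h"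
    and X: "\<And>j. j < n \<Longrightarrow> X (Suc j) = X j + h *\<^sub>R W (X j)" "\<And>j. j \<le> n \<Longrightarrow> X j \<in> K" and K: "K \<subseteq> \<Omega>"
  shows "c * (\<Sum>j<n. h * (W (X j) \<bullet> W (X j))) \<le> 2 * Bw + real n * h"
proof -
  have "c * (\<Sum>j<k. h * (W (X j) \<bullet> W (X j))) \<le> w (X k) - w (X 0) + real k * h" if "k \<le> n" for k
    using that
  proof (induction k)
    case (Suc k)
    let ?W = "W (X k)"
    have xk: "X k \<in> K" using X(2) Suc.prems by simp
    define \<theta> where "\<theta> = (\<lambda>s::real. w (X k + s *\<^sub>R (h *\<^sub>R ?W)))"
    define \<theta>' where "\<theta>' = (\<lambda>s::real. (h *\<^sub>R ?W) \<bullet> w' (X k + s *\<^sub>R (h *\<^sub>R ?W)))"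
    have seg: "X k + s *\<^sub>R (h *\<^sub>R ?W) \<in> \<Omega> \<and> c * (?W \<bullet> ?W) - 1 \<le> w' (X k + s *\<^sub>R (h *\<^sub>R ?W)) \<bullet> ?W"
      if "0 \<le> s" "s \<le> 1" for s
    proof (rule cond[OF xk _ W(1)[OF xk]])
      have "\<bar>s\<bar> * (h * norm ?W) \<le> 1 * \<delta>" using that W(2) h by (intro mult_mono) auto
      then show "dist (X k + s *\<^sub>R (h *\<^sub>R ?W)) (X k) \<le> \<delta>" using h by (simp add: dist_norm abs_mult mult.assoc)
    qed
    have "DERIV \<theta> s :> \<theta>' s" if "0 \<le> s" "s \<le> 1" for s
    proof -
      have "((\<lambda>s. w (X k + s *\<^sub>R (h *\<^sub>R ?W))) has_derivative
          (\<lambda>t. (t *\<^sub>R (h *\<^sub>R ?W)) \<bullet> w' (X k + s *\<^sub>R (h *\<^sub>R ?W)))) (at s)"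
        by (rule has_derivative_compose[of "\<lambda>s. X k + s *\<^sub>R (h *\<^sub>R ?W)" "\<lambda>t. t *\<^sub>R (h *\<^sub>R ?W)",
              OF _ w(1)[unfolded gderiv_def]])
           (use seg[OF that] in \<open>auto intro!: derivative_eq_intros\<close>)
      moreover have "(\<lambda>t. (t *\<^sub>R (h *\<^sub>R ?W)) \<bullet> w' (X k + s *\<^sub>R (h *\<^sub>R ?W))) = (*) (\<theta>' s)"
        by (simp add: fun_eq_iff \<theta>'_def)
      ultimately show ?thesis unfolding \<theta>_def by (simp add: has_field_derivative_def)
    qed
    then obtain s where s: "0 < s" "s < 1" "\<theta> 1 - \<theta> 0 = (1 - 0) * \<theta>' s"
      using MVT2[of 0 1 \<theta> \<theta>'] by auto
    have "h * (c * (?W \<bullet> ?W) - 1) \<le> h * (w' (X k + s *\<^sub>R (h *\<^sub>R ?W)) \<bullet> ?W)"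
      using seg[of s] s h by (intro mult_left_mono) auto
    also have "\<dots> = \<theta> 1 - \<theta> 0" using s by (simp add: \<theta>'_def inner_commute)
    also have "\<dots> = w (X (Suc k)) - w (X k)" using X(1)[of k] Suc.prems by (simp add: \<theta>_def)
    finally show ?case using Suc by (simp add: algebra_simps)
  qed simp
  from this[of n] show ?thesis
    using w(2)[of "X n"] w(2)[of "X 0"] X(2)[of n] X(2)[of 0] K by (auto simp: abs_le_iff) (smt (verit) subsetD)
qed

text \<open>Close to time t the polygons run where \<open>V\<close> is close to its value at
  \<gamma> t, so their increments, and hence those of the limit, differ from the linear ones by at
  most a factor \<open>e\<close> of the elapsed time. Neither a Lipschitz condition nor convergence
  of the slopes enters.\<close>

lemma limit_curve_derivative:
  fixes \<gamma> :: "real \<Rightarrow> 'a::euclidean_space" and X a :: "nat \<Rightarrow> nat \<Rightarrow> 'a"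
  assumes \<gamma>: "continuous_on {0..s\<^sub>0} \<gamma>" and h: "\<And>m. 0 < h m"
    and unif: "\<And>e. 0 < e \<Longrightarrow> \<exists>N. \<forall>m\<ge>N. \<forall>t\<in>{0..s\<^sub>0}. norm (X m (nat \<lfloor>t / h m\<rfloor>) - \<gamma> t) < e"
    and int: "\<And>u v. 0 \<le> u \<Longrightarrow> u \<le> v \<Longrightarrow> v \<le> s\<^sub>0 \<Longrightarrow>
       (\<lambda>m. integral {u..v} (\<lambda>t. a m (nat \<lfloor>t / h m\<rfloor>))) \<longlonglongrightarrow> \<gamma> v - \<gamma> u"
    and s: "(\<lambda>m. real (n m) * h m) \<longlonglongrightarrow> s\<^sub>0"
    and a: "\<And>m j. j < n m \<Longrightarrow> norm (a m j - V (X m j)) \<le> \<epsilon> m" "\<epsilon> \<longlonglongrightarrow> 0"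
    and V: "open \<Omega>" "continuous_on \<Omega> V" and t: "t \<in> {0..s\<^sub>0}" "\<gamma> t \<in> \<Omega>"
  shows "(\<gamma> has_vector_derivative V (\<gamma> t)) (at t within {0..s\<^sub>0})"
  unfolding has_vector_derivative_def has_derivative_within_alt
proof (intro conjI allI impI)
  show "bounded_linear (\<lambda>x. x *\<^sub>R V (\<gamma> t))" by (rule bounded_linear_scaleR_left)
  fix e :: real assume e: "0 < e"
  let ?V = "V (\<gamma> t)"
  have "isCont V (\<gamma> t)" using V t(2) by (simp add: continuous_on_eq_continuous_at)
  then obtain \<rho> where \<rho>: "0 < \<rho>" "\<And>x. dist x (\<gamma> t) < \<rho> \<Longrightarrow> dist (V x) ?V < e / 2"
    unfolding continuous_at_eps_delta using e by (metis half_gt_zero)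
  obtain d where d: "0 < d" "\<And>x. x \<in> {0..s\<^sub>0} \<Longrightarrow> dist x t < d \<Longrightarrow> dist (\<gamma> x) (\<gamma> t) < \<rho> / 2"
    using \<gamma> t(1) \<rho>(1) unfolding continuous_on_iff by (meson half_gt_zero)
  \<comment> \<open>The slopes follow \<open>V\<close> only for indices below \<open>n m\<close>,
    that is, before a time tending to \<open>s\<^sub>0\<close>; this is the reason for v <
    \<open>s\<^sub>0\<close>. The endpoint is recovered by continuity afterwards.\<close>
  have interior: "norm (\<gamma> v - \<gamma> u - (v - u) *\<^sub>R ?V) \<le> e * (v - u)"
    if uv: "0 \<le> u" "u \<le> v" "v < s\<^sub>0" "dist u t < d" "dist v t < d" for u v
  proof -
    obtain N1 where N1: "\<And>m t. m \<ge> N1 \<Longrightarrow> t \<in> {0..s\<^sub>0} \<Longrightarrow> norm (X m (nat \<lfloor>t / h m\<rfloor>) - \<gamma> t) < \<rho> / 2"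
      using unif[OF half_gt_zero[OF \<rho>(1)]] by blast
    obtain N2 where N2: "\<And>m. m \<ge> N2 \<Longrightarrow> norm (\<epsilon> m - 0) < e / 2"
      using LIMSEQ_D[OF a(2), of "e / 2"] e by auto
    obtain N3 where N3: "\<And>m. m \<ge> N3 \<Longrightarrow> v < real (n m) * h m"
      using order_tendstoD(1)[OF s uv(3)] unfolding eventually_sequentially by blast
    let ?q = "\<lambda>m x. a m (nat \<lfloor>x / h m\<rfloor>)"
    have le: "norm (integral {u..v} (?q m) - (v - u) *\<^sub>R ?V) \<le> e * (v - u)" if m: "m \<ge> max N1 (max N2 N3)" for m
    proof -
      have qi: "?q m integrable_on {u..v}" by (rule step_function_integrable[OF h uv(1)])
      have "norm (?q m x - ?V) \<le> e" if x: "x \<in> {u..v}" for x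
      proof -
        define j where "j = nat \<lfloor>x / h m\<rfloor>"
        have "0 \<le> x / h m" using x uv(1) h[of m] by simp
        then have "real j \<le> x / h m" unfolding j_def by linarith
        then have "real j * h m \<le> x" using h[of m] by (simp add: field_simps)
        also have "x < real (n m) * h m" using N3[of m] m x by auto
        finally have "j < n m" using h[of m] by simp
        then have 1: "norm (a m j - V (X m j)) < e / 2" using a(1)[of j m] N2[of m] m by auto
        have x0: "x \<in> {0..s\<^sub>0}" using x uv by auto
        have "dist x t < d" using x uv(4,5) by (auto simp: dist_real_def)
        then have "dist (\<gamma> x) (\<gamma> t) < \<rho> / 2" using d(2)[OF x0] by simp
        moreover have "dist (X m j) (\<gamma> x) < \<rho> / 2" using N1[of m x] m x0 by (simp add: dist_norm j_def)
        ultimately have "dist (X m j) (\<gamma> t) < \<rho>" using dist_triangle[of "X m j" "\<gamma> t" "\<gamma> x"] by linarith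
        then have "norm (V (X m j) - ?V) < e / 2" using \<rho>(2) by (simp add: dist_norm)
        then have "norm (a m j - ?V) < e"
          using 1 norm_triangle_ineq[of "a m j - V (X m j)" "V (X m j) - ?V"] by simp
        then show ?thesis by (simp add: j_def)
      qed
      then have "norm (integral {u..v} (\<lambda>x. ?q m x - ?V)) \<le> e * measure lborel {u..v}"
        using e by (intro has_integral_bound_real[OF _ finite.emptyI integrable_integral]) (auto intro!: integrable_diff qi)
      then show ?thesis
        using uv(2) by (simp add: integral_diff[OF qi integrable_const_ivl])
    qed
    have "(\<lambda>m. norm (integral {u..v} (?q m) - (v - u) *\<^sub>R ?V)) \<longlonglongrightarrow> norm (\<gamma> v - \<gamma> u - (v - u) *\<^sub>R ?V)"
      using uv by (intro tendsto_intros int) auto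
    then show ?thesis by (rule LIMSEQ_le_const2) (use le in blast)
  qed
  have both: "norm (\<gamma> v - \<gamma> u - (v - u) *\<^sub>R ?V) \<le> e * (v - u)"
    if uv: "0 \<le> u" "u \<le> v" "v \<le> s\<^sub>0" "dist u t < d" "dist v t < d" for u v
  proof (cases "u < v")
    case True
    define \<phi> where "\<phi> = (\<lambda>x. e * (x - u) - norm (\<gamma> x - \<gamma> u - (x - u) *\<^sub>R ?V))"
    have "continuous_on (closure {u<..<v}) \<phi>"
      using True uv unfolding \<phi>_def closure_greaterThanLessThan[OF True]
      by (intro continuous_intros continuous_on_subset[OF \<gamma>]) auto
    moreover have "v \<in> closure {u<..<v}" using True by (simp add: closure_greaterThanLessThan[OF True])
    moreover have "\<phi> x \<ge> 0" if "x \<in> {u<..<v}" for x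
      using interior[of u x] that uv by (auto simp: \<phi>_def dist_real_def)
    ultimately have "\<phi> v \<ge> 0" by (rule continuous_ge_on_closure)
    then show ?thesis by (simp add: \<phi>_def)
  qed (use uv in simp)
  show "\<exists>d>0. \<forall>y\<in>{0..s\<^sub>0}. norm (y - t) < d \<longrightarrow> norm (\<gamma> y - \<gamma> t - (y - t) *\<^sub>R ?V) \<le> e * norm (y - t)"
  proof (intro exI[of _ d] conjI ballI impI d(1))
    fix y assume y: "y \<in> {0..s\<^sub>0}" "norm (y - t) < d"
    show "norm (\<gamma> y - \<gamma> t - (y - t) *\<^sub>R ?V) \<le> e * norm (y - t)"
    proof (cases "t \<le> y")
      case True
      then show ?thesis using both[of t y] t(1) y d(1) by (simp add: dist_norm)
    next
      case False
      have "\<gamma> y - \<gamma> t - (y - t) *\<^sub>R ?V = - (\<gamma> t - \<gamma> y - (t - y) *\<^sub>R ?V)" by (simp add: algebra_simps)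
      then show ?thesis using both[of y t] t(1) y d(1) False by (simp only: norm_minus_cancel) (simp add: dist_norm)
    qed
  qed
qed

text \<open>Starting within \<rho> of \<open>y\<close> at speed at most \<open>M\<close>, the curve
  needs at least the time \<rho> / M to leave the ball of radius 2 \<rho>. During that time
  \<open>w\<close> grows at a rate of at least \<open>m\<close>, and afterwards it does not
  decrease.\<close>

lemma potential_gain:
  fixes \<gamma> :: "real \<Rightarrow> 'a::euclidean_space"
  assumes \<gamma>: "continuous_on {0..s} \<gamma>" "\<And>t. t \<in> {0..s} \<Longrightarrow> \<gamma> t \<in> \<Omega>"
    "\<And>t. t \<in> {0..s} \<Longrightarrow> (\<gamma> has_vector_derivative V (\<gamma> t)) (at t within {0..s})"
    and w: "\<And>x. x \<in> \<Omega> \<Longrightarrow> GDERIV w x :> w' x" "\<And>x. x \<in> \<Omega> \<Longrightarrow> 0 \<le> w' x \<bullet> V x"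
    and loc: "\<And>x. x \<in> ball y (2 * \<rho>) \<Longrightarrow> m \<le> w' x \<bullet> V x" "\<And>x. x \<in> ball y (2 * \<rho>) \<Longrightarrow> norm (V x) \<le> M"
    and start: "\<gamma> 0 \<in> cball y \<rho>" and pos: "0 < \<rho>" "0 < M" and s: "\<rho> / M \<le> s"
  shows "w (\<gamma> 0) + m * (\<rho> / M) \<le> w (\<gamma> s)"
proof -
  define \<tau> where "\<tau> = \<rho> / M"
  have \<tau>: "0 < \<tau>" "\<tau> \<le> s" "\<tau> * M = \<rho>" using pos s by (auto simp: \<tau>_def)
  have inside: "\<gamma> t \<in> ball y (2 * \<rho>)" if t: "0 \<le> t" "t < \<tau>" for t
  proof (rule ccontr)
    assume out: "\<gamma> t \<notin> ball y (2 * \<rho>)"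
    \<comment> \<open>The first time \<open>x\<close> in this set yields the contradiction: until
      then the speed is at most \<open>M\<close>, so less than \<rho> has been covered by a time x
      \<le> t < \<rho> / M.\<close>
    define A where "A = {x \<in> {0..t}. 2 * \<rho> \<le> dist y (\<gamma> x)}"
    have ct: "continuous_on {0..t} \<gamma>" using continuous_on_subset[OF \<gamma>(1)] t \<tau> by auto
    have "compact A"
    proof -
      have "closed A" unfolding A_def
        by (intro continuous_on_closed_Collect_le continuous_intros ct)
      moreover have "A \<subseteq> {0..t}" by (auto simp: A_def)
      then have "bounded A" using bounded_closed_interval bounded_subset by blast
      ultimately show ?thesis by (simp add: compact_eq_bounded_closed)
    qed
    moreover have "t \<in> A" using out t by (auto simp: A_def)
    ultimately obtain x where x: "x \<in> A" "\<And>z. z \<in> A \<Longrightarrow> x \<le> z"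
      using compact_attains_inf[of A] by auto
    have in_ball: "\<gamma> z \<in> ball y (2 * \<rho>)" if "0 \<le> z" "z < x" for z
      using x(2)[of z] that x(1) by (auto simp: A_def not_le[symmetric])
    have x0: "0 < x"
    proof (rule ccontr)
      assume "\<not> 0 < x"
      then have "x = 0" using x(1) by (auto simp: A_def)
      then show False using x(1) start pos(1) by (auto simp: A_def)
    qed
    have xt: "x \<le> t" using x(1) by (simp add: A_def)
    have "norm (\<gamma> x - \<gamma> 0) \<le> M * x - M * 0"
    proof (rule differentiable_bound_general[OF x0, of \<gamma> "\<lambda>t. M * t" "\<lambda>t. V (\<gamma> t)" "\<lambda>_. M"])
      show "continuous_on {0..x} \<gamma>" using continuous_on_subset[OF ct] xt by auto
      show "(\<gamma> has_vector_derivative V (\<gamma> z)) (at z)" if "0 < z" "z < x" for z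
        using \<gamma>(3)[of z] that xt t \<tau>(2) at_within_Icc_at[of 0 z s] by simp
      show "norm (V (\<gamma> z)) \<le> M" if "0 < z" "z < x" for z using loc(2)[OF in_ball] that by simp
    qed (auto intro!: continuous_intros derivative_eq_intros)
    also have "M * x - M * 0 < M * \<tau>" using xt t pos(2) by simp
    also have "M * \<tau> = \<rho>" using \<tau>(3) by (simp add: mult.commute)
    finally have "norm (\<gamma> x - \<gamma> 0) < \<rho>" .
    moreover have "2 * \<rho> \<le> dist y (\<gamma> x)" using x(1) by (simp add: A_def)
    moreover have "dist y (\<gamma> 0) \<le> \<rho>" using start by simp
    ultimately show False using dist_triangle[of y "\<gamma> x" "\<gamma> 0"] by (simp add: dist_norm norm_minus_commute)
  qed
  have wc: "continuous_on \<Omega> w" using w(1) by (rule GDERIV_continuous_on)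
  have w\<gamma>c: "continuous_on {0..s} (\<lambda>t. w (\<gamma> t))"
    using \<gamma>(2) by (intro continuous_on_compose2[OF wc \<gamma>(1)]) auto
  have w\<gamma>d: "((\<lambda>t. w (\<gamma> t)) has_real_derivative w' (\<gamma> t) \<bullet> V (\<gamma> t)) (at t)" if "0 < t" "t < s" for t
  proof -
    have "(\<gamma> has_derivative (\<lambda>h. h *\<^sub>R V (\<gamma> t))) (at t)"
      using \<gamma>(3)[of t] that at_within_Icc_at[of 0 t s] unfolding has_vector_derivative_def by simp
    from has_derivative_compose[OF this w(1)[unfolded gderiv_def], of] \<gamma>(2)[of t] that
    have "((\<lambda>t. w (\<gamma> t)) has_derivative (\<lambda>h. (h *\<^sub>R V (\<gamma> t)) \<bullet> w' (\<gamma> t))) (at t)" by simp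
    moreover have "(\<lambda>h. (h *\<^sub>R V (\<gamma> t)) \<bullet> w' (\<gamma> t)) = (*) (w' (\<gamma> t) \<bullet> V (\<gamma> t))"
      by (simp add: fun_eq_iff inner_commute)
    ultimately show ?thesis by (simp add: has_field_derivative_def)
  qed
  have "m * \<tau> \<le> w (\<gamma> \<tau>) - w (\<gamma> 0)"
  proof -
    obtain l z where z: "0 < z" "z < \<tau>" "DERIV (\<lambda>t. w (\<gamma> t)) z :> l" "w (\<gamma> \<tau>) - w (\<gamma> 0) = (\<tau> - 0) * l"
      using MVT[OF \<tau>(1), of "\<lambda>t. w (\<gamma> t)"] continuous_on_subset[OF w\<gamma>c] w\<gamma>d \<tau>(2)
      by (auto simp: real_differentiable_def) (metis less_le_trans)
    have "l = w' (\<gamma> z) \<bullet> V (\<gamma> z)" using DERIV_unique[OF z(3) w\<gamma>d] z(1,2) \<tau>(2) by simp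
    then have "m \<le> l" using loc(1)[OF inside] z by simp
    then show ?thesis using z(4) \<tau>(1) by (simp add: mult.commute)
  qed
  moreover have "w (\<gamma> \<tau>) \<le> w (\<gamma> s)"
  proof (rule DERIV_nonneg_imp_increasing_open[OF \<tau>(2)])
    show "\<exists>l. DERIV (\<lambda>t. w (\<gamma> t)) x :> l \<and> 0 \<le> l" if "\<tau> < x" "x < s" for x
      using w\<gamma>d[of x] w(2)[OF \<gamma>(2)[of x]] that \<tau>(1) by auto
    show "continuous_on {\<tau>..s} (\<lambda>t. w (\<gamma> t))" using continuous_on_subset[OF w\<gamma>c] \<tau>(1) by auto
  qed
  ultimately show ?thesis unfolding \<tau>_def by linarith
qed

text \<open>Polygons ending in the small ball \<open>K\<^sub>0\<close> have a limit curve ending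
  there. Its last time outside \<Omega> is the start of the required piece; such a time exists
  because otherwise \<open>w\<close> would gain more than its oscillation over
  \<open>K\<^sub>0\<close>.\<close>

lemma curve_from_frontier:
  fixes V w' :: "'a::euclidean_space \<Rightarrow> 'a"
  assumes \<Omega>: "open \<Omega>" "bounded \<Omega>" and V: "continuous_on \<Omega> V" "weakly_div_free \<Omega> V"
    and w: "\<And>x. x \<in> \<Omega> \<Longrightarrow> GDERIV w x :> w' x" "continuous_on \<Omega> w'" "\<And>x. x \<in> \<Omega> \<Longrightarrow> \<bar>w x\<bar> \<le> Bw"
    and c: "0 < c" "\<And>x. x \<in> \<Omega> \<Longrightarrow> c * (V x \<bullet> V x) \<le> w' x \<bullet> V x"
    and y: "y \<in> \<Omega>" "V y \<noteq> 0" and r: "0 < r"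
  obtains \<gamma> a b where "a < (b::real)" "continuous_on {a..b} \<gamma>" "\<gamma> a \<in> frontier \<Omega>" "\<gamma> b \<in> ball y r"
    "\<And>t. a < t \<Longrightarrow> t \<le> b \<Longrightarrow> \<gamma> t \<in> \<Omega>"
    "\<And>t. a < t \<Longrightarrow> t \<le> b \<Longrightarrow> (\<gamma> has_vector_derivative V (\<gamma> t)) (at t within {a..b})"
proof -
  have w'V0: "0 \<le> w' x \<bullet> V x" if "x \<in> \<Omega>" for x
    using c(2)[OF that] c(1) by (meson inner_ge_zero less_imp_le mult_nonneg_nonneg order_trans)
  \<comment> \<open>Half of the growth rate at \<open>y\<close>, so that it remains a lower bound
    for the rate in a neighbourhood.\<close>
  define m where "m = w' y \<bullet> V y / 2"
  have "0 < c * (V y \<bullet> V y)" using c(1) y(2) by simp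
  then have m: "0 < m" using c(2)[OF y(1)] by (simp add: m_def)
  define M where "M = norm (V y) + 1"
  have M: "0 < M" by (simp add: M_def add_nonneg_pos)
  have cont: "isCont (\<lambda>x. w' x \<bullet> V x) y" "isCont V y"
    using V(1) w(2) y(1) \<Omega>(1) by (auto intro!: continuous_intros simp: continuous_on_eq_continuous_at)
  obtain \<rho>1 where \<rho>1: "0 < \<rho>1" "\<And>x. dist x y < \<rho>1 \<Longrightarrow> dist (w' x \<bullet> V x) (w' y \<bullet> V y) < m"
    using cont(1) m unfolding continuous_at_eps_delta by blast
  obtain \<rho>2 where \<rho>2: "0 < \<rho>2" "\<And>x. dist x y < \<rho>2 \<Longrightarrow> dist (V x) (V y) < 1"
    using cont(2) unfolding continuous_at_eps_delta by (metis zero_less_one)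
  define \<rho> where "\<rho> = min \<rho>1 \<rho>2 / 2"
  have \<rho>: "0 < \<rho>" using \<rho>1(1) \<rho>2(1) by (simp add: \<rho>_def)
  have loc: "m \<le> w' x \<bullet> V x" "norm (V x) \<le> M" if "x \<in> ball y (2 * \<rho>)" for x
  proof -
    have "dist x y < \<rho>1" "dist x y < \<rho>2" using that by (auto simp: \<rho>_def dist_commute)
    then have "\<bar>w' x \<bullet> V x - w' y \<bullet> V y\<bar> < m" "norm (V x - V y) < 1"
      using \<rho>1(2)[of x] \<rho>2(2)[of x] by (simp_all add: dist_real_def dist_norm)
    moreover have "w' y \<bullet> V y = 2 * m" by (simp add: m_def)
    ultimately show "m \<le> w' x \<bullet> V x" "norm (V x) \<le> M"
      using norm_triangle_ineq2[of "V x" "V y"] unfolding M_def by linarith+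
  qed
  define \<tau> where "\<tau> = \<rho> / M"
  have \<tau>: "0 < \<tau>" using \<rho> M by (simp add: \<tau>_def)
  have "isCont w y" using w(1)[OF y(1)] unfolding gderiv_def by (rule has_derivative_continuous)
  then obtain \<rho>3 where \<rho>3: "0 < \<rho>3" "\<And>x. dist x y < \<rho>3 \<Longrightarrow> dist (w x) (w y) < m * \<tau> / 2"
    unfolding continuous_at_eps_delta using m \<tau> by (metis half_gt_zero mult_pos_pos)
  obtain \<rho>4 where \<rho>4: "0 < \<rho>4" "cball y \<rho>4 \<subseteq> \<Omega>" using \<Omega>(1) y(1) open_contains_cball by blast
  \<comment> \<open>Below \<rho>3 the oscillation of \<open>w\<close> over \<open>K\<^sub>0\<close>
    is less than m \<tau>, the gain guaranteed during the time \<tau> = \<rho> / M; the other bounds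
    place \<open>K\<^sub>0\<close> inside \<Omega>, inside the target ball and inside
    \<open>cball y \<rho>\<close>.\<close>
  define r' where "r' = min (min (\<rho>3 / 2) \<rho>4) (min (r / 2) \<rho>)"
  have r': "0 < r'" "r' < \<rho>3" "r' \<le> \<rho>4" "r' < r" "r' \<le> \<rho>"
    using \<rho>3(1) \<rho>4(1) r \<rho> by (auto simp: r'_def)
  define K\<^sub>0 where "K\<^sub>0 = cball y r'"
  have K0: "compact K\<^sub>0" "K\<^sub>0 \<subseteq> \<Omega>" "K\<^sub>0 \<subseteq> ball y r" "K\<^sub>0 \<subseteq> cball y \<rho>"
    using r' \<rho>4(2) by (auto simp: K\<^sub>0_def)
  have osc: "w x' - w x < m * \<tau>" if "x \<in> K\<^sub>0" "x' \<in> K\<^sub>0" for x x'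
  proof -
    have "dist (w x) (w y) < m * \<tau> / 2" "dist (w x') (w y) < m * \<tau> / 2"
      using that r'(2) \<rho>3(2)[of x] \<rho>3(2)[of x'] by (simp_all add: K\<^sub>0_def dist_commute)
    then show ?thesis unfolding dist_real_def by linarith
  qed
  \<comment> \<open>The maximum of the bump, which normalises \<open>f\<close> to values at most
    1.\<close>
  define k where "k = (r'\<^sup>2)^3"
  have k: "0 < k" using r'(1) by (simp add: k_def)
  define f where "f = (\<lambda>x. inverse k * bump r' (y - x))"
  define f' where "f' = (\<lambda>x. inverse k *\<^sub>R (- bump_grad r' (y - x)))"
  have f_test: "test_on UNIV f f'"
  proof -
    have "test_on UNIV (\<lambda>x. inverse k * bump r' (y - x)) (\<lambda>x. inverse k *\<^sub>R (- bump_grad r' (y - x)) + bump r' (y - x) *\<^sub>R 0)"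
      by (rule test_on_mult[OF open_UNIV test_on_bump GDERIV_const]) simp
    then show ?thesis by (simp add: f_def f'_def)
  qed
  have f1: "0 \<le> f x" "f x \<le> 1" "x \<notin> K\<^sub>0 \<Longrightarrow> f x = 0" for x
  proof -
    show "0 \<le> f x" using k by (simp add: f_def bump_nonneg)
    have "bump r' (y - x) \<le> k" unfolding bump_def k_def by (intro power_mono) auto
    then show "f x \<le> 1" using k by (simp add: f_def field_simps)
    show "x \<notin> K\<^sub>0 \<Longrightarrow> f x = 0"
      using bump_eq_0[of r' "y - x"] r'(1) by (simp add: f_def K\<^sub>0_def dist_norm)
  qed
  have fint: "0 < integral UNIV f"
    using integral_bump_shift[OF r'(1), of y] bump_mass_pos[OF r'(1), where 'a = 'a] k by (simp add: f_def)
  obtain T where T: "0 < T" and rec: "\<And>K \<delta>. compact K \<Longrightarrow> K \<subseteq> \<Omega> \<Longrightarrow> K\<^sub>0 \<subseteq> K \<Longrightarrow> 0 < \<delta> \<Longrightarrow>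
    \<exists>W h n X. 0 < h \<and> h \<le> \<delta> \<and> (\<forall>x\<in>K. norm (W x - V x) \<le> \<delta>) \<and> (\<forall>x. h * norm (W x) \<le> \<delta>) \<and>
      real n * h \<le> T \<and> (\<forall>j<n. X (Suc j) = X j + h *\<^sub>R W (X j)) \<and> (\<forall>j\<le>n. X j \<in> K) \<and> X n \<in> K\<^sub>0 \<and>
      ((\<exists>y. y \<notin> K \<and> dist (X 0) y \<le> \<delta>) \<or> (X 0 \<in> K\<^sub>0 \<and> \<tau> \<le> real n * h))"
    using recurrence_or_exit[OF \<Omega> V f_test f1 fint \<tau>] by metis
  obtain Ke :: "nat \<Rightarrow> 'a set" where Ke: "\<And>m. compact (Ke m)" "\<And>m. Ke m \<subseteq> \<Omega>"
    "\<And>C. compact C \<Longrightarrow> C \<subseteq> \<Omega> \<Longrightarrow> \<exists>m\<^sub>0. \<forall>m\<ge>m\<^sub>0. C \<subseteq> Ke m"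
    using compact_exhaustion[OF \<Omega>] by blast
  obtain m\<^sub>0 where m0: "\<And>m. m \<ge> m\<^sub>0 \<Longrightarrow> K\<^sub>0 \<subseteq> Ke m" using Ke(3)[OF K0(1,2)] by blast
  \<comment> \<open>The shift discards those sets of the exhaustion that may fail to contain
    \<open>K\<^sub>0\<close>.\<close>
  define K where "K = (\<lambda>m. Ke (m\<^sub>0 + m))"
  have K: "compact (K m)" "K m \<subseteq> \<Omega>" "K\<^sub>0 \<subseteq> K m" for m
    unfolding K_def using Ke m0 by auto
  have Kall: "\<exists>m1. \<forall>m\<ge>m1. C \<subseteq> K m" if C: "compact C" "C \<subseteq> \<Omega>" for C
  proof -
    obtain m1 where "\<And>m. m \<ge> m1 \<Longrightarrow> C \<subseteq> Ke m" using Ke(3)[OF C] by blast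
    then show ?thesis unfolding K_def by (intro exI[of _ m1]) auto
  qed
  \<comment> \<open>The admissible tolerance depends on the compact set, as \<open>V\<close> may be
    unbounded near the frontier; it is therefore chosen anew for each \<open>m\<close>, and also
    small enough to tend to 0.\<close>
  have "\<forall>m. \<exists>\<delta>. 0 < \<delta> \<and> \<delta> \<le> inverse (real (Suc m)) \<and> (\<forall>x \<xi> U. x \<in> K m \<longrightarrow> dist \<xi> x \<le> \<delta> \<longrightarrow> norm (U - V x) \<le> \<delta> \<longrightarrow>
      \<xi> \<in> \<Omega> \<and> c * (U \<bullet> U) - 1 \<le> w' \<xi> \<bullet> U)"
  proof
    fix m
    obtain \<delta> where "0 < \<delta>" "\<And>x \<xi> U. x \<in> K m \<Longrightarrow> dist \<xi> x \<le> \<delta> \<Longrightarrow> norm (U - V x) \<le> \<delta> \<Longrightarrow>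
        \<xi> \<in> \<Omega> \<and> c * (U \<bullet> U) - 1 \<le> w' \<xi> \<bullet> U"
      using uniform_descent_condition[OF \<Omega>(1) V(1) w(2) c(2) K(1,2)[of m]] by metis
    then show "\<exists>\<delta>. 0 < \<delta> \<and> \<delta> \<le> inverse (real (Suc m)) \<and> (\<forall>x \<xi> U. x \<in> K m \<longrightarrow> dist \<xi> x \<le> \<delta> \<longrightarrow> norm (U - V x) \<le> \<delta> \<longrightarrow>
      \<xi> \<in> \<Omega> \<and> c * (U \<bullet> U) - 1 \<le> w' \<xi> \<bullet> U)"
      by (intro exI[of _ "min \<delta> (inverse (real (Suc m)))"]) auto
  qed
  then obtain \<delta> where \<delta>: "\<And>m. 0 < \<delta> m" "\<And>m. \<delta> m \<le> inverse (real (Suc m))"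
    "\<And>m x \<xi> U. x \<in> K m \<Longrightarrow> dist \<xi> x \<le> \<delta> m \<Longrightarrow> norm (U - V x) \<le> \<delta> m \<Longrightarrow>
      \<xi> \<in> \<Omega> \<and> c * (U \<bullet> U) - 1 \<le> w' \<xi> \<bullet> U"
    by metis
  have \<delta>0: "\<delta> \<longlonglongrightarrow> 0"
  proof (rule tendsto_sandwich[OF _ _ tendsto_const LIMSEQ_inverse_real_of_nat])
    show "\<forall>\<^sub>F m in sequentially. 0 \<le> \<delta> m" using \<delta>(1) by (simp add: less_imp_le)
    show "\<forall>\<^sub>F m in sequentially. \<delta> m \<le> inverse (real (Suc m))" using \<delta>(2) by simp
  qed
  have "\<forall>m. \<exists>W h n X. 0 < h \<and> h \<le> \<delta> m \<and> (\<forall>x\<in>K m. norm (W x - V x) \<le> \<delta> m) \<and> (\<forall>x. h * norm (W x) \<le> \<delta> m) \<and>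
      real n * h \<le> T \<and> (\<forall>j<n. X (Suc j) = X j + h *\<^sub>R W (X j)) \<and> (\<forall>j\<le>n. X j \<in> K m) \<and> X n \<in> K\<^sub>0 \<and>
      ((\<exists>y. y \<notin> K m \<and> dist (X 0) y \<le> \<delta> m) \<or> (X 0 \<in> K\<^sub>0 \<and> \<tau> \<le> real n * h))"
    using rec[OF K \<delta>(1)] by blast
  then obtain W h n Y where h: "\<And>m. 0 < h m" "\<And>m. h m \<le> \<delta> m"
    and W: "\<And>m x. x \<in> K m \<Longrightarrow> norm (W m x - V x) \<le> \<delta> m" "\<And>m x. h m * norm (W m x) \<le> \<delta> m"
    and nT: "\<And>m. real (n m) * h m \<le> T"
    and Y: "\<And>m j. j < n m \<Longrightarrow> Y m (Suc j) = Y m j + h m *\<^sub>R W m (Y m j)" "\<And>m j. j \<le> n m \<Longrightarrow> Y m j \<in> K m"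
      "\<And>m. Y m (n m) \<in> K\<^sub>0"
    and start: "\<And>m. (\<exists>y. y \<notin> K m \<and> dist (Y m 0) y \<le> \<delta> m) \<or> (Y m 0 \<in> K\<^sub>0 \<and> \<tau> \<le> real (n m) * h m)"
    by metis
  \<comment> \<open>The polygons are stopped at index \<open>n m\<close> and given slope 0 from
    there on, so that all of them live on the common time interval from 0 to
    \<open>T\<close>.\<close>
  define X where "X = (\<lambda>m j. Y m (min j (n m)))"
  define a where "a = (\<lambda>m j. if j < n m then W m (Y m j) else 0)"
  have Xstep: "X m (Suc j) = X m j + h m *\<^sub>R a m j" for m j
    using Y(1)[of j m] by (cases "j < n m") (simp_all add: X_def a_def)
  have XK: "X m j \<in> K m" for m j unfolding X_def by (intro Y(2)) simp
  obtain Bd where Bd: "\<And>x. x \<in> \<Omega> \<Longrightarrow> norm x \<le> Bd" using \<Omega>(2) unfolding bounded_iff by blast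
  have energy: "(\<Sum>i<j. h m * (a m i \<bullet> a m i)) \<le> (2 * \<bar>Bw\<bar> + T) / c" for m j
  proof -
    have "(\<Sum>i<j. h m * (a m i \<bullet> a m i)) \<le> (\<Sum>i<n m. h m * (a m i \<bullet> a m i))"
    proof -
      have "(\<Sum>i<j. h m * (a m i \<bullet> a m i)) = (\<Sum>i\<in>{..<j} \<inter> {..<n m}. h m * (a m i \<bullet> a m i))"
        by (intro sum.mono_neutral_right) (auto simp: a_def)
      also have "\<dots> \<le> (\<Sum>i<n m. h m * (a m i \<bullet> a m i))"
        using h(1)[of m] by (intro sum_mono2) auto
      finally show ?thesis .
    qed
    also have "\<dots> = (\<Sum>i<n m. h m * (W m (Y m i) \<bullet> W m (Y m i)))" by (simp add: a_def)
    also have "\<dots> \<le> (2 * \<bar>Bw\<bar> + T) / c"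
    proof -
      have "c * (\<Sum>i<n m. h m * (W m (Y m i) \<bullet> W m (Y m i))) \<le> 2 * Bw + real (n m) * h m"
        by (rule discrete_energy[where \<Omega> = \<Omega> and w = w and w' = w' and K = "K m" and V = V and \<delta> = "\<delta> m"
              and W = "W m" and X = "Y m"]) (fact w(1) w(3) \<delta>(3) W(1) W(2) h(1) Y(1) Y(2) K(2))+
      then have "c * (\<Sum>i<n m. h m * (W m (Y m i) \<bullet> W m (Y m i))) \<le> 2 * \<bar>Bw\<bar> + T"
        using nT[of m] by linarith
      then show ?thesis using c(1) by (simp add: pos_le_divide_eq mult.commute)
    qed
    finally show ?thesis .
  qed
  have st: "real (n m) * h m \<in> {0..T}" for m using nT[of m] h(1)[of m] by simp
  have astep: "norm (h m *\<^sub>R a m j) \<le> \<delta> m" for m j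
    using W(2)[of m] h(1)[of m] \<delta>(1)[of m] by (auto simp: a_def)
  have Xbd: "norm (X m j) \<le> Bd" for m j using XK K(2) Bd by blast
  obtain \<gamma> \<iota> s\<^sub>0 where \<iota>: "strict_mono \<iota>" and s0: "(\<lambda>m. real (n (\<iota> m)) * h (\<iota> m)) \<longlonglongrightarrow> s\<^sub>0" "s\<^sub>0 \<in> {0..T}"
    and \<gamma>T: "continuous_on {0..T} \<gamma>"
    and unif: "\<And>e. 0 < e \<Longrightarrow> \<exists>N. \<forall>m\<ge>N. \<forall>t\<in>{0..T}. norm (X (\<iota> m) (nat \<lfloor>t / h (\<iota> m)\<rfloor>) - \<gamma> t) < e"
    and int: "\<And>u v. 0 \<le> u \<Longrightarrow> u \<le> v \<Longrightarrow> v \<le> T \<Longrightarrow>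
       (\<lambda>m. integral {u..v} (\<lambda>t. a (\<iota> m) (nat \<lfloor>t / h (\<iota> m)\<rfloor>))) \<longlonglongrightarrow> \<gamma> v - \<gamma> u"
  proof (rule polygon_limit[of h X a \<delta> "(2 * \<bar>Bw\<bar> + T) / c" Bd T "\<lambda>m. real (n m) * h m",
        OF h(1) Xstep astep \<delta>0 energy Xbd T st])
    fix \<gamma> r s\<^sub>0
    assume "strict_mono r" "(\<lambda>m. real (n (r m)) * h (r m)) \<longlonglongrightarrow> s\<^sub>0" "s\<^sub>0 \<in> {0..T}" "continuous_on {0..T} \<gamma>"
      "\<And>e. 0 < e \<Longrightarrow> \<exists>N. \<forall>m\<ge>N. \<forall>t\<in>{0..T}. norm (X (r m) (nat \<lfloor>t / h (r m)\<rfloor>) - \<gamma> t) < e"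
      "\<And>u v. 0 \<le> u \<Longrightarrow> u \<le> v \<Longrightarrow> v \<le> T \<Longrightarrow>
         (\<lambda>m. integral {u..v} (\<lambda>t. a (r m) (nat \<lfloor>t / h (r m)\<rfloor>))) \<longlonglongrightarrow> \<gamma> v - \<gamma> u"
    then show thesis by (rule that) assumption+
  qed
  have \<gamma>c: "continuous_on {0..s\<^sub>0} \<gamma>" using continuous_on_subset[OF \<gamma>T] s0(2) by auto
  have \<delta>\<iota>: "(\<lambda>m. \<delta> (\<iota> m)) \<longlonglongrightarrow> 0" using LIMSEQ_subseq_LIMSEQ[OF \<delta>0 \<iota>] by (simp add: o_def)
  have lim: "(\<lambda>m. X (\<iota> m) (nat \<lfloor>t / h (\<iota> m)\<rfloor>)) \<longlonglongrightarrow> \<gamma> t" if "t \<in> {0..T}" for t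
    using unif that by (intro LIMSEQ_I) blast
  have \<gamma>d: "(\<gamma> has_vector_derivative V (\<gamma> t)) (at t within {0..s\<^sub>0})" if t: "t \<in> {0..s\<^sub>0}" "\<gamma> t \<in> \<Omega>" for t
  proof (rule limit_curve_derivative[where X = "\<lambda>m. X (\<iota> m)" and a = "\<lambda>m. a (\<iota> m)" and h = "\<lambda>m. h (\<iota> m)"
        and n = "\<lambda>m. n (\<iota> m)" and \<epsilon> = "\<lambda>m. \<delta> (\<iota> m)", OF \<gamma>c h(1) _ _ s0(1) _ \<delta>\<iota> \<Omega>(1) V(1) t])
    show "\<exists>N. \<forall>m\<ge>N. \<forall>t\<in>{0..s\<^sub>0}. norm (X (\<iota> m) (nat \<lfloor>t / h (\<iota> m)\<rfloor>) - \<gamma> t) < e" if "0 < e" for e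
      using unif[OF that] s0(2) by fastforce
    show "(\<lambda>m. integral {u..v} (\<lambda>t. a (\<iota> m) (nat \<lfloor>t / h (\<iota> m)\<rfloor>))) \<longlonglongrightarrow> \<gamma> v - \<gamma> u"
      if "0 \<le> u" "u \<le> v" "v \<le> s\<^sub>0" for u v using int that s0(2) by auto
    show "norm (a (\<iota> m) j - V (X (\<iota> m) j)) \<le> \<delta> (\<iota> m)" if "j < n (\<iota> m)" for m j
      using W(1)[OF Y(2), of j "\<iota> m"] that by (simp add: a_def X_def)
  qed
  have in_closure: "\<gamma> t \<in> closure \<Omega>" if "t \<in> {0..T}" for t
    using lim[OF that] XK K(2) by (meson closure_sequential subsetD)
  have end_K0: "\<gamma> s\<^sub>0 \<in> K\<^sub>0"
  proof -
    let ?s = "\<lambda>m. real (n (\<iota> m)) * h (\<iota> m)"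
    have "(\<lambda>m. \<gamma> (?s m)) \<longlonglongrightarrow> \<gamma> s\<^sub>0"
      using continuous_on_tendsto_compose[OF \<gamma>T s0(1) s0(2)] st by simp
    moreover have "(\<lambda>m. X (\<iota> m) (n (\<iota> m)) - \<gamma> (?s m)) \<longlonglongrightarrow> 0"
    proof (rule LIMSEQ_I)
      fix e :: real assume "0 < e"
      then obtain N where N: "\<And>m t. m \<ge> N \<Longrightarrow> t \<in> {0..T} \<Longrightarrow> norm (X (\<iota> m) (nat \<lfloor>t / h (\<iota> m)\<rfloor>) - \<gamma> t) < e"
        using unif by blast
      have "nat \<lfloor>?s m / h (\<iota> m)\<rfloor> = n (\<iota> m)" for m using h(1)[of "\<iota> m"] by simp
      then show "\<exists>N. \<forall>m\<ge>N. norm (X (\<iota> m) (n (\<iota> m)) - \<gamma> (?s m) - 0) < e"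
        using N[OF _ st] by (intro exI[of _ N]) (metis diff_zero)
    qed
    ultimately have "(\<lambda>m. X (\<iota> m) (n (\<iota> m))) \<longlonglongrightarrow> \<gamma> s\<^sub>0"
      using tendsto_add by fastforce
    moreover have "X m (n m) \<in> K\<^sub>0" for m using Y(3) by (simp add: X_def)
    ultimately show ?thesis
      using closed_sequentially[OF compact_imp_closed[OF K0(1)], of "\<lambda>m. X (\<iota> m) (n (\<iota> m))"] by blast
  qed
  \<comment> \<open>If the limit starts inside \<Omega>, a closed ball about its starting point lies
    in \<open>K m\<close> for all large m. The polygons then cannot start near the complement of
    \<open>K m\<close>, which leaves the alternative of recurrence.\<close>
  have start_lim: "\<gamma> 0 \<in> K\<^sub>0 \<and> \<tau> \<le> s\<^sub>0" if in\<Omega>: "\<gamma> 0 \<in> \<Omega>"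
  proof -
    have X0: "(\<lambda>m. Y (\<iota> m) 0) \<longlonglongrightarrow> \<gamma> 0" using lim[of 0] T by (simp add: X_def)
    obtain e where e: "0 < e" "cball (\<gamma> 0) (2 * e) \<subseteq> \<Omega>"
    proof -
      obtain e where "0 < e" "cball (\<gamma> 0) e \<subseteq> \<Omega>" using \<Omega>(1) in\<Omega> open_contains_cball by blast
      then show thesis using that[of "e / 2"] by simp
    qed
    obtain m1 where m1: "\<And>m. m \<ge> m1 \<Longrightarrow> cball (\<gamma> 0) (2 * e) \<subseteq> K m" using Kall[OF compact_cball e(2)] by blast
    have "\<forall>\<^sub>F m in sequentially. dist (Y (\<iota> m) 0) (\<gamma> 0) < e" using tendstoD[OF X0 e(1)] .
    moreover have "\<forall>\<^sub>F m in sequentially. \<delta> (\<iota> m) < e" using order_tendstoD(2)[OF \<delta>\<iota> e(1)] .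
    moreover have "\<forall>\<^sub>F m in sequentially. m1 \<le> m" by (rule eventually_ge_at_top)
    ultimately have ev: "\<forall>\<^sub>F m in sequentially. Y (\<iota> m) 0 \<in> K\<^sub>0 \<and> \<tau> \<le> real (n (\<iota> m)) * h (\<iota> m)"
    proof eventually_elim
      case (elim m)
      have "m1 \<le> \<iota> m" using elim(3) seq_suble[OF \<iota>, of m] by linarith
      have "\<not> (\<exists>y. y \<notin> K (\<iota> m) \<and> dist (Y (\<iota> m) 0) y \<le> \<delta> (\<iota> m))"
      proof
        assume "\<exists>y. y \<notin> K (\<iota> m) \<and> dist (Y (\<iota> m) 0) y \<le> \<delta> (\<iota> m)"
        then obtain x where x: "x \<notin> K (\<iota> m)" "dist (Y (\<iota> m) 0) x \<le> \<delta> (\<iota> m)" by blast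
        have "dist (\<gamma> 0) x \<le> 2 * e"
          using dist_triangle[of "\<gamma> 0" x "Y (\<iota> m) 0"] elim(1,2) x(2) by (simp add: dist_commute)
        then show False using m1[OF \<open>m1 \<le> \<iota> m\<close>] x(1) by auto
      qed
      then show ?case using start[of "\<iota> m"] by blast
    qed
    have "\<gamma> 0 \<in> K\<^sub>0"
      by (rule Lim_in_closed_set[OF compact_imp_closed[OF K0(1)] _ _ X0]) (use ev in \<open>auto elim: eventually_mono\<close>)
    moreover have "\<tau> \<le> s\<^sub>0"
      by (rule tendsto_lowerbound[OF s0(1)]) (use ev in \<open>auto elim: eventually_mono\<close>)
    ultimately show ?thesis by blast
  qed
  define A where "A = {t \<in> {0..s\<^sub>0}. \<gamma> t \<notin> \<Omega>}"
  have "A \<noteq> {}"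
  proof
    assume "A = {}"
    then have all: "\<gamma> t \<in> \<Omega>" if "t \<in> {0..s\<^sub>0}" for t using that by (auto simp: A_def)
    then have st0: "\<gamma> 0 \<in> K\<^sub>0" "\<tau> \<le> s\<^sub>0" using start_lim s0(2) by auto
    have "w (\<gamma> 0) + m * (\<rho> / M) \<le> w (\<gamma> s\<^sub>0)"
      by (rule potential_gain[OF \<gamma>c all \<gamma>d w(1) w'V0 loc _ \<rho> M]) (use all st0 K0(4) in \<open>auto simp: \<tau>_def\<close>)
    then show False using osc[OF st0(1) end_K0] by (simp add: \<tau>_def)
  qed
  moreover have "compact A"
  proof -
    have "A = {0..s\<^sub>0} \<inter> \<gamma> -` (- \<Omega>)" by (auto simp: A_def)
    then have "closed A" using continuous_closed_preimage[OF \<gamma>c closed_atLeastAtMost, of "- \<Omega>"] \<Omega>(1) by auto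
    moreover have "A \<subseteq> {0..s\<^sub>0}" by (auto simp: A_def)
    then have "bounded A" using bounded_closed_interval bounded_subset by blast
    ultimately show ?thesis by (simp add: compact_eq_bounded_closed)
  qed
  \<comment> \<open>The last time outside \<Omega>. It exists because the set of such times is
    compact, and the curve stays in \<Omega> from then on.\<close>
  ultimately obtain \<alpha> where \<alpha>: "\<alpha> \<in> A" "\<And>t. t \<in> A \<Longrightarrow> t \<le> \<alpha>"
    using compact_attains_sup[of A] by auto
  have \<alpha>0: "0 \<le> \<alpha>" "\<alpha> \<le> s\<^sub>0" "\<gamma> \<alpha> \<notin> \<Omega>" using \<alpha>(1) by (auto simp: A_def)
  have "\<alpha> \<noteq> s\<^sub>0" using \<alpha>0(3) end_K0 K0(2) by blast
  then have lt: "\<alpha> < s\<^sub>0" using \<alpha>0(2) by simp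
  have after: "\<gamma> t \<in> \<Omega>" if "\<alpha> < t" "t \<le> s\<^sub>0" for t
    using \<alpha>(2)[of t] that \<alpha>0(1) by (auto simp: A_def)
  show thesis
  proof (rule that[OF lt])
    show "continuous_on {\<alpha>..s\<^sub>0} \<gamma>" using continuous_on_subset[OF \<gamma>c] \<alpha>0(1) by auto
    show "\<gamma> \<alpha> \<in> frontier \<Omega>" using in_closure[of \<alpha>] \<alpha>0 s0(2) \<Omega>(1) by (auto simp: frontier_def interior_open)
    show "\<gamma> s\<^sub>0 \<in> ball y r" using end_K0 K0(3) by blast
    show "\<gamma> t \<in> \<Omega>" if "\<alpha> < t" "t \<le> s\<^sub>0" for t by (rule after[OF that])
    show "(\<gamma> has_vector_derivative V (\<gamma> t)) (at t within {\<alpha>..s\<^sub>0})" if "\<alpha> < t" "t \<le> s\<^sub>0" for t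
      using has_vector_derivative_within_subset[OF \<gamma>d[OF _ after[OF that]]] that \<alpha>0(1) by auto
  qed
qed

section \<open>Change of time and conclusion\<close>

text \<open>The derivative of an inverse function, relative to sets, because the final endpoint of
  the new time interval is included.\<close>

lemma has_real_derivative_inverse_within:
  fixes \<theta> \<eta> :: "real \<Rightarrow> real"
  assumes \<theta>: "(\<theta> has_real_derivative d) (at (\<eta> u) within S)" "d \<noteq> 0"
    and \<eta>: "continuous (at u within U) \<eta>" "\<And>s. s \<in> U \<Longrightarrow> \<eta> s \<in> S" "\<And>s. s \<in> U \<Longrightarrow> \<theta> (\<eta> s) = s" and u: "u \<in> U"
  shows "(\<eta> has_real_derivative inverse d) (at u within U)"
proof -
  have "((\<lambda>y. (\<theta> y - \<theta> (\<eta> u)) / (y - \<eta> u)) \<longlongrightarrow> d) (at (\<eta> u) within S)"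
    using \<theta>(1) by (simp add: has_field_derivative_iff)
  moreover have "filterlim \<eta> (at (\<eta> u) within S) (at u within U)"
    unfolding filterlim_at
  proof
    show "\<forall>\<^sub>F s in at u within U. \<eta> s \<in> S \<and> \<eta> s \<noteq> \<eta> u"
      using \<eta>(2,3) u unfolding eventually_at_filter by (intro always_eventually) metis
    show "(\<eta> \<longlongrightarrow> \<eta> u) (at u within U)" using \<eta>(1) by (simp add: continuous_within)
  qed
  ultimately have "((\<lambda>s. (\<theta> (\<eta> s) - \<theta> (\<eta> u)) / (\<eta> s - \<eta> u)) \<longlongrightarrow> d) (at u within U)"
    by (rule filterlim_compose)
  then have "((\<lambda>s. inverse ((\<theta> (\<eta> s) - \<theta> (\<eta> u)) / (\<eta> s - \<eta> u))) \<longlongrightarrow> inverse d) (at u within U)"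
    using \<theta>(2) by (rule tendsto_inverse)
  moreover have "\<forall>\<^sub>F s in at u within U. inverse ((\<theta> (\<eta> s) - \<theta> (\<eta> u)) / (\<eta> s - \<eta> u)) = (\<eta> s - \<eta> u) / (s - u)"
    using \<eta>(3) u unfolding eventually_at_filter by (intro always_eventually) (simp add: inverse_eq_divide)
  ultimately show ?thesis
    unfolding has_field_derivative_iff by (rule Lim_transform_eventually)
qed

text \<open>Only the initial time needs work: if \<open>X\<close> has a limit \<open>v\<close> at
  the starting point, then the derivative of the curve is close to \<open>v\<close> shortly after
  time 0, and the mean value inequality makes \<open>v\<close> the one-sided derivative. If there is
  no limit, the definition demands nothing there.\<close>

lemma integral_curve_from_frontier:
  fixes \<beta> :: "real \<Rightarrow> 'a::euclidean_space"
  assumes \<Omega>: "open \<Omega>" and L: "0 < L" and \<beta>: "continuous_on {0..L} \<beta>" "\<beta> 0 \<in> frontier \<Omega>"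
    "\<And>t. 0 < t \<Longrightarrow> t \<le> L \<Longrightarrow> \<beta> t \<in> \<Omega>"
    "\<And>t. 0 < t \<Longrightarrow> t \<le> L \<Longrightarrow> (\<beta> has_vector_derivative X (\<beta> t)) (at t within {0..L})"
  shows "\<beta> L \<in> boundary_curves_union \<Omega> X"
proof -
  have out: "\<beta> 0 \<notin> \<Omega>" using \<beta>(2) \<Omega> by (simp add: frontier_def interior_open)
  have cl: "\<beta> t \<in> closure \<Omega>" if "t \<in> {0..L}" for t
    using that \<beta>(2,3) closure_subset[of \<Omega>] by (cases "t = 0") (auto simp: frontier_def less_le)
  have start: "(\<beta> has_vector_derivative v) (at 0 within {0..L})" if v: "(X \<longlongrightarrow> v) (at (\<beta> 0) within \<Omega>)" for v
    unfolding has_vector_derivative_def has_derivative_within_alt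
  proof (intro conjI allI impI)
    show "bounded_linear (\<lambda>x. x *\<^sub>R v)" by (rule bounded_linear_scaleR_left)
    fix e :: real assume e: "0 < e"
    obtain d1 where d1: "0 < d1" "\<And>x. x \<in> \<Omega> \<Longrightarrow> dist x (\<beta> 0) < d1 \<Longrightarrow> dist (X x) v < e"
      using v e out unfolding Lim_within by (metis zero_less_dist_iff)
    obtain d where d: "0 < d" "\<And>t. t \<in> {0..L} \<Longrightarrow> dist t 0 < d \<Longrightarrow> dist (\<beta> t) (\<beta> 0) < d1"
      using \<beta>(1) d1(1) L unfolding continuous_on_iff by (metis atLeastAtMost_iff less_imp_le order_refl)
    show "\<exists>d>0. \<forall>y\<in>{0..L}. norm (y - 0) < d \<longrightarrow> norm (\<beta> y - \<beta> 0 - (y - 0) *\<^sub>R v) \<le> e * norm (y - 0)"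
    proof (intro exI[of _ d] conjI ballI impI d(1))
      fix y assume y: "y \<in> {0..L}" "norm (y - 0) < d"
      show "norm (\<beta> y - \<beta> 0 - (y - 0) *\<^sub>R v) \<le> e * norm (y - 0)"
      proof (cases "y = 0")
        case False
        then have y0: "0 < y" using y by simp
        have "norm ((\<beta> y - y *\<^sub>R v) - (\<beta> 0 - 0 *\<^sub>R v)) \<le> e * y - e * 0"
        proof (rule differentiable_bound_general[OF y0, of "\<lambda>t. \<beta> t - t *\<^sub>R v" "\<lambda>t. e * t" "\<lambda>t. X (\<beta> t) - v" "\<lambda>_. e"])
          show "continuous_on {0..y} (\<lambda>t. \<beta> t - t *\<^sub>R v)"
            using y(1) by (intro continuous_intros continuous_on_subset[OF \<beta>(1)]) auto
          show "continuous_on {0..y} (\<lambda>t. e * t)" by (intro continuous_intros)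
          fix t assume t: "0 < t" "t < y"
          then have tL: "0 < t" "t < L" using y(1) by auto
          have "(\<beta> has_vector_derivative X (\<beta> t)) (at t)"
            using \<beta>(4)[of t] tL at_within_Icc_at[of 0 t L] by simp
          then show "((\<lambda>t. \<beta> t - t *\<^sub>R v) has_vector_derivative X (\<beta> t) - v) (at t)"
            by (auto intro!: derivative_eq_intros)
          show "((\<lambda>t. e * t) has_vector_derivative e) (at t)"
            by (auto intro!: derivative_eq_intros)
          have "dist (\<beta> t) (\<beta> 0) < d1" using d(2)[of t] t y by auto
          then show "norm (X (\<beta> t) - v) \<le> e" using d1(2)[of "\<beta> t"] \<beta>(3)[of t] tL by (simp add: dist_norm)
        qed
        then show ?thesis using y0 by (simp add: algebra_simps)
      qed simp
    qed
  qed
  have "integral_curve \<Omega> X L \<beta>"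
    unfolding integral_curve_def
  proof (intro conjI ballI allI impI)
    show "0 \<le> L" "continuous_on {0..L} \<beta>" using L \<beta>(1) by auto
    show "\<beta> ` {0..L} \<subseteq> closure \<Omega>" using cl by blast
    show "(\<beta> has_vector_derivative X (\<beta> t)) (at t within {0..L})" if "t \<in> {0..L}" "\<beta> t \<in> \<Omega>" for t
      using \<beta>(4)[of t] that out by (cases "t = 0") auto
    show "(\<beta> has_vector_derivative v) (at t within {0..L})"
      if "t \<in> {0..L}" "\<beta> t \<in> frontier \<Omega> \<and> (X \<longlongrightarrow> v) (at (\<beta> t) within \<Omega>)" for t v
    proof (cases "t = 0")
      case False
      then have "\<beta> t \<in> \<Omega>" using that(1) \<beta>(3) by simp
      then show ?thesis using that(2) \<Omega> by (simp add: frontier_def interior_open)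
    qed (use start that in blast)
  qed
  moreover have "\<beta> L \<in> closure \<Omega>" "\<beta> L \<in> \<beta> ` {0..L}" "\<beta> 0 \<in> \<beta> ` {0..L}" using cl L by auto
  ultimately show ?thesis unfolding boundary_curves_union_def using \<beta>(2) by blast
qed

text \<open>The new time \<theta> is the integral of \<open>D\<close> along the curve, so its
  inverse \<eta> has the derivative 1 / D, which cancels the factor \<open>D\<close>. The bounds on
  \<open>D\<close> make \<theta> finite and strictly increasing.\<close>

lemma boundary_curve_by_time_change:
  fixes \<gamma> :: "real \<Rightarrow> 'a::euclidean_space"
  assumes \<Omega>: "open \<Omega>" and D: "continuous_on \<Omega> D" "0 < c" "\<And>x. x \<in> \<Omega> \<Longrightarrow> c \<le> D x" "\<And>x. x \<in> \<Omega> \<Longrightarrow> D x \<le> C"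
    and \<gamma>: "a < (b::real)" "continuous_on {a..b} \<gamma>" "\<gamma> a \<in> frontier \<Omega>"
    "\<And>t. a < t \<Longrightarrow> t \<le> b \<Longrightarrow> \<gamma> t \<in> \<Omega>"
    "\<And>t. a < t \<Longrightarrow> t \<le> b \<Longrightarrow> (\<gamma> has_vector_derivative D (\<gamma> t) *\<^sub>R X (\<gamma> t)) (at t within {a..b})"
  shows "\<gamma> b \<in> boundary_curves_union \<Omega> X"
proof -
  define g where "g = (\<lambda>t. D (\<gamma> t))"
  have gc: "continuous_on {a<..b} g"
    unfolding g_def using \<gamma>(4)
    by (intro continuous_on_compose2[OF D(1) continuous_on_subset[OF \<gamma>(2)]]) auto
  \<comment> \<open>Nothing is known about \<open>D\<close> at the frontier point \<gamma> a. Hence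
    \<open>g\<close> is handled on the open interval, where it is continuous and bounded, and
    \<theta> is differentiated only within the interval without \<open>a\<close>.\<close>
  have gi: "g integrable_on {a..b}"
    unfolding integrable_on_Icc_iff_Ioo
  proof (rule measurable_bounded_by_integrable_imp_integrable)
    show "g \<in> borel_measurable (lebesgue_on {a<..<b})"
      by (intro continuous_imp_measurable_on_sets_lebesgue continuous_on_subset[OF gc]) auto
    show "(\<lambda>t. C) integrable_on {a<..<b}"
      using integrable_on_Icc_iff_Ioo[of "\<lambda>t. C" a b] integrable_const_ivl by blast
    show "norm (g t) \<le> C" if "t \<in> {a<..<b}" for t
      using D(2) D(3,4)[OF \<gamma>(4)[of t]] that by (simp add: g_def)
  qed auto
  define \<theta> where "\<theta> = (\<lambda>t. integral {a..t} g)"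
  have \<theta>c: "continuous_on {a..b} \<theta>" unfolding \<theta>_def by (rule indefinite_integral_continuous_1[OF gi])
  have \<theta>d: "(\<theta> has_real_derivative g t) (at t within {a<..b})" if "a < t" "t \<le> b" for t
  proof -
    have eq: "{a..b} - {a} = {a<..b}" by auto
    have "continuous (at t within {a<..b}) g"
      using gc that by (simp add: continuous_on_eq_continuous_within)
    then have "((\<lambda>u. integral {a..u} g) has_vector_derivative g t) (at t within ({a..b} - {a}))"
      using that by (intro integral_has_vector_derivative_continuous_at[OF gi]) (auto simp: eq)
    then show ?thesis unfolding \<theta>_def eq by (simp add: has_real_derivative_iff_has_vector_derivative)
  qed
  have \<theta>mono: "c * (t - s) \<le> \<theta> t - \<theta> s" if "a \<le> s" "s \<le> t" "t \<le> b" for s t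
  proof -
    have i: "g integrable_on {s..t}" using integrable_on_subinterval[OF gi] that by auto
    have "\<theta> t - \<theta> s = integral {s..t} g"
      using Henstock_Kurzweil_Integration.integral_combine[OF that(1,2) integrable_on_subinterval[OF gi, of a t]] that
      unfolding \<theta>_def by auto
    also have "integral {s<..<t} g = integral {s..t} g" by (rule integral_open_interval_real[symmetric])
    then have "integral {s..t} g = integral {s<..<t} g" by simp
    also have "integral {s<..<t} g \<ge> integral {s<..<t} (\<lambda>_. c)"
    proof (rule integral_le)
      show "(\<lambda>_. c) integrable_on {s<..<t}"
        using integrable_on_Icc_iff_Ioo[of "\<lambda>t. c" s t] integrable_const_ivl by blast
      show "g integrable_on {s<..<t}" using i by (simp add: integrable_on_Icc_iff_Ioo)
      show "c \<le> g x" if "x \<in> {s<..<t}" for x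
        using D(3)[OF \<gamma>(4)[of x]] that \<open>a \<le> s\<close> \<open>t \<le> b\<close> by (simp add: g_def)
    qed
    moreover have "integral {s<..<t} (\<lambda>_. c) = c * (t - s)"
      using integral_open_interval_real[of s t "\<lambda>_. c"] that(2) by (simp add: mult.commute)
    ultimately show ?thesis by linarith
  qed
  have inj: "inj_on \<theta> {a..b}"
  proof (rule linorder_inj_onI')
    fix s t assume "s \<in> {a..b}" "t \<in> {a..b}" "s < t"
    then have "0 < c * (t - s)" "c * (t - s) \<le> \<theta> t - \<theta> s" using D(2) \<theta>mono[of s t] by auto
    then show "\<theta> s \<noteq> \<theta> t" by linarith
  qed
  define L where "L = \<theta> b"
  have \<theta>a: "\<theta> a = 0" by (simp add: \<theta>_def)
  have L: "0 < L" using \<theta>mono[of a b] \<gamma>(1) D(2) \<theta>a mult_pos_pos[of c "b - a"] unfolding L_def by linarith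
  have img: "\<theta> ` {a..b} = {0..L}"
  proof
    show "\<theta> ` {a..b} \<subseteq> {0..L}"
    proof
      fix u assume "u \<in> \<theta> ` {a..b}"
      then obtain t where t: "t \<in> {a..b}" "u = \<theta> t" by blast
      have "0 \<le> c * (t - a)" "0 \<le> c * (b - t)" using t D(2) by auto
      then show "u \<in> {0..L}" using \<theta>mono[of a t] \<theta>mono[of t b] t \<theta>a unfolding L_def by auto
    qed
    show "{0..L} \<subseteq> \<theta> ` {a..b}"
    proof
      fix u assume "u \<in> {0..L}"
      then obtain t where "a \<le> t" "t \<le> b" "\<theta> t = u"
        using IVT'[of \<theta> a u b] \<theta>c \<gamma>(1) \<theta>a unfolding L_def by auto
      then show "u \<in> \<theta> ` {a..b}" by auto
    qed
  qed
  define \<eta> where "\<eta> = the_inv_into {a..b} \<theta>"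
  have \<eta>: "\<eta> u \<in> {a..b}" "\<theta> (\<eta> u) = u" if "u \<in> {0..L}" for u
    unfolding \<eta>_def using the_inv_into_into[OF inj _ subset_refl] f_the_inv_into_f[OF inj] that img by blast+
  have \<eta>c: "continuous_on {0..L} \<eta>"
    using continuous_on_inv_into[OF \<theta>c compact_Icc inj] unfolding img \<eta>_def .
  have \<eta>0: "\<eta> 0 = a" and \<eta>L: "\<eta> L = b"
    unfolding \<eta>_def L_def using the_inv_into_f_f[OF inj, of a] the_inv_into_f_f[OF inj, of b] \<theta>a \<gamma>(1) by auto
  have \<eta>a: "a < \<eta> u" if "0 < u" "u \<le> L" for u
    using \<eta>[of u] that \<theta>a by (cases "\<eta> u = a") auto
  \<comment> \<open>At positive times the removed point 0 does not affect the filter; this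
    reconciles the half-open domain of differentiability with the closed time interval.\<close>
  have within: "at u within {0..L} = at u within {0<..L}" if "0 < u" for u :: real
    by (rule at_within_nhd[of u "{0<..}"]) (use that in auto)
  have \<eta>d: "(\<eta> has_vector_derivative inverse (g (\<eta> u))) (at u within {0..L})" if u: "0 < u" "u \<le> L" for u
  proof -
    have "g (\<eta> u) \<noteq> 0" using D(2) D(3)[OF \<gamma>(4)[OF \<eta>a[OF u]]] \<eta>(1)[of u] u by (auto simp: g_def)
    moreover have "continuous (at u within {0<..L}) \<eta>"
    proof (rule continuous_within_subset[of u "{0..L}"])
      show "continuous (at u within {0..L}) \<eta>" using \<eta>c u by (simp add: continuous_on_eq_continuous_within)
    qed auto
    ultimately have "(\<eta> has_real_derivative inverse (g (\<eta> u))) (at u within {0<..L})"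
      using \<theta>d[OF \<eta>a[OF u]] \<eta> \<eta>a u
      by (intro has_real_derivative_inverse_within[of \<theta> _ _ _ "{a<..b}"]) auto
    then show ?thesis
      by (simp add: within[OF u(1)] has_real_derivative_iff_has_vector_derivative)
  qed
  have \<eta>img: "\<eta> ` {0..L} \<subseteq> {a..b}" using \<eta>(1) by blast
  have "(\<gamma> \<circ> \<eta>) L \<in> boundary_curves_union \<Omega> X"
  proof (rule integral_curve_from_frontier[OF \<Omega> L])
    show "continuous_on {0..L} (\<gamma> \<circ> \<eta>)"
      by (rule continuous_on_compose[OF \<eta>c continuous_on_subset[OF \<gamma>(2) \<eta>img]])
    show "(\<gamma> \<circ> \<eta>) 0 \<in> frontier \<Omega>" using \<gamma>(3) \<eta>0 by simp
    fix u assume u: "0 < u" "u \<le> L"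
    have \<eta>b: "\<eta> u \<le> b" using \<eta>(1)[of u] u by simp
    show in\<Omega>: "(\<gamma> \<circ> \<eta>) u \<in> \<Omega>" using \<gamma>(4)[OF \<eta>a[OF u] \<eta>b] by simp
    have "(\<gamma> has_vector_derivative g (\<eta> u) *\<^sub>R X (\<gamma> (\<eta> u))) (at (\<eta> u) within \<eta> ` {0..L})"
      using has_vector_derivative_within_subset[OF \<gamma>(5)[OF \<eta>a[OF u] \<eta>b] \<eta>img] by (simp add: g_def)
    from vector_diff_chain_within[OF \<eta>d[OF u] this]
    have "(\<gamma> \<circ> \<eta> has_vector_derivative inverse (g (\<eta> u)) *\<^sub>R g (\<eta> u) *\<^sub>R X (\<gamma> (\<eta> u))) (at u within {0..L})" .
    moreover have "g (\<eta> u) \<noteq> 0" using D(2,3) in\<Omega> by (force simp: g_def)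
    ultimately show "(\<gamma> \<circ> \<eta> has_vector_derivative X ((\<gamma> \<circ> \<eta>) u)) (at u within {0..L})" by simp
  qed
  then show ?thesis using \<eta>L by simp
qed

section \<open>The Wronskian field of the two solutions, and the theorem\<close>

lemma GDERIV_zero_imp_constant_on_ball:
  assumes "\<And>x. x \<in> ball y r \<Longrightarrow> GDERIV w x :> 0"
  obtains k where "\<And>x. x \<in> ball y r \<Longrightarrow> w x = (k::real)"
proof -
  have "(w has_derivative (\<lambda>h. 0)) (at x within ball y r)" if "x \<in> ball y r" for x
    using assms[OF that] unfolding gderiv_def by (simp add: has_derivative_at_withinI)
  then obtain k where "\<And>x. x \<in> ball y r \<Longrightarrow> w x = k"
    using has_derivative_zero_constant[of "ball y r" w] by auto
  then show thesis using that by blast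
qed

text \<open>Solving the equation for the Laplacian: on \<Omega> the weak Laplacian coincides with an
  expression in \<open>u\<close>, its gradient and the coefficients, and this expression is
  continuous.\<close>

lemma dirichlet_solution_weak_lap:
  fixes u :: "'a::euclidean_space \<Rightarrow> real"
  assumes \<Omega>: "open \<Omega>" and D: "C_k_on 1 D \<Omega>" "\<And>x. x \<in> \<Omega> \<Longrightarrow> 0 < D x" and \<sigma>: "continuous_on \<Omega> \<sigma>"
    and u: "dirichlet_solution \<Omega> D \<sigma> f u"
  defines "L \<equiv> \<lambda>x. (\<sigma> x * u x - grad D x \<bullet> grad u x) / D x"
  shows "continuous_on \<Omega> L" "weak_lap \<Omega> (grad u) L"
    "\<And>x. x \<in> \<Omega> \<Longrightarrow> D x * L x + grad D x \<bullet> grad u x - \<sigma> x * u x = 0"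
proof -
  obtain L0 where C1: "C_k_on 1 u \<Omega>" and wl: "weak_laplacian \<Omega> u L0"
    and eq: "\<And>x. x \<in> \<Omega> \<Longrightarrow> D x * L0 x + grad D x \<bullet> grad u x - \<sigma> x * u x = 0"
    using u unfolding dirichlet_solution_def by blast
  have Dc: "continuous_on \<Omega> D" and uc: "continuous_on \<Omega> u"
    using C1_gradD(1)[OF D(1)] C1_gradD(1)[OF C1] by (auto intro: GDERIV_continuous_on)
  show Lc: "continuous_on \<Omega> L"
    unfolding L_def using D(2)
    by (intro continuous_intros Dc uc \<sigma> C1_gradD(2)[OF D(1)] C1_gradD(2)[OF C1]) force
  have "L0 x = L x" if "x \<in> \<Omega>" for x
    using eq[OF that] D(2)[OF that] by (simp add: L_def field_simps)
  then show "weak_lap \<Omega> (grad u) L" by (rule weak_laplacian_imp_weak_lap[OF \<Omega> wl C1 Lc])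
  show "D x * L x + grad D x \<bullet> grad u x - \<sigma> x * u x = 0" if "x \<in> \<Omega>" for x
    using D(2)[OF that] by (simp add: L_def)
qed

lemma weak_lap_linear_combination:
  assumes \<Omega>: "open \<Omega>" and 1: "weak_lap \<Omega> p\<^sub>1 L\<^sub>1" "continuous_on \<Omega> p\<^sub>1" "continuous_on \<Omega> L\<^sub>1"
    and 2: "weak_lap \<Omega> p\<^sub>2 L\<^sub>2" "continuous_on \<Omega> p\<^sub>2" "continuous_on \<Omega> L\<^sub>2"
  shows "weak_lap \<Omega> (\<lambda>x. p\<^sub>1 x - k *\<^sub>R p\<^sub>2 x) (\<lambda>x. L\<^sub>1 x - k * L\<^sub>2 x)"
  unfolding weak_lap_def
proof (intro allI impI)
  fix \<psi> g assume t: "test_on \<Omega> \<psi> g"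
  obtain K where K: "compact K" "K \<subseteq> \<Omega>" "\<And>x. x \<in> \<Omega> - K \<Longrightarrow> \<psi> x = 0" "\<And>x. x \<in> \<Omega> - K \<Longrightarrow> g x = 0"
    "continuous_on \<Omega> g" "continuous_on \<Omega> \<psi>"
    using test_onE[OF t \<Omega>] by metis
  have i: "(\<lambda>x. L\<^sub>1 x * \<psi> x + p\<^sub>1 x \<bullet> g x) integrable_on \<Omega>" "(\<lambda>x. k * (L\<^sub>2 x * \<psi> x + p\<^sub>2 x \<bullet> g x)) integrable_on \<Omega>"
    by (rule compact_support_integrable[OF \<Omega> K(1,2)]; use K 1 2 in \<open>auto intro!: continuous_intros\<close>)+
  have "integral \<Omega> (\<lambda>x. (L\<^sub>1 x - k * L\<^sub>2 x) * \<psi> x + (p\<^sub>1 x - k *\<^sub>R p\<^sub>2 x) \<bullet> g x) =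
      integral \<Omega> (\<lambda>x. (L\<^sub>1 x * \<psi> x + p\<^sub>1 x \<bullet> g x) - k * (L\<^sub>2 x * \<psi> x + p\<^sub>2 x \<bullet> g x))"
    by (rule integral_cong) (simp add: inner_diff_left algebra_simps)
  also have "\<dots> = integral \<Omega> (\<lambda>x. L\<^sub>1 x * \<psi> x + p\<^sub>1 x \<bullet> g x) - integral \<Omega> (\<lambda>x. k * (L\<^sub>2 x * \<psi> x + p\<^sub>2 x \<bullet> g x))"
    by (rule integral_diff[OF i])
  also have "\<dots> = 0" using 1(1) 2(1) t unfolding weak_lap_def by simp
  finally show "integral \<Omega> (\<lambda>x. (L\<^sub>1 x - k * L\<^sub>2 x) * \<psi> x + (p\<^sub>1 x - k *\<^sub>R p\<^sub>2 x) \<bullet> g x) = 0" .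
qed

text \<open>The equation for the first solution is tested with the second solution times \<psi>, and
  conversely. In the difference the zero-order terms and the terms with the product of the two
  gradients cancel.\<close>

lemma weakly_div_free_wronskian:
  fixes u\<^sub>1 u\<^sub>2 D :: "'a::euclidean_space \<Rightarrow> real"
  assumes \<Omega>: "open \<Omega>"
    and u1: "\<And>x. x \<in> \<Omega> \<Longrightarrow> GDERIV u\<^sub>1 x :> p\<^sub>1 x" "continuous_on \<Omega> p\<^sub>1" "continuous_on \<Omega> L\<^sub>1" "weak_lap \<Omega> p\<^sub>1 L\<^sub>1"
      "\<And>x. x \<in> \<Omega> \<Longrightarrow> D x * L\<^sub>1 x + D' x \<bullet> p\<^sub>1 x - \<sigma> x * u\<^sub>1 x = 0"
    and u2: "\<And>x. x \<in> \<Omega> \<Longrightarrow> GDERIV u\<^sub>2 x :> p\<^sub>2 x" "continuous_on \<Omega> p\<^sub>2" "continuous_on \<Omega> L\<^sub>2" "weak_lap \<Omega> p\<^sub>2 L\<^sub>2"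
      "\<And>x. x \<in> \<Omega> \<Longrightarrow> D x * L\<^sub>2 x + D' x \<bullet> p\<^sub>2 x - \<sigma> x * u\<^sub>2 x = 0"
    and D: "\<And>x. x \<in> \<Omega> \<Longrightarrow> GDERIV D x :> D' x" "continuous_on \<Omega> D'" and \<sigma>: "continuous_on \<Omega> \<sigma>"
  shows "weakly_div_free \<Omega> (\<lambda>x. D x *\<^sub>R (u\<^sub>2 x *\<^sub>R p\<^sub>1 x - u\<^sub>1 x *\<^sub>R p\<^sub>2 x))"
  unfolding weakly_div_free_def
proof (intro allI impI)
  fix \<psi> g assume t: "test_on \<Omega> \<psi> g"
  obtain K where K: "compact K" "K \<subseteq> \<Omega>" "\<And>x. x \<in> \<Omega> - K \<Longrightarrow> \<psi> x = 0" "\<And>x. x \<in> \<Omega> - K \<Longrightarrow> g x = 0"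
    "continuous_on \<Omega> g" "continuous_on \<Omega> \<psi>"
    using test_onE[OF t \<Omega>] by metis
  have uc: "continuous_on \<Omega> u\<^sub>1" "continuous_on \<Omega> u\<^sub>2" "continuous_on \<Omega> D"
    using u1(1) u2(1) D(1) by (auto intro: GDERIV_continuous_on)
  let ?F1 = "\<lambda>x. D x * (p\<^sub>1 x \<bullet> (u\<^sub>2 x *\<^sub>R g x + \<psi> x *\<^sub>R p\<^sub>2 x)) + \<sigma> x * u\<^sub>1 x * (u\<^sub>2 x * \<psi> x)"
  let ?F2 = "\<lambda>x. D x * (p\<^sub>2 x \<bullet> (u\<^sub>1 x *\<^sub>R g x + \<psi> x *\<^sub>R p\<^sub>1 x)) + \<sigma> x * u\<^sub>2 x * (u\<^sub>1 x * \<psi> x)"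
  have z: "integral \<Omega> ?F1 = 0" "integral \<Omega> ?F2 = 0"
    by (rule weak_lap_divergence_form[OF \<Omega> u1(4) D u1(5) test_on_mult[OF \<Omega> t u2(1,2)]], assumption+)
       (rule weak_lap_divergence_form[OF \<Omega> u2(4) D u2(5) test_on_mult[OF \<Omega> t u1(1,2)]], assumption+)
  have i: "?F1 integrable_on \<Omega>" "?F2 integrable_on \<Omega>"
    by (rule compact_support_integrable[OF \<Omega> K(1,2)];
        use K uc u1(2) u2(2) \<sigma> in \<open>auto intro!: continuous_intros\<close>)+
  have "integral \<Omega> (\<lambda>x. D x *\<^sub>R (u\<^sub>2 x *\<^sub>R p\<^sub>1 x - u\<^sub>1 x *\<^sub>R p\<^sub>2 x) \<bullet> g x) = integral \<Omega> (\<lambda>x. ?F1 x - ?F2 x)"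
    by (rule integral_cong) (simp add: inner_add_right inner_diff_left inner_commute[of "p\<^sub>2 _" "p\<^sub>1 _"] algebra_simps)
  also have "\<dots> = 0" using integral_diff[OF i] z by simp
  finally show "integral \<Omega> (\<lambda>x. D x *\<^sub>R (u\<^sub>2 x *\<^sub>R p\<^sub>1 x - u\<^sub>1 x *\<^sub>R p\<^sub>2 x) \<bullet> g x) = 0" .
qed

theorem theorem1p1:
  fixes \<Omega> :: "(real ^ 'n) set"
    and D \<sigma> f\<^sub>1 f\<^sub>2 u\<^sub>1 u\<^sub>2 :: "real ^ 'n \<Rightarrow> real"
    and X :: "real ^ 'n \<Rightarrow> real ^ 'n"
  assumes "smooth_bounded_domain \<Omega>"
    and "C_k_on 1 D \<Omega>" and "bounded (D ` \<Omega>)" and "\<exists>c>0. \<forall>x\<in>\<Omega>. c \<le> D x"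
    and "continuous_on \<Omega> \<sigma>" and "\<forall>x\<in>\<Omega>. 0 \<le> \<sigma> x"
    and "continuous_on (frontier \<Omega>) f\<^sub>1" and "continuous_on (frontier \<Omega>) f\<^sub>2"
    and "\<forall>x\<in>frontier \<Omega>. 0 < f\<^sub>2 x"
    and "\<not> (\<lambda>x. f\<^sub>1 x / f\<^sub>2 x) constant_on frontier \<Omega>"
    and "dirichlet_solution \<Omega> D \<sigma> f\<^sub>1 u\<^sub>1" and "dirichlet_solution \<Omega> D \<sigma> f\<^sub>2 u\<^sub>2"
    and "\<forall>x\<in>\<Omega>. X x = u\<^sub>2 x *\<^sub>R grad u\<^sub>1 x - u\<^sub>1 x *\<^sub>R grad u\<^sub>2 x"
  shows "\<Omega> \<subseteq> closure (boundary_curves_union \<Omega> X)"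
proof -
  have \<Omega>: "open \<Omega>" "connected \<Omega>" "\<Omega> \<noteq> {}" "bounded \<Omega>"
    using assms(1) unfolding smooth_bounded_domain_def by auto
  obtain cD where cD: "0 < cD" "\<And>x. x \<in> \<Omega> \<Longrightarrow> cD \<le> D x" using assms(4) by blast
  have Dpos: "0 < D x" if "x \<in> \<Omega>" for x using cD(2)[OF that] cD(1) by linarith
  obtain CD where "\<And>x. x \<in> \<Omega> \<Longrightarrow> norm (D x) \<le> CD" using assms(3) unfolding bounded_iff by blast
  then have CD: "D x \<le> CD" if "x \<in> \<Omega>" for x using that by fastforce
  note D = C1_gradD[OF assms(2)]
  have Dc: "continuous_on \<Omega> D" using D(1) by (rule GDERIV_continuous_on)
  have C1: "C_k_on 1 u\<^sub>1 \<Omega>" "C_k_on 1 u\<^sub>2 \<Omega>" and cl: "continuous_on (closure \<Omega>) u\<^sub>1" "continuous_on (closure \<Omega>) u\<^sub>2"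
    and bd: "\<And>x. x \<in> frontier \<Omega> \<Longrightarrow> u\<^sub>1 x = f\<^sub>1 x" "\<And>x. x \<in> frontier \<Omega> \<Longrightarrow> u\<^sub>2 x = f\<^sub>2 x"
    using assms(11,12) unfolding dirichlet_solution_def by auto
  define p\<^sub>1 where "p\<^sub>1 = grad u\<^sub>1"
  define p\<^sub>2 where "p\<^sub>2 = grad u\<^sub>2"
  note p1 = C1_gradD[OF C1(1), folded p\<^sub>1_def] and p2 = C1_gradD[OF C1(2), folded p\<^sub>2_def]
  define L\<^sub>1 where "L\<^sub>1 = (\<lambda>x. (\<sigma> x * u\<^sub>1 x - grad D x \<bullet> p\<^sub>1 x) / D x)"
  define L\<^sub>2 where "L\<^sub>2 = (\<lambda>x. (\<sigma> x * u\<^sub>2 x - grad D x \<bullet> p\<^sub>2 x) / D x)"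
  have L1: "continuous_on \<Omega> L\<^sub>1" "weak_lap \<Omega> p\<^sub>1 L\<^sub>1" "\<And>x. x \<in> \<Omega> \<Longrightarrow> D x * L\<^sub>1 x + grad D x \<bullet> p\<^sub>1 x - \<sigma> x * u\<^sub>1 x = 0"
    unfolding L\<^sub>1_def p\<^sub>1_def
    using dirichlet_solution_weak_lap[OF \<Omega>(1) assms(2) Dpos assms(5,11)] by blast+
  have L2: "continuous_on \<Omega> L\<^sub>2" "weak_lap \<Omega> p\<^sub>2 L\<^sub>2" "\<And>x. x \<in> \<Omega> \<Longrightarrow> D x * L\<^sub>2 x + grad D x \<bullet> p\<^sub>2 x - \<sigma> x * u\<^sub>2 x = 0"
    unfolding L\<^sub>2_def p\<^sub>2_def
    using dirichlet_solution_weak_lap[OF \<Omega>(1) assms(2) Dpos assms(5,12)] by blast+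
  have weak2: "integral \<Omega> (\<lambda>x. D x * (p\<^sub>2 x \<bullet> g x) + \<sigma> x * u\<^sub>2 x * \<psi> x) = 0" if "test_on \<Omega> \<psi> g" for \<psi> g
    by (rule weak_lap_divergence_form[OF \<Omega>(1) L2(2) D L2(3) that])
  have uc: "continuous_on \<Omega> u\<^sub>1" "continuous_on \<Omega> u\<^sub>2"
    using cl closure_subset continuous_on_subset by blast+
  have \<sigma>nn: "0 \<le> \<sigma> x" if "x \<in> \<Omega>" for x using assms(6) that by blast
  have u2nn: "0 \<le> u\<^sub>2 x" if "x \<in> \<Omega>" for x
  proof (rule weak_minimum_principle[OF \<Omega>(1,4) cl(2) p2 Dc Dpos assms(5) \<sigma>nn _ _ that])
    show "0 \<le> integral \<Omega> (\<lambda>x. D x * (p\<^sub>2 x \<bullet> g x) + \<sigma> x * u\<^sub>2 x * \<psi> x)" if "test_on \<Omega> \<psi> g" for \<psi> g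
      using weak2[OF that] by simp
    show "0 \<le> u\<^sub>2 x" if "x \<in> frontier \<Omega>" for x using bd(2)[OF that] assms(9) that by force
  qed
  \<comment> \<open>A quotient that is not constant forces the frontier to be nonempty, as every
    function is constant on the empty set.\<close>
  obtain x\<^sub>f where xf: "x\<^sub>f \<in> frontier \<Omega>" using assms(10) unfolding constant_on_def by blast
  have closure_frontier: "frontier \<Omega> \<subseteq> closure \<Omega>" by (simp add: frontier_def)
  \<comment> \<open>Otherwise the second solution would vanish on the closure by continuity,
    contrary to its positive boundary value at the frontier point just chosen.\<close>
  have "\<exists>x\<in>\<Omega>. u\<^sub>2 x \<noteq> 0"
  proof (rule ccontr)
    assume "\<not> ?thesis"
    then have "u\<^sub>2 x = 0" if "x \<in> closure \<Omega>" for x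
      using continuous_constant_on_closure[OF cl(2) _ that, of 0] by blast
    then show False using xf closure_frontier bd(2)[OF xf] assms(9) by force
  qed
  then obtain x\<^sub>0 where x0: "x\<^sub>0 \<in> \<Omega>" "u\<^sub>2 x\<^sub>0 \<noteq> 0" by blast
  have u2pos: "0 < u\<^sub>2 x" if "x \<in> \<Omega>" for x
    by (rule strong_minimum_principle[OF \<Omega>(1,2) p2 D Dpos assms(5) \<sigma>nn weak2 u2nn x0 that])
  have u2cl: "0 < u\<^sub>2 x" if "x \<in> closure \<Omega>" for x
    using that u2pos bd(2)[of x] assms(9) closure_Un_frontier[of \<Omega>] by (cases "x \<in> \<Omega>") auto
  have ccl: "compact (closure \<Omega>)" using \<Omega>(4) by (simp add: compact_closure)
  obtain c2 where c2: "0 < c2" "\<And>x. x \<in> closure \<Omega> \<Longrightarrow> c2 \<le> u\<^sub>2 x"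
    using continuous_on_compact_pos_lower_bound[OF ccl cl(2) u2cl] by blast
  obtain C2 where C2: "0 \<le> C2" "\<And>x. x \<in> closure \<Omega> \<Longrightarrow> norm (u\<^sub>2 x) \<le> C2"
    using continuous_on_compact_bound[OF ccl cl(2)] by blast
  obtain C1 where C1': "0 \<le> C1" "\<And>x. x \<in> closure \<Omega> \<Longrightarrow> norm (u\<^sub>1 x) \<le> C1"
    using continuous_on_compact_bound[OF ccl cl(1)] by blast
  have in_cl: "x \<in> closure \<Omega>" if "x \<in> \<Omega>" for x using that closure_subset by blast
  have X: "X x = u\<^sub>2 x *\<^sub>R p\<^sub>1 x - u\<^sub>1 x *\<^sub>R p\<^sub>2 x" if "x \<in> \<Omega>" for x
    using assms(13) that by (simp add: p\<^sub>1_def p\<^sub>2_def)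
  define V where "V = (\<lambda>x. D x *\<^sub>R (u\<^sub>2 x *\<^sub>R p\<^sub>1 x - u\<^sub>1 x *\<^sub>R p\<^sub>2 x))"
  have VX: "V x = D x *\<^sub>R X x" if "x \<in> \<Omega>" for x using X[OF that] by (simp add: V_def)
  have Vc: "continuous_on \<Omega> V" unfolding V_def by (intro continuous_intros Dc uc p1 p2)
  have Vdiv: "weakly_div_free \<Omega> V"
    unfolding V_def
    by (rule weakly_div_free_wronskian[OF \<Omega>(1) p1 L1 p2 L2 D assms(5)])
  define w where "w = (\<lambda>x. u\<^sub>1 x * inverse (u\<^sub>2 x))"
  define w' where "w' = (\<lambda>x. (inverse (u\<^sub>2 x))\<^sup>2 *\<^sub>R (u\<^sub>2 x *\<^sub>R p\<^sub>1 x - u\<^sub>1 x *\<^sub>R p\<^sub>2 x))"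
  have w: "GDERIV w x :> w' x" if "x \<in> \<Omega>" for x
  proof -
    define i where "i = inverse (u\<^sub>2 x)"
    have "i * u\<^sub>2 x = 1" using u2pos[OF that] by (simp add: i_def)
    then have "u\<^sub>1 x *\<^sub>R (- i\<^sup>2) *\<^sub>R p\<^sub>2 x + i *\<^sub>R p\<^sub>1 x = i\<^sup>2 *\<^sub>R (u\<^sub>2 x *\<^sub>R p\<^sub>1 x - u\<^sub>1 x *\<^sub>R p\<^sub>2 x)"
      by (simp add: scaleR_diff_right power2_eq_square mult.assoc mult.commute[of i "u\<^sub>1 x"])
    then show ?thesis
      using GDERIV_mult[OF p1(1)[OF that] GDERIV_inverse[OF p2(1)[OF that]]] u2pos[OF that]
      unfolding w_def w'_def i_def by simp
  qed
  have w'c: "continuous_on \<Omega> w'"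
    unfolding w'_def using u2pos by (intro continuous_intros uc p1 p2) force
  have w_bd: "\<bar>w x\<bar> \<le> C1 / c2" if "x \<in> \<Omega>" for x
  proof -
    have "\<bar>u\<^sub>1 x\<bar> / u\<^sub>2 x \<le> C1 / c2"
      using C1'(2)[OF in_cl[OF that]] c2(2)[OF in_cl[OF that]] c2(1) C1'(1) by (intro frac_le) auto
    then show ?thesis using u2pos[OF that] by (simp add: w_def abs_mult divide_inverse)
  qed
  \<comment> \<open>Here w' \<bullet> V is D |X|^2 / u2^2 and |V|^2 is D^2 |X|^2, so the required
    inequality amounts to c D u2^2 \<le> 1. Adding 1 to the bounds keeps the denominator
    positive.\<close>
  define c where "c = inverse ((CD + 1) * (C2 + 1)\<^sup>2)"
  have CD0: "0 < CD" using CD[OF x0(1)] Dpos[OF x0(1)] by linarith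
  have c: "0 < c" using CD0 C2(1) by (simp add: c_def)
  have w'V: "c * (V x \<bullet> V x) \<le> w' x \<bullet> V x" if x: "x \<in> \<Omega>" for x
  proof -
    let ?X = "u\<^sub>2 x *\<^sub>R p\<^sub>1 x - u\<^sub>1 x *\<^sub>R p\<^sub>2 x"
    have u: "0 < u\<^sub>2 x" "u\<^sub>2 x \<le> C2 + 1" using u2pos[OF x] C2(2)[OF in_cl[OF x]] by auto
    have d: "0 < D x" "D x \<le> CD + 1" using Dpos[OF x] CD[OF x] by auto
    have "D x * (u\<^sub>2 x)\<^sup>2 \<le> (CD + 1) * (C2 + 1)\<^sup>2"
      using u d by (intro mult_mono power_mono) auto
    then have "c * (D x * (u\<^sub>2 x)\<^sup>2) \<le> 1"
      using CD0 C2(1) unfolding c_def by (simp add: pos_divide_le_eq inverse_eq_divide)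
    then have "c * (D x * (u\<^sub>2 x)\<^sup>2) * (D x * (inverse (u\<^sub>2 x))\<^sup>2) \<le> 1 * (D x * (inverse (u\<^sub>2 x))\<^sup>2)"
      using d by (intro mult_right_mono) auto
    moreover have "c * (D x * (u\<^sub>2 x)\<^sup>2) * (D x * (inverse (u\<^sub>2 x))\<^sup>2) = c * D x * D x"
      using u(1) by (simp add: field_simps)
    ultimately have "c * D x * D x * (?X \<bullet> ?X) \<le> D x * (inverse (u\<^sub>2 x))\<^sup>2 * (?X \<bullet> ?X)"
      by (intro mult_right_mono) auto
    then show ?thesis unfolding V_def w'_def inner_scaleR_left inner_scaleR_right by (simp only: mult_ac)
  qed
  have nonstat: "\<exists>y\<in>ball x r. X y \<noteq> 0" if x: "ball x r \<subseteq> \<Omega>" and r: "0 < r" for x r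
  proof (rule ccontr)
    assume "\<not> ?thesis"
    then have X0: "X y = 0" if "y \<in> ball x r" for y using that by blast
    have "GDERIV w y :> 0" if "y \<in> ball x r" for y
    proof -
      have y: "y \<in> \<Omega>" using that x by blast
      have "w' y = 0" using X0[OF that] X[OF y] by (simp add: w'_def)
      then show ?thesis using w[OF y] by simp
    qed
    then obtain k where k: "\<And>y. y \<in> ball x r \<Longrightarrow> w y = k"
      using GDERIV_zero_imp_constant_on_ball by blast
    \<comment> \<open>By linearity \<open>z\<close> solves the same equation and vanishes on the
      ball, where the quotient of the solutions equals \<open>k\<close>. Dividing the equation by
      \<open>D\<close> bounds its Laplacian by |z| + |z'| on compact sets.\<close>
    define z where "z = (\<lambda>y. u\<^sub>1 y - k * u\<^sub>2 y)"
    define z' where "z' = (\<lambda>y. p\<^sub>1 y - k *\<^sub>R p\<^sub>2 y)"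
    define L where "L = (\<lambda>y. L\<^sub>1 y - k * L\<^sub>2 y)"
    have z: "GDERIV z y :> z' y" if "y \<in> \<Omega>" for y
      unfolding z_def z'_def
      using GDERIV_diff[OF p1(1)[OF that] GDERIV_mult[OF GDERIV_const[of k y] p2(1)[OF that]]] by simp
    have z'c: "continuous_on \<Omega> z'" unfolding z'_def by (intro continuous_intros p1 p2)
    have Lc: "continuous_on \<Omega> L" unfolding L_def by (intro continuous_intros L1 L2)
    have wl: "weak_lap \<Omega> z' L"
      unfolding z'_def L_def by (rule weak_lap_linear_combination[OF \<Omega>(1) L1(2) p1(2) L1(1) L2(2) p2(2) L2(1)])
    have L_eq: "L y = (\<sigma> y * z y - grad D y \<bullet> z' y) / D y" for y
      unfolding L_def L\<^sub>1_def L\<^sub>2_def z_def z'_def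
      by (simp add: inner_diff_right algebra_simps diff_divide_distrib add_divide_distrib)
    have bound: "\<exists>B. \<forall>y\<in>C. \<bar>L y\<bar> \<le> B * (\<bar>z y\<bar> + norm (z' y))" if C: "compact C" "C \<subseteq> \<Omega>" for C
    proof -
      obtain b1 where b1: "0 \<le> b1" "\<And>y. y \<in> C \<Longrightarrow> norm (\<sigma> y) \<le> b1"
        using continuous_on_compact_bound[OF C(1) continuous_on_subset[OF assms(5) C(2)]] by blast
      obtain b2 where b2: "0 \<le> b2" "\<And>y. y \<in> C \<Longrightarrow> norm (grad D y) \<le> b2"
        using continuous_on_compact_bound[OF C(1) continuous_on_subset[OF D(2) C(2)]] by blast
      have "\<bar>L y\<bar> \<le> ((b1 + b2) / cD) * (\<bar>z y\<bar> + norm (z' y))" if y: "y \<in> C" for y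
      proof -
        let ?s = "\<bar>z y\<bar> + norm (z' y)"
        have y\<Omega>: "y \<in> \<Omega>" using y C(2) by blast
        have "\<bar>\<sigma> y * z y\<bar> \<le> b1 * ?s"
          unfolding abs_mult using b1 y by (intro mult_mono) auto
        moreover have "\<bar>grad D y \<bullet> z' y\<bar> \<le> b2 * ?s"
          using Cauchy_Schwarz_ineq2[of "grad D y" "z' y"] mult_mono[OF b2(2)[OF y], of "norm (z' y)" ?s] b2(1) by auto
        ultimately have "\<bar>\<sigma> y * z y - grad D y \<bullet> z' y\<bar> \<le> (b1 + b2) * ?s"
          unfolding distrib_right by linarith
        then have "\<bar>\<sigma> y * z y - grad D y \<bullet> z' y\<bar> / D y \<le> (b1 + b2) * ?s / cD"
          using cD(1) cD(2)[OF y\<Omega>] b1(1) b2(1) by (intro frac_le) auto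
        then show ?thesis using Dpos[OF y\<Omega>] by (simp add: L_eq abs_divide)
      qed
      then show ?thesis by blast
    qed
    have z_ball: "z y = 0" if "y \<in> ball x r" for y
    proof -
      have "u\<^sub>2 y \<noteq> 0" using u2pos[of y] that x by force
      then show ?thesis using k[OF that] by (simp add: z_def w_def field_simps)
    qed
    have z\<Omega>: "z y = 0" if "y \<in> \<Omega>" for y
      by (rule unique_continuation[OF \<Omega>(1,2) z z'c Lc wl bound open_ball _ x z_ball that]) (use r in auto)
    \<comment> \<open>Continuity up to the frontier carries the vanishing of \<open>z\<close> over
      to the boundary data, whose quotient would then be the constant \<open>k\<close>.\<close>
    have "continuous_on (closure \<Omega>) z" unfolding z_def by (intro continuous_intros cl)
    then have zcl: "z y = 0" if "y \<in> closure \<Omega>" for y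
      using continuous_constant_on_closure[of \<Omega> z 0 y] z\<Omega> that by blast
    have "f\<^sub>1 y / f\<^sub>2 y = k" if "y \<in> frontier \<Omega>" for y
    proof -
      have "z y = 0" "0 < f\<^sub>2 y" using zcl closure_frontier that assms(9) by blast+
      then show ?thesis using bd(1,2)[OF that] by (simp add: z_def field_simps)
    qed
    then show False using assms(10) unfolding constant_on_def by blast
  qed
  show ?thesis
  proof
    fix x assume x: "x \<in> \<Omega>"
    show "x \<in> closure (boundary_curves_union \<Omega> X)"
      unfolding closure_approachable
    proof (intro allI impI)
      fix e :: real assume e: "0 < e"
      obtain r0 where r0: "0 < r0" "ball x r0 \<subseteq> \<Omega>" using \<Omega>(1) x open_contains_ball by blast
      define r where "r = min r0 e"
      have r: "0 < r" "ball x r \<subseteq> \<Omega>" "r \<le> e" using r0 e by (auto simp: r_def)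
      obtain y where y: "y \<in> ball x r" "X y \<noteq> 0" using nonstat[OF r(2,1)] by blast
      have y\<Omega>: "y \<in> \<Omega>" using y(1) r(2) by blast
      have Vy: "V y \<noteq> 0" using VX[OF y\<Omega>] y(2) Dpos[OF y\<Omega>] by simp
      have r': "0 < r - dist x y" using y(1) by simp
      obtain \<gamma> a b where \<gamma>: "a < b" "continuous_on {a..b} \<gamma>" "\<gamma> a \<in> frontier \<Omega>" "\<gamma> b \<in> ball y (r - dist x y)"
        "\<And>t. a < t \<Longrightarrow> t \<le> b \<Longrightarrow> \<gamma> t \<in> \<Omega>"
        "\<And>t. a < t \<Longrightarrow> t \<le> b \<Longrightarrow> (\<gamma> has_vector_derivative V (\<gamma> t)) (at t within {a..b})"
        using curve_from_frontier[OF \<Omega>(1,4) Vc Vdiv w w'c w_bd c w'V y\<Omega> Vy r'] by metis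
      have "\<gamma> b \<in> boundary_curves_union \<Omega> X"
        by (rule boundary_curve_by_time_change[OF \<Omega>(1) Dc cD CD \<gamma>(1,2,3,5)])
           (use \<gamma>(5,6) VX in auto)
      moreover have "dist (\<gamma> b) x < e"
        using \<gamma>(4) r(3) dist_triangle[of x "\<gamma> b" y] by (simp add: dist_commute)
      ultimately show "\<exists>y\<in>boundary_curves_union \<Omega> X. dist y x < e" by blast
    qed
  qed
qed

end
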